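(* Let $\alpha>0$, $\kappa>0$, $y_d\in L^2(q_t)$ and $f\in L^2(Q_T)$. Then the following problem is uniquely solvable: find $(y,u,\lambda)\in Y\times U\times U$ such that \begin{align*} (y,\tilde y)_{L^2(q_t)}+(\lambda,\partial_t\tilde y-\kappa\Delta\tilde y)_{L^2(Q_T)}&=(y_d,\tilde y)_{L^2(q_t)} &&\forall\,\tilde y\in Y,\\ \alpha(u,\tilde u)_{L^2(Q_T)}+(\lambda,\tilde u)_{L^2(Q_T)}&=0&&\forall\,\tilde u\in U,\\ (\partial_t y-\kappa\Delta y,\tilde\lambda)_{L^2(Q_T)}+(u,\tilde\lambda)_{L^2(Q_T)}&=(f,\tilde\lambda)_{L^2(Q_T)}&&\forall\,\tilde\lambda\in U. \end{align*} Moreover, the condition number of the preconditioned operator $\mathcal B_0^{-1}\mathcal A$ is bounded by \[ \operatorname{cond}\left(\mathcal B_0^{-1}\mathcal A\right)\le\frac{\cos(\pi/7)}{\sin(\pi/14)}\approx 4.05 . \]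
   Context: Let $d\in\{2,3\}$, let $\Omega\subset\mathbb R^d$ be a bounded open domain with Lipschitz boundary, $T>0$, $Q_T=(0,T)\times\Omega$, and let $q_t\subseteq Q_T$ be a (measurable) observation domain. $\Delta$ and $\nabla$ act in the space variable only. Let $H(\Delta,\Omega):=\{v\in L^2(\Omega):\Delta v\in L^2(\Omega)\}$ (weak Laplacian) with norm $\|v\|_{H(\Delta,\Omega)}^2=\|v\|_{L^2(\Omega)}^2+\|\Delta v\|_{L^2(\Omega)}^2$. Let $H^1_{0,*}((0,T);L^2(\Omega))$ be the space of functions in $H^1((0,T);L^2(\Omega))$ vanishing at $t=0$ (not necessarily at $t=T$). Set \[ Y:=L^2((0,T);H(\Delta,\Omega)\cap H_0^1(\Omega))\cap H^1_{0,*}((0,T);L^2(\Omega)),\qquad \|y\|_Y:=\|\partial_t y-\kappa\Delta y\|_{L^2(Q_T)},\qquad U:=L^2(Q_T); \] $Y$ is complete with respect to $\|\cdot\|_Y$. A prime denotes the dual space or the adjoint operator. Define $M:U\to U'$ by $\langle Mu,\lambda\rangle=(u,\lambda)_{L^2(Q_T)}$, $M_{q_t}:U\to U'$ by $\langle M_{q_t}u,\lambda\rangle=(u,\lambda)_{L^2(q_t)}$ (also used as an operator $Y\to Y'$ by restriction), and $L:Y\to U'$ by $\langle Ly,\lambda\rangle=(\partial_ty-\kappa\Delta y,\lambda)_{L^2(Q_T)}$. On $X:=Y\times U\times U$ define the operators $X\to X'$ \[ \mathcal A=\begin{pmatrix}M_{q_t}&0&L'\\0&\alpha M&M\\L&M&0\end{pmatrix},\qquad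 \mathcal B_0=\begin{pmatrix}M_{q_t}+\alpha L'M^{-1}L&0&0\\0&\alpha M&0\\0&0&\frac1\alpha M\end{pmatrix}. \] The problem in the claim is $\mathcal A(y,u,\lambda)=\mathbf b$, with $\mathbf b\in X'$ given by the right-hand sides. The condition number is $\operatorname{cond}(\mathcal B_0^{-1}\mathcal A)=\|\mathcal B_0^{-1}\mathcal A\|\,\|(\mathcal B_0^{-1}\mathcal A)^{-1}\|$, where operator norms on $X$ are taken with respect to the norm $\|\mathbf x\|_{\mathcal B_0}=\langle\mathcal B_0\mathbf x,\mathbf x\rangle^{1/2}$. *)

theory Defs
  imports "HOL-Analysis.Analysis"
begin

definition sq_integrable :: "('a::euclidean_space \<Rightarrow> real) \<Rightarrow> bool" where
  "sq_integrable f \<longleftrightarrow> f \<in> borel_measurable lebesgue \<and> integrable lebesgue (\<lambda>x. (f x)\<^sup>2)"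

lemma sq_integrable_mult:
  assumes "sq_integrable f" "sq_integrable g"
  shows "integrable lebesgue (\<lambda>x. f x * g x)"
proof (rule Bochner_Integration.integrable_bound)
  show "integrable lebesgue (\<lambda>x. (f x)\<^sup>2 + (g x)\<^sup>2)"
    using assms by (simp add: sq_integrable_def)
  show "(\<lambda>x. f x * g x) \<in> borel_measurable lebesgue"
    using assms by (auto simp: sq_integrable_def intro!: borel_measurable_times)
  have "\<bar>a * b\<bar> \<le> a\<^sup>2 + b\<^sup>2" for a b :: real
  proof -
    have "2 * (\<bar>a\<bar> * \<bar>b\<bar>) \<le> a\<^sup>2 + b\<^sup>2" and "0 \<le> \<bar>a\<bar> * \<bar>b\<bar>"
      using sum_squares_bound[of "\<bar>a\<bar>" "\<bar>b\<bar>"] by simp_all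
    then show ?thesis unfolding abs_mult by linarith
  qed
  then show "AE x in lebesgue. norm (f x * g x) \<le> norm ((f x)\<^sup>2 + (g x)\<^sup>2)"
    by (intro AE_I2) (metis real_norm_def abs_of_nonneg sum_power2_ge_zero)
qed

lemma sq_integrable_zero: "sq_integrable (\<lambda>x. 0)"
  by (simp add: sq_integrable_def)

lemma sq_integrable_scale: "sq_integrable f \<Longrightarrow> sq_integrable (\<lambda>x. c * f x)"
  by (auto simp: sq_integrable_def power_mult_distrib intro!: borel_measurable_times)

lemma sq_integrable_add:
  assumes "sq_integrable f" "sq_integrable g"
  shows "sq_integrable (\<lambda>x. f x + g x)"
  using assms sq_integrable_mult[OF assms]
  by (auto simp: sq_integrable_def power2_sum mult.assoc)

quotient_type (overloaded) 'a l2 = "'a::euclidean_space \<Rightarrow> real" / partial: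
  "\<lambda>f g. sq_integrable f \<and> sq_integrable g \<and> (AE x in lebesgue. f x = g x)"
  morphisms rep_l2 l2_class
proof (rule part_equivpI)
  show "\<exists>f::'a \<Rightarrow> real. sq_integrable f \<and> sq_integrable f \<and> (AE x in lebesgue. f x = f x)"
    using sq_integrable_zero by auto
qed (auto intro!: sympI transpI elim: AE_mp)

instantiation l2 :: (euclidean_space) real_vector
begin

lift_definition zero_l2 :: "'a l2" is "\<lambda>x. 0"
  by (simp add: sq_integrable_zero)

lift_definition plus_l2 :: "'a l2 \<Rightarrow> 'a l2 \<Rightarrow> 'a l2" is "\<lambda>f g x. f x + g x"
  by (auto intro: sq_integrable_add)

lift_definition scaleR_l2 :: "real \<Rightarrow> 'a l2 \<Rightarrow> 'a l2" is "\<lambda>c f x. c * f x"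
  by (auto intro: sq_integrable_scale)

definition uminus_l2 :: "'a l2 \<Rightarrow> 'a l2" where "uminus_l2 u = (-1) *\<^sub>R u"

definition minus_l2 :: "'a l2 \<Rightarrow> 'a l2 \<Rightarrow> 'a l2" where "minus_l2 u v = u + (-1) *\<^sub>R v"

instance
proof
  fix a b c :: "'a l2" and r s :: real
  show "a + b + c = a + (b + c)"
    by transfer (auto intro: sq_integrable_add simp: add.assoc)
  show "a + b = b + a"
    by transfer (auto intro: sq_integrable_add simp: add.commute)
  show "0 + a = a"
    by transfer auto
  show "- a + a = 0"
    unfolding uminus_l2_def
    by transfer (auto intro: sq_integrable_zero)
  show "a - b = a + - b"
    unfolding uminus_l2_def minus_l2_def ..
  show "r *\<^sub>R (a + b) = r *\<^sub>R a + r *\<^sub>R b"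
    by transfer (auto intro: sq_integrable_add sq_integrable_scale simp: distrib_left)
  show "(r + s) *\<^sub>R a = r *\<^sub>R a + s *\<^sub>R a"
    by transfer (auto intro: sq_integrable_add sq_integrable_scale simp: distrib_right)
  show "r *\<^sub>R s *\<^sub>R a = (r * s) *\<^sub>R a"
    by transfer (auto intro: sq_integrable_scale simp: mult.assoc)
  show "1 *\<^sub>R a = a"
    by transfer auto
qed

end

instantiation l2 :: (euclidean_space) real_inner
begin

lift_definition inner_l2 :: "'a l2 \<Rightarrow> 'a l2 \<Rightarrow> real"
  is "\<lambda>f g. \<integral>x. f x * g x \<partial>lebesgue"
  by (rule integral_cong_AE) (auto simp: sq_integrable_def)

definition norm_l2 :: "'a l2 \<Rightarrow> real" where "norm_l2 u = sqrt (inner u u)"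

definition sgn_l2 :: "'a l2 \<Rightarrow> 'a l2" where "sgn_l2 u = inverse (norm u) *\<^sub>R u"

definition dist_l2 :: "'a l2 \<Rightarrow> 'a l2 \<Rightarrow> real" where "dist_l2 u v = norm (u - v)"

definition uniformity_l2 :: "('a l2 \<times> 'a l2) filter" where
  "uniformity_l2 = (INF e\<in>{0<..}. principal {(x, y). dist x y < e})"

definition open_l2 :: "'a l2 set \<Rightarrow> bool" where
  "open_l2 S \<longleftrightarrow> (\<forall>x\<in>S. \<forall>\<^sub>F (x', y) in uniformity. x' = x \<longrightarrow> y \<in> S)"

instance
proof
  fix u v w :: "'a l2" and r :: real
  show "inner u v = inner v u"
    by transfer (simp add: mult.commute)
  show "inner (u + v) w = inner u w + inner v w"
    by transfer (simp add: distrib_right sq_integrable_mult)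
  show "inner (r *\<^sub>R u) v = r * inner u v"
    by transfer (simp add: mult.assoc)
  show "0 \<le> inner u u"
    by transfer simp
  show "inner u u = 0 \<longleftrightarrow> u = 0"
  proof transfer
    fix f :: "'a \<Rightarrow> real"
    assume f: "sq_integrable f \<and> sq_integrable f \<and> (AE x in lebesgue. f x = f x)"
    have "integrable lebesgue (\<lambda>x. f x * f x)"
      using f sq_integrable_mult by blast
    then have "(\<integral>x. f x * f x \<partial>lebesgue) = 0 \<longleftrightarrow> (AE x in lebesgue. f x * f x = 0)"
      by (intro integral_nonneg_eq_0_iff_AE) auto
    then show "(\<integral>x. f x * f x \<partial>lebesgue) = 0 \<longleftrightarrow>
        sq_integrable f \<and> sq_integrable (\<lambda>x::'a. 0::real) \<and> (AE x in lebesgue. f x = 0)"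
      using f sq_integrable_zero by auto
  qed
qed (fact norm_l2_def sgn_l2_def dist_l2_def uniformity_l2_def open_l2_def)+

end

text \<open>
  L^2(S) is realised as the closed subspace of the classes that vanish outside S (extension by zero).
\<close>

definition L2_on :: "'a::euclidean_space set \<Rightarrow> 'a l2 set" where
  "L2_on S = {u. AE x in lebesgue. x \<notin> S \<longrightarrow> rep_l2 u x = 0}"

definition inner_on :: "'a::euclidean_space set \<Rightarrow> 'a l2 \<Rightarrow> 'a l2 \<Rightarrow> real" where
  "inner_on S u v = set_lebesgue_integral lebesgue S (\<lambda>x. rep_l2 u x * rep_l2 v x)"

definition pd :: "'a::euclidean_space \<Rightarrow> ('a \<Rightarrow> real) \<Rightarrow> 'a \<Rightarrow> real" where
  "pd i f x = frechet_derivative f (at x) i"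

primrec C_k :: "nat \<Rightarrow> ('a::euclidean_space \<Rightarrow> real) \<Rightarrow> bool" where
  "C_k 0 f \<longleftrightarrow> continuous_on UNIV f"
| "C_k (Suc k) f \<longleftrightarrow> (\<forall>x. f differentiable (at x)) \<and> (\<forall>i\<in>Basis. C_k k (pd i f))"

definition test_fun :: "'a::euclidean_space set \<Rightarrow> ('a \<Rightarrow> real) \<Rightarrow> bool" where
  "test_fun S \<phi> \<longleftrightarrow>
     (\<forall>k. C_k k \<phi>) \<and> compact (closure {x. \<phi> x \<noteq> 0}) \<and> closure {x. \<phi> x \<noteq> 0} \<subseteq> S"

definition weak_pd :: "'a::euclidean_space set \<Rightarrow> 'a \<Rightarrow> 'a l2 \<Rightarrow> 'a l2 \<Rightarrow> bool" where
  "weak_pd S i v w \<longleftrightarrow>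
     (\<forall>\<phi>. test_fun S \<phi> \<longrightarrow> inner v (l2_class (pd i \<phi>)) = - inner w (l2_class \<phi>))"

definition weak_laplacian :: "'a::euclidean_space set \<Rightarrow> 'a l2 \<Rightarrow> 'a l2 \<Rightarrow> bool" where
  "weak_laplacian S v w \<longleftrightarrow>
     (\<forall>\<phi>. test_fun S \<phi> \<longrightarrow>
        inner v (l2_class (\<lambda>x. \<Sum>i\<in>Basis. pd i (pd i \<phi>) x)) = inner w (l2_class \<phi>))"

definition H_Laplace :: "'a::euclidean_space set \<Rightarrow> 'a l2 set" where
  "H_Laplace \<Omega> = {v \<in> L2_on \<Omega>. \<exists>w\<in>L2_on \<Omega>. weak_laplacian \<Omega> v w}"

text \<open>The closure of the test functions in H^1; \<open>Dv i\<close> is the weak derivative of \<open>v\<close> in direction \<open>i\<close>.\<close>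

definition H1_0 :: "'a::euclidean_space set \<Rightarrow> 'a l2 set" where
  "H1_0 \<Omega> = {v \<in> L2_on \<Omega>. \<exists>Dv.
     (\<forall>i\<in>Basis. Dv i \<in> L2_on \<Omega> \<and> weak_pd \<Omega> i v (Dv i)) \<and>
     (\<exists>\<phi>. (\<forall>n::nat. test_fun \<Omega> (\<phi> n)) \<and>
        (\<lambda>n. l2_class (\<phi> n)) \<longlonglongrightarrow> v \<and>
        (\<forall>i\<in>Basis. (\<lambda>n. l2_class (pd i (\<phi> n))) \<longlonglongrightarrow> Dv i))}"

text \<open>
  Near each boundary point, and after a rigid motion, the domain is the strict epigraph of a
  Lipschitz function on the hyperplane orthogonal to \<open>e\<close>.
\<close>

definition lipschitz_boundary :: "'a::euclidean_space set \<Rightarrow> bool" where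
  "lipschitz_boundary \<Omega> \<longleftrightarrow>
     (\<forall>p\<in>frontier \<Omega>. \<exists>\<epsilon>>0. \<exists>e \<gamma> C. norm e = 1 \<and> C-lipschitz_on {x. inner x e = 0} \<gamma> \<and>
        \<Omega> \<inter> ball p \<epsilon> = {x \<in> ball p \<epsilon>. inner x e > \<gamma> (x - inner x e *\<^sub>R e)})"

definition cyl :: "'a::euclidean_space set \<Rightarrow> real \<Rightarrow> (real \<times> 'a) set" where
  "cyl \<Omega> T = {0<..<T} \<times> \<Omega>"

text \<open>
  An element of L^2 of the cylinder is identified with the function \<open>t \<mapsto> slice y t\<close>, which is an
  element of L^2((0,T); L^2). By Fubini, for almost every \<open>t\<close> the first branch applies and the
  slice does not depend on the chosen representative.
\<close>

definition slice :: "(real \<times> 'a::euclidean_space) l2 \<Rightarrow> real \<Rightarrow> 'a l2" where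
  "slice y t =
     (if sq_integrable (\<lambda>x. rep_l2 y (t, x)) then l2_class (\<lambda>x. rep_l2 y (t, x)) else 0)"

definition spatial_laplacian ::
  "'a::euclidean_space set \<Rightarrow> real \<Rightarrow> (real \<times> 'a) l2 \<Rightarrow> (real \<times> 'a) l2 \<Rightarrow> bool" where
  "spatial_laplacian \<Omega> T y g \<longleftrightarrow>
     (AE t in lebesgue. t \<in> {0<..<T} \<longrightarrow> weak_laplacian \<Omega> (slice y t) (slice g t))"

text \<open>
  L^2((0,T); V) for V the intersection of \<open>H_Laplace \<Omega>\<close> and \<open>H1_0 \<Omega>\<close>, normed as \<open>H_Laplace \<Omega>\<close>:
  measurability and square-integrability of the V-valued function say that the slicewise
  Laplacians form an element of L^2 of the cylinder.
\<close>

definition L2_H_Laplace_H1_0 :: "'a::euclidean_space set \<Rightarrow> real \<Rightarrow> (real \<times> 'a) l2 set" where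
  "L2_H_Laplace_H1_0 \<Omega> T = {y \<in> L2_on (cyl \<Omega> T).
     (AE t in lebesgue. t \<in> {0<..<T} \<longrightarrow> slice y t \<in> H_Laplace \<Omega> \<inter> H1_0 \<Omega>) \<and>
     (\<exists>g\<in>L2_on (cyl \<Omega> T). spatial_laplacian \<Omega> T y g)}"

text \<open>
  H^1((0,T); L^2) functions whose continuous representative \<open>z\<close> vanishes at time 0;
  \<open>(1, 0)\<close> is the time direction.
\<close>

definition H1_0star :: "'a::euclidean_space set \<Rightarrow> real \<Rightarrow> (real \<times> 'a) l2 set" where
  "H1_0star \<Omega> T = {y \<in> L2_on (cyl \<Omega> T).
     (\<exists>w\<in>L2_on (cyl \<Omega> T). weak_pd (cyl \<Omega> T) (1, 0) y w) \<and>
     (\<exists>z. continuous_on {0..T} z \<and> z 0 = 0 \<and>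
        (AE t in lebesgue. t \<in> {0<..<T} \<longrightarrow> slice y t = z t))}"

definition Y_space :: "'a::euclidean_space set \<Rightarrow> real \<Rightarrow> (real \<times> 'a) l2 set" where
  "Y_space \<Omega> T = L2_H_Laplace_H1_0 \<Omega> T \<inter> H1_0star \<Omega> T"

abbreviation U_space :: "'a::euclidean_space set \<Rightarrow> real \<Rightarrow> (real \<times> 'a) l2 set" where
  "U_space \<Omega> T \<equiv> L2_on (cyl \<Omega> T)"

definition time_deriv ::
  "'a::euclidean_space set \<Rightarrow> real \<Rightarrow> (real \<times> 'a) l2 \<Rightarrow> (real \<times> 'a) l2" where
  "time_deriv \<Omega> T y = (THE w. w \<in> L2_on (cyl \<Omega> T) \<and> weak_pd (cyl \<Omega> T) (1, 0) y w)"

definition laplace ::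
  "'a::euclidean_space set \<Rightarrow> real \<Rightarrow> (real \<times> 'a) l2 \<Rightarrow> (real \<times> 'a) l2" where
  "laplace \<Omega> T y = (THE g. g \<in> L2_on (cyl \<Omega> T) \<and> spatial_laplacian \<Omega> T y g)"

definition heat ::
  "real \<Rightarrow> 'a::euclidean_space set \<Rightarrow> real \<Rightarrow> (real \<times> 'a) l2 \<Rightarrow> (real \<times> 'a) l2" where
  "heat \<kappa> \<Omega> T y = time_deriv \<Omega> T y - \<kappa> *\<^sub>R laplace \<Omega> T y"

definition norm_Y :: "real \<Rightarrow> 'a::euclidean_space set \<Rightarrow> real \<Rightarrow> (real \<times> 'a) l2 \<Rightarrow> real" where
  "norm_Y \<kappa> \<Omega> T y = norm (heat \<kappa> \<Omega> T y)"

text \<open>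
  A functional on a subspace \<open>S\<close> is represented by a function that is zero outside \<open>S\<close>, so that
  equality of functionals is equality of functions.
\<close>

definition restr :: "'v set \<Rightarrow> ('v \<Rightarrow> real) \<Rightarrow> 'v \<Rightarrow> real" where
  "restr S l = (\<lambda>x. if x \<in> S then l x else 0)"

definition dual :: "'v::real_vector set \<Rightarrow> ('v \<Rightarrow> real) \<Rightarrow> ('v \<Rightarrow> real) set" where
  "dual S N = {l.
     (\<forall>x\<in>S. \<forall>y\<in>S. l (x + y) = l x + l y) \<and>
     (\<forall>c. \<forall>x\<in>S. l (c *\<^sub>R x) = c * l x) \<and>
     (\<exists>C. \<forall>x\<in>S. \<bar>l x\<bar> \<le> C * N x) \<and>
     (\<forall>x. x \<notin> S \<longrightarrow> l x = 0)}"

definition op_norm :: "'v::real_vector set \<Rightarrow> ('v \<Rightarrow> real) \<Rightarrow> ('v \<Rightarrow> 'v) \<Rightarrow> ennreal" where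
  "op_norm S N F = (SUP x \<in> S - {0}. ennreal (N (F x) / N x))"

definition cond_number :: "'v::real_vector set \<Rightarrow> ('v \<Rightarrow> real) \<Rightarrow> ('v \<Rightarrow> 'v) \<Rightarrow> ennreal" where
  "cond_number S N F =
     (if bij_betw F S S then op_norm S N F * op_norm S N (the_inv_into S F) else \<infinity>)"

type_synonym 'a st = "(real \<times> 'a) l2"

definition X_space :: "'a::euclidean_space set \<Rightarrow> real \<Rightarrow> ('a st \<times> 'a st \<times> 'a st) set" where
  "X_space \<Omega> T = Y_space \<Omega> T \<times> U_space \<Omega> T \<times> U_space \<Omega> T"

definition norm_X ::
  "real \<Rightarrow> 'a::euclidean_space set \<Rightarrow> real \<Rightarrow> 'a st \<times> 'a st \<times> 'a st \<Rightarrow> real" where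
  "norm_X \<kappa> \<Omega> T = (\<lambda>(y, u, l). sqrt ((norm_Y \<kappa> \<Omega> T y)\<^sup>2 + (norm u)\<^sup>2 + (norm l)\<^sup>2))"

definition X_dual ::
  "real \<Rightarrow> 'a::euclidean_space set \<Rightarrow> real \<Rightarrow> ('a st \<times> 'a st \<times> 'a st \<Rightarrow> real) set" where
  "X_dual \<kappa> \<Omega> T = dual (X_space \<Omega> T) (norm_X \<kappa> \<Omega> T)"

definition op_M :: "'a::euclidean_space set \<Rightarrow> real \<Rightarrow> 'a st \<Rightarrow> 'a st \<Rightarrow> real" where
  "op_M \<Omega> T u = restr (U_space \<Omega> T) (\<lambda>m. inner_on (cyl \<Omega> T) u m)"

definition op_Mq ::
  "'a::euclidean_space set \<Rightarrow> real \<Rightarrow> (real \<times> 'a) set \<Rightarrow> 'a st \<Rightarrow> 'a st \<Rightarrow> real" where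
  "op_Mq \<Omega> T q y = restr (Y_space \<Omega> T) (\<lambda>z. inner_on q y z)"

definition op_L :: "real \<Rightarrow> 'a::euclidean_space set \<Rightarrow> real \<Rightarrow> 'a st \<Rightarrow> 'a st \<Rightarrow> real" where
  "op_L \<kappa> \<Omega> T y = restr (U_space \<Omega> T) (\<lambda>m. inner_on (cyl \<Omega> T) (heat \<kappa> \<Omega> T y) m)"

text \<open>The adjoint of \<open>op_L\<close>, with U identified with its bidual.\<close>

definition op_L' :: "real \<Rightarrow> 'a::euclidean_space set \<Rightarrow> real \<Rightarrow> 'a st \<Rightarrow> 'a st \<Rightarrow> real" where
  "op_L' \<kappa> \<Omega> T l = restr (Y_space \<Omega> T) (\<lambda>z. op_L \<kappa> \<Omega> T z l)"

definition op_Minv :: "'a::euclidean_space set \<Rightarrow> real \<Rightarrow> ('a st \<Rightarrow> real) \<Rightarrow> 'a st" where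
  "op_Minv \<Omega> T = the_inv_into (U_space \<Omega> T) (op_M \<Omega> T)"

definition op_A ::
  "real \<Rightarrow> real \<Rightarrow> 'a::euclidean_space set \<Rightarrow> real \<Rightarrow> (real \<times> 'a) set \<Rightarrow>
   'a st \<times> 'a st \<times> 'a st \<Rightarrow> 'a st \<times> 'a st \<times> 'a st \<Rightarrow> real" where
  "op_A \<alpha> \<kappa> \<Omega> T q = (\<lambda>(y, u, l). restr (X_space \<Omega> T) (\<lambda>(y', u', l').
       (op_Mq \<Omega> T q y y' + op_L' \<kappa> \<Omega> T l y')
     + (\<alpha> * op_M \<Omega> T u u' + op_M \<Omega> T l u')
     + (op_L \<kappa> \<Omega> T y l' + op_M \<Omega> T u l')))"

definition op_B0 ::
  "real \<Rightarrow> real \<Rightarrow> 'a::euclidean_space set \<Rightarrow> real \<Rightarrow> (real \<times> 'a) set \<Rightarrow>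
   'a st \<times> 'a st \<times> 'a st \<Rightarrow> 'a st \<times> 'a st \<times> 'a st \<Rightarrow> real" where
  "op_B0 \<alpha> \<kappa> \<Omega> T q = (\<lambda>(y, u, l). restr (X_space \<Omega> T) (\<lambda>(y', u', l').
       (op_Mq \<Omega> T q y y' + \<alpha> * op_L' \<kappa> \<Omega> T (op_Minv \<Omega> T (op_L \<kappa> \<Omega> T y)) y')
     + \<alpha> * op_M \<Omega> T u u'
     + 1 / \<alpha> * op_M \<Omega> T l l'))"

definition norm_B0 ::
  "real \<Rightarrow> real \<Rightarrow> 'a::euclidean_space set \<Rightarrow> real \<Rightarrow> (real \<times> 'a) set \<Rightarrow>
   'a st \<times> 'a st \<times> 'a st \<Rightarrow> real" where
  "norm_B0 \<alpha> \<kappa> \<Omega> T q x = sqrt (op_B0 \<alpha> \<kappa> \<Omega> T q x x)"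

definition B0inv_A ::
  "real \<Rightarrow> real \<Rightarrow> 'a::euclidean_space set \<Rightarrow> real \<Rightarrow> (real \<times> 'a) set \<Rightarrow>
   'a st \<times> 'a st \<times> 'a st \<Rightarrow> 'a st \<times> 'a st \<times> 'a st" where
  "B0inv_A \<alpha> \<kappa> \<Omega> T q x =
     the_inv_into (X_space \<Omega> T) (op_B0 \<alpha> \<kappa> \<Omega> T q) (op_A \<alpha> \<kappa> \<Omega> T q x)"

end

theory Submission
  imports Defs
begin

text \<open>
  Eliminating \<open>u\<close> and \<open>\<lambda>\<close> turns the optimality system into a problem on \<open>Y\<close> for the inner product
  \<open>(y, z)\<close> on \<open>q\<close> plus \<open>\<alpha> (Ly, Lz)\<close>, so solvability is the Riesz theorem once \<open>Y\<close> is complete.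
  Completeness rests on the a priori estimate
  \<open>\<parallel>\<partial>\<^sub>t y\<parallel>^2 + \<kappa>^2 \<parallel>\<Delta> y\<parallel>^2 \<le> \<parallel>\<partial>\<^sub>t y - \<kappa> \<Delta> y\<parallel>^2\<close>, that is, on \<open>(\<partial>\<^sub>t y, \<Delta> y) \<le> 0\<close>, which is obtained as the limit of
  the corresponding inequality for backward difference quotients in time.

  For the condition number, order the unknowns as \<open>(u, \<lambda>, y)\<close> and rescale. The form of \<open>\<A>\<close> is
  then a compression of the tridiagonal matrix \<open>J\<close> with rows \<open>(1,1,0), (1,0,1), (0,1,0)\<close>
  (and of the identity), whose norm is \<open>2 cos (\<pi>/7)\<close>. The block LDL factorisation of \<open>\<A>\<close> has
  Schur complements \<open>1, -1, 1\<close>, which makes the form of the inverse explicit and bounds it by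
  that of the matrix with rows \<open>(1,0,1), (0,0,1), (1,1,1)\<close>, whose norm is \<open>1 / (2 sin (\<pi>/14))\<close>.
\<close>

subsection \<open>The space \<open>L^2\<close>\<close>

text \<open>The time derivative of \<open>y\<close> is known only in \<open>L^2\<close>, so its
  slices need not lie in \<open>H1_0 \<Omega>\<close> and cannot be inserted into Green's formula; a
  backward difference of \<open>y\<close> keeps the spatial regularity of \<open>y\<close> in almost
  every slice. Backward differences also suit the initial condition: extended by 0 to negative
  times, \<open>y\<close> has no jump at 0, so the quotients stay bounded by the norm of the time
  derivative, while the jump at \<open>T\<close> acts only outside the cylinder.

  The norm of \<open>Y\<close> is the \<open>L^2\<close> norm of the image under the heat operator,
  so completeness of \<open>Y\<close> is read as completeness of the range of that operator.

  The characteristic polynomial of \<open>J\<close> is \<open>x^3 - x^2 - 2 x + 1\<close>, with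
  roots \<open>2 cos (pi/7)\<close>, \<open>2 sin (pi/14)\<close> and
  \<open>- 2 cos (2 pi/7)\<close>. The second matrix is the inverse of \<open>J\<close> with the
  sign of the first unknown reversed, so the bound is the ratio of the largest to the smallest
  modulus of an eigenvalue of \<open>J\<close>. Both norms follow from bounds on quadratic forms
  because the preconditioned operator is self-adjoint for the inner product of
  \<open>B_0\<close>.\<close>

lemma sq_integrable_rep_l2 [simp]: "sq_integrable (rep_l2 u)"
  using Quotient_rep_reflp[OF Quotient_l2, of u] by simp

lemma l2_class_rep_l2 [simp]: "l2_class (rep_l2 u) = u"
  by (rule Quotient_abs_rep[OF Quotient_l2])

lemma rep_l2_class: "sq_integrable f \<Longrightarrow> AE x in lebesgue. rep_l2 (l2_class f) x = f x"
  using Quotient_rep_abs[OF Quotient_l2, of f] by auto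

lemma l2_class_eq_iff:
  assumes "sq_integrable f" "sq_integrable g"
  shows "l2_class f = l2_class g \<longleftrightarrow> (AE x in lebesgue. f x = g x)"
  using Quotient_rel[OF Quotient_l2, of f g] assms by auto

lemma l2_class_add:
  "sq_integrable f \<Longrightarrow> sq_integrable g \<Longrightarrow> l2_class f + l2_class g = l2_class (\<lambda>x. f x + g x)"
  by (rule plus_l2.abs_eq) auto

lemma l2_class_scaleR: "sq_integrable f \<Longrightarrow> c *\<^sub>R l2_class f = l2_class (\<lambda>x. c * f x)"
  by (rule scaleR_l2.abs_eq) auto

lemma sq_integrable_diff:
  "sq_integrable f \<Longrightarrow> sq_integrable g \<Longrightarrow> sq_integrable (\<lambda>x. f x - g x)"
  using sq_integrable_add[of f "\<lambda>x. (-1) * g x"] sq_integrable_scale[of g "-1"] by simp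

lemma l2_class_diff:
  "sq_integrable f \<Longrightarrow> sq_integrable g \<Longrightarrow> l2_class f - l2_class g = l2_class (\<lambda>x. f x - g x)"
  using l2_class_add[of f "\<lambda>x. (-1) * g x"] sq_integrable_scale[of g "-1"] l2_class_scaleR[of g "-1"]
  by (simp add: minus_l2_def)

lemma l2_class_zero: "l2_class (\<lambda>x. 0) = 0"
  by (simp add: zero_l2.abs_eq)

lemma inner_l2_class:
  "sq_integrable f \<Longrightarrow> sq_integrable g \<Longrightarrow>
    inner (l2_class f) (l2_class g) = (\<integral>x. f x * g x \<partial>lebesgue)"
  by (rule inner_l2.abs_eq) auto

lemma norm_l2_class: "sq_integrable f \<Longrightarrow> (norm (l2_class f))\<^sup>2 = (\<integral>x. (f x)\<^sup>2 \<partial>lebesgue)"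
  unfolding power2_norm_eq_inner by (simp only: inner_l2_class power2_eq_square)

lemma rep_l2_add: "AE x in lebesgue. rep_l2 (u + v) x = rep_l2 u x + rep_l2 v x"
  using rep_l2_class[OF sq_integrable_add, of "rep_l2 u" "rep_l2 v"]
    l2_class_add[of "rep_l2 u" "rep_l2 v"] by simp

lemma rep_l2_scaleR: "AE x in lebesgue. rep_l2 (c *\<^sub>R u) x = c * rep_l2 u x"
  using rep_l2_class[OF sq_integrable_scale, of "rep_l2 u" c] l2_class_scaleR[of "rep_l2 u" c] by simp

lemma rep_l2_zero: "AE x in lebesgue. rep_l2 0 x = 0"
  using rep_l2_class[OF sq_integrable_zero] by (simp add: l2_class_zero)

lemma AE_lebesgue_iff: "(AE x in lebesgue. P x) \<longleftrightarrow> (AE x in lborel. P x)"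
  by (rule AE_completion_iff)

lemma sq_integrable_AE_cong:
  assumes "sq_integrable f" "g \<in> borel_measurable lebesgue" "AE x in lebesgue. f x = g x"
  shows "sq_integrable g"
  unfolding sq_integrable_def
proof
  show "g \<in> borel_measurable lebesgue" by fact
  show "integrable lebesgue (\<lambda>x. (g x)\<^sup>2)"
    using assms by (subst integrable_cong_AE[where g="\<lambda>x. (f x)\<^sup>2"]) (auto simp: sq_integrable_def)
qed

lemma sq_integrable_bound:
  assumes "sq_integrable f" "g \<in> borel_measurable lebesgue" "\<And>x. \<bar>g x\<bar> \<le> \<bar>f x\<bar>"
  shows "sq_integrable g"
  unfolding sq_integrable_def
proof
  show g: "g \<in> borel_measurable lebesgue" by fact
  show "integrable lebesgue (\<lambda>x. (g x)\<^sup>2)"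
    by (rule Bochner_Integration.integrable_bound[where f="\<lambda>x. (f x)\<^sup>2"])
       (use assms g in \<open>auto simp: sq_integrable_def abs_le_square_iff\<close>)
qed

text \<open>The representative \<open>rep_l2\<close> is only Lebesgue measurable, and a section of
  such a function can fail to be measurable. Fubini arguments therefore start from a Borel
  representative, which can moreover be made to vanish everywhere, not just almost everywhere, off
  \<open>S\<close>.\<close>

lemma l2_borel_on:
  fixes u :: "'a::euclidean_space l2"
  assumes "u \<in> L2_on S" "S \<in> sets borel"
  obtains f where "f \<in> borel_measurable borel" "sq_integrable f" "u = l2_class f"
    "\<And>x. x \<notin> S \<Longrightarrow> f x = 0"
proof -
  have "rep_l2 u \<in> borel_measurable (completion lborel)"
    using sq_integrable_rep_l2[of u] by (simp add: sq_integrable_def)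
  then obtain g where g: "g \<in> borel_measurable lborel" "AE x in lborel. rep_l2 u x = g x"
    using completion_ex_borel_measurable_real by blast
  define f where "f = (\<lambda>x. indicator S x * g x)"
  have f: "f \<in> borel_measurable borel"
    using g assms(2) unfolding f_def by measurable
  have ae: "AE x in lebesgue. rep_l2 u x = f x"
    using g(2) assms(1)[unfolded L2_on_def] unfolding AE_lebesgue_iff f_def
    by (auto simp: indicator_def AE_lebesgue_iff)
  have "f \<in> borel_measurable lebesgue"
    by (rule measurable_completion) (use f in simp)
  then have sq: "sq_integrable f"
    using sq_integrable_AE_cong[OF sq_integrable_rep_l2 _ ae] by simp
  have "u = l2_class f"
    using ae l2_class_eq_iff[of "rep_l2 u" f] sq by simp
  with f sq show ?thesis
    by (intro that[of f]) (auto simp: f_def)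
qed

lemma l2_borel:
  fixes u :: "'a::euclidean_space l2"
  obtains f where "f \<in> borel_measurable borel" "sq_integrable f" "u = l2_class f"
  using l2_borel_on[of u UNIV] by (auto simp: L2_on_def)

lemma l2_class_in_L2_on:
  assumes "sq_integrable f" "AE x in lebesgue. x \<notin> S \<longrightarrow> f x = 0"
  shows "l2_class f \<in> L2_on S"
  using rep_l2_class[OF assms(1)] assms(2) unfolding L2_on_def by auto

lemma borel_lebesgue: "f \<in> borel_measurable borel \<Longrightarrow> f \<in> borel_measurable lebesgue"
  by (rule measurable_completion) simp

lemma sq_integrable_borel:
  assumes "f \<in> borel_measurable borel"
  shows "sq_integrable f \<longleftrightarrow> integrable lborel (\<lambda>x. (f x)\<^sup>2)"
proof -
  have "integrable lebesgue (\<lambda>x. (f x)\<^sup>2) \<longleftrightarrow> integrable lborel (\<lambda>x. (f x)\<^sup>2)"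
    by (rule integrable_completion) (use assms in measurable)
  then show ?thesis using borel_lebesgue[OF assms] by (simp add: sq_integrable_def)
qed

lemma integral_borel:
  fixes f :: "'a::euclidean_space \<Rightarrow> real"
  assumes "f \<in> borel_measurable borel"
  shows "(\<integral>x. f x \<partial>lebesgue) = (\<integral>x. f x \<partial>lborel)"
  using assms by (intro integral_completion) simp

lemma inner_l2_borel:
  assumes "sq_integrable f" "sq_integrable g" "f \<in> borel_measurable borel" "g \<in> borel_measurable borel"
  shows "inner (l2_class f) (l2_class g) = (\<integral>x. f x * g x \<partial>lborel)"
  using assms by (subst inner_l2_class) (auto intro!: integral_borel)

lemma integrable_mult_borel:
  assumes "sq_integrable f" "sq_integrable g" "f \<in> borel_measurable borel" "g \<in> borel_measurable borel"
  shows "integrable lborel (\<lambda>x. f x * g x)"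
proof -
  have "integrable lebesgue (\<lambda>x. f x * g x) \<longleftrightarrow> integrable lborel (\<lambda>x. f x * g x)"
    by (rule integrable_completion) (use assms in measurable)
  then show ?thesis using sq_integrable_mult[OF assms(1,2)] by simp
qed

lemma subspace_L2_on: "subspace (L2_on S)"
proof (rule subspaceI)
  show "0 \<in> L2_on S" using rep_l2_zero unfolding L2_on_def by auto
next
  fix u v assume "u \<in> L2_on S" "v \<in> L2_on S"
  then show "u + v \<in> L2_on S"
    using rep_l2_add[of u v] unfolding L2_on_def by auto
next
  fix u c assume "u \<in> L2_on S"
  then show "c *\<^sub>R u \<in> L2_on S"
    using rep_l2_scaleR[of c u] unfolding L2_on_def by auto
qed

text \<open>The choice of the rate \<open>4^k\<close> makes \<open>\<Sum>k. 4^k * (f (k+1) - f k)^2\<close> integrable, so that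
  almost everywhere \<open>\<bar>f (k+1) - f k\<bar>\<close> is dominated by a multiple of \<open>2^-k\<close>.\<close>

lemma l2_rapid_Cauchy_convergent:
  fixes u :: "nat \<Rightarrow> 'a::euclidean_space l2"
  assumes u: "\<And>k n. k \<le> n \<Longrightarrow> norm (u n - u k) \<le> (1/4) ^ k"
  shows "\<exists>v. u \<longlonglongrightarrow> v"
proof -
  have "\<exists>f. f \<in> borel_measurable borel \<and> sq_integrable f \<and> u n = l2_class f" for n
    using l2_borel by metis
  then obtain f where f: "\<And>n. f n \<in> borel_measurable borel" "\<And>n. sq_integrable (f n)"
    "\<And>n. u n = l2_class (f n)" by metis
  note [measurable] = f(1)
  have diff: "(\<integral>\<^sup>+x. ennreal ((f n x - f k x)\<^sup>2) \<partial>lborel) = ennreal ((norm (u n - u k))\<^sup>2)" for n k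
  proof -
    have sq: "sq_integrable (\<lambda>x. f n x - f k x)" by (intro sq_integrable_diff f)
    have "(norm (u n - u k))\<^sup>2 = (\<integral>x. (f n x - f k x)\<^sup>2 \<partial>lebesgue)"
      using norm_l2_class[OF sq] l2_class_diff[OF f(2) f(2)] f(3) by metis
    also have "\<dots> = (\<integral>x. (f n x - f k x)\<^sup>2 \<partial>lborel)"
      by (rule integral_borel) measurable
    finally show ?thesis
      using sq by (subst nn_integral_eq_integral) (auto simp: sq_integrable_borel)
  qed
  have "(\<integral>\<^sup>+x. (\<Sum>k. ennreal (4 ^ k * (f (Suc k) x - f k x)\<^sup>2)) \<partial>lborel)
      = (\<Sum>k. (\<integral>\<^sup>+x. ennreal (4 ^ k * (f (Suc k) x - f k x)\<^sup>2) \<partial>lborel))"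
    by (rule nn_integral_suminf) measurable
  also have "\<dots> = (\<Sum>k. ennreal (4 ^ k * (norm (u (Suc k) - u k))\<^sup>2))"
    by (simp add: ennreal_mult nn_integral_cmult diff)
  also have "\<dots> \<le> (\<Sum>k. ennreal ((1/4) ^ k))"
  proof (intro suminf_le ennreal_leI)
    fix k
    have "(norm (u (Suc k) - u k))\<^sup>2 \<le> ((1/4) ^ k)\<^sup>2"
      by (intro power_mono u) auto
    then have "4 ^ k * (norm (u (Suc k) - u k))\<^sup>2 \<le> 4 ^ k * ((1/4) ^ k)\<^sup>2"
      by simp
    also have "\<dots> = (1/4) ^ k"
      by (simp add: power2_eq_square power_divide)
    finally show "4 ^ k * (norm (u (Suc k) - u k))\<^sup>2 \<le> (1/4) ^ k" .
  qed auto
  also have "\<dots> < \<infinity>"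
    by (subst suminf_ennreal2) (auto intro: summable_geometric)
  finally have "AE x in lborel. (\<Sum>k. ennreal (4 ^ k * (f (Suc k) x - f k x)\<^sup>2)) \<noteq> \<infinity>"
    by (intro nn_integral_PInf_AE) auto
  then have conv: "AE x in lborel. convergent (\<lambda>n. f n x)"
  proof eventually_elim
    fix x assume fin: "(\<Sum>k. ennreal (4 ^ k * (f (Suc k) x - f k x)\<^sup>2)) \<noteq> \<infinity>"
    then obtain C where C: "(\<Sum>k. ennreal (4 ^ k * (f (Suc k) x - f k x)\<^sup>2)) = ennreal C" "C \<ge> 0"
      using ennreal_cases[of "\<Sum>k. ennreal (4 ^ k * (f (Suc k) x - f k x)\<^sup>2)"] by (metis infinity_ennreal_def)
    have "\<bar>f (Suc k) x - f k x\<bar> \<le> sqrt C * (1/2) ^ k" for k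
    proof -
      have "ennreal (4 ^ k * (f (Suc k) x - f k x)\<^sup>2) \<le> ennreal C"
      proof -
        define d where "d = (\<lambda>k. ennreal (4 ^ k * (f (Suc k) x - f k x)\<^sup>2))"
        have "sum d {k} \<le> suminf d"
          by (rule sum_le_suminf) auto
        then show ?thesis using C(1) by (simp add: d_def)
      qed
      then have "4 ^ k * (f (Suc k) x - f k x)\<^sup>2 \<le> C"
        using C(2) by (simp add: ennreal_le_iff)
      then have "(2 ^ k * \<bar>f (Suc k) x - f k x\<bar>)\<^sup>2 \<le> C"
        by (simp add: power_mult_distrib power_mult[symmetric] mult.commute[of _ 2])
           (simp add: power_mult)
      then have "2 ^ k * \<bar>f (Suc k) x - f k x\<bar> \<le> sqrt C"
        by (rule real_le_rsqrt)
      then show ?thesis by (simp add: field_simps)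
    qed
    then have "summable (\<lambda>k. f (Suc k) x - f k x)"
      using summable_comparison_test'[of "\<lambda>k. sqrt C * (1/2)^k" 0 "\<lambda>k. f (Suc k) x - f k x"]
        summable_mult[OF summable_geometric[of "1/2::real"], of "sqrt C"] by simp
    then have "convergent (\<lambda>n. f n x - f 0 x)"
      using summable_iff_convergent[of "\<lambda>k. f (Suc k) x - f k x"] by (simp only: sum_lessThan_telescope[of "\<lambda>i. f i x"])
    then have "convergent (\<lambda>n. (f n x - f 0 x) + f 0 x)"
      by (rule convergent_add[OF _ convergent_const])
    then show "convergent (\<lambda>n. f n x)" by simp
  qed
  define g where "g = (\<lambda>x. lim (\<lambda>n. f n x))"
  have g [measurable]: "g \<in> borel_measurable borel"
    unfolding g_def by measurable
  have lim: "AE x in lborel. (\<lambda>n. f n x) \<longlonglongrightarrow> g x"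
    using conv by eventually_elim (auto simp: g_def convergent_LIMSEQ_iff)
  have dist: "(\<integral>\<^sup>+x. ennreal ((g x - f k x)\<^sup>2) \<partial>lborel) \<le> ennreal (((1/4) ^ k)\<^sup>2)" for k
  proof -
    have "(\<integral>\<^sup>+x. ennreal ((g x - f k x)\<^sup>2) \<partial>lborel)
        = (\<integral>\<^sup>+x. liminf (\<lambda>n. ennreal ((f n x - f k x)\<^sup>2)) \<partial>lborel)"
    proof (rule nn_integral_cong_AE)
      show "AE x in lborel. ennreal ((g x - f k x)\<^sup>2) = liminf (\<lambda>n. ennreal ((f n x - f k x)\<^sup>2))"
        using lim
      proof eventually_elim
        fix x assume "(\<lambda>n. f n x) \<longlonglongrightarrow> g x"
        then have "(\<lambda>n. ennreal ((f n x - f k x)\<^sup>2)) \<longlonglongrightarrow> ennreal ((g x - f k x)\<^sup>2)"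
          by (intro tendsto_ennrealI tendsto_intros)
        then show "ennreal ((g x - f k x)\<^sup>2) = liminf (\<lambda>n. ennreal ((f n x - f k x)\<^sup>2))"
          using lim_imp_Liminf[OF sequentially_bot] by metis
      qed
    qed
    also have "\<dots> \<le> liminf (\<lambda>n. (\<integral>\<^sup>+x. ennreal ((f n x - f k x)\<^sup>2) \<partial>lborel))"
      by (rule nn_integral_liminf) measurable
    also have "\<dots> \<le> liminf (\<lambda>n::nat. ennreal (((1/4) ^ k)\<^sup>2))"
    proof (rule Liminf_mono)
      show "\<forall>\<^sub>F n in sequentially. (\<integral>\<^sup>+x. ennreal ((f n x - f k x)\<^sup>2) \<partial>lborel) \<le> ennreal (((1/4) ^ k)\<^sup>2)"
        unfolding diff using eventually_ge_at_top[of k]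
        by eventually_elim (intro ennreal_leI power_mono u, auto)
    qed
    finally show ?thesis by (simp add: Liminf_const)
  qed
  have sqd: "sq_integrable (\<lambda>x. g x - f k x)" for k
    using dist[of k] by (subst sq_integrable_borel) 
      (auto intro!: integrableI_bounded intro: le_less_trans simp: top.not_eq_extremum[symmetric] top_unique)
  have sqg: "sq_integrable g"
    using sq_integrable_add[OF sqd[of 0] f(2)[of 0]] by simp
  have "norm (u k - l2_class g) \<le> (1/4) ^ k" for k
  proof -
    have "ennreal ((norm (l2_class g - u k))\<^sup>2) = (\<integral>\<^sup>+x. ennreal ((g x - f k x)\<^sup>2) \<partial>lborel)"
      using sqd[of k] norm_l2_class[OF sqd] l2_class_diff[OF sqg f(2)] f(3)[of k]
      by (subst nn_integral_eq_integral) (auto simp: sq_integrable_borel integral_borel)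
    also have "\<dots> \<le> ennreal (((1/4) ^ k)\<^sup>2)" by (rule dist)
    finally have "(norm (l2_class g - u k))\<^sup>2 \<le> ((1/4) ^ k)\<^sup>2"
      by (simp add: ennreal_le_iff)
    then show ?thesis
      using power2_le_imp_le[of "norm (l2_class g - u k)" "(1/4)^k"] by (simp add: norm_minus_commute)
  qed
  then have "(\<lambda>k. u k - l2_class g) \<longlonglongrightarrow> 0"
    using Lim_null_comparison[of "\<lambda>k. u k - l2_class g" "\<lambda>k. (1/4)^k" sequentially]
      LIMSEQ_power_zero[of "1/4::real"] by simp
  then have "u \<longlonglongrightarrow> l2_class g" by (rule LIM_zero_cancel)
  then show ?thesis by blast
qed

lemma complete_l2: "complete (UNIV :: 'a::euclidean_space l2 set)"
  unfolding complete_def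
proof safe
  fix u :: "nat \<Rightarrow> 'a l2" assume "Cauchy u"
  then have "\<exists>N. \<forall>m\<ge>N. \<forall>n\<ge>N. dist (u m) (u n) < (1/4)^k" for k :: nat
    using metric_CauchyD[of u "(1/4)^k"] by auto
  then obtain N where N: "\<And>k m n. m \<ge> N k \<Longrightarrow> n \<ge> N k \<Longrightarrow> dist (u m) (u n) < (1/4)^k"
    by metis
  \<comment> \<open>The partial sums dominate \<open>N k\<close> and are monotone; the summand
    \<open>k\<close> makes the index sequence strictly increasing.\<close>
  define r where "r = (\<lambda>k. (\<Sum>i\<le>k. N i) + k)"
  have r: "strict_mono r" "\<And>k. r k \<ge> N k"
    unfolding r_def by (auto intro!: strict_monoI_Suc simp: member_le_sum trans_le_add1)
  have "\<exists>v. (u \<circ> r) \<longlonglongrightarrow> v"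
  proof (rule l2_rapid_Cauchy_convergent)
    fix k n :: nat assume "k \<le> n"
    then have "r n \<ge> N k" using r strict_mono_less_eq[OF r(1)] le_trans by metis
    then show "norm ((u \<circ> r) n - (u \<circ> r) k) \<le> (1/4)^k"
      using N[of k "r n" "r k"] r(2)[of k] by (simp add: dist_norm)
  qed
  then obtain v where "(u \<circ> r) \<longlonglongrightarrow> v" by blast
  then have "u \<longlonglongrightarrow> v" using \<open>Cauchy u\<close> r(1) Cauchy_converges_subseq by blast
  then show "\<exists>l\<in>UNIV. u \<longlonglongrightarrow> l" by blast
qed

subsection \<open>Hilbert space arguments\<close>

lemma parallelogram: "(norm (a + b :: 'a::real_inner))\<^sup>2 + (norm (a - b))\<^sup>2 = 2 * (norm a)\<^sup>2 + 2 * (norm b)\<^sup>2"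
  unfolding power2_norm_eq_inner inner_add_left inner_add_right inner_diff_left inner_diff_right
  by linarith

text \<open>The representing vector minimises \<open>\<parallel>x\<parallel>^2 - 2 l x\<close>; by the parallelogram law every minimising
  sequence is a Cauchy sequence.\<close>

lemma riesz_representation:
  fixes S :: "'a::real_inner set"
  assumes S: "subspace S" "complete S"
    and add: "\<And>x y. x \<in> S \<Longrightarrow> y \<in> S \<Longrightarrow> l (x + y) = l x + l y"
    and scale: "\<And>c x. x \<in> S \<Longrightarrow> l (c *\<^sub>R x) = c * l x"
    and bound: "\<And>x. x \<in> S \<Longrightarrow> \<bar>l x\<bar> \<le> C * norm x"
  obtains r where "r \<in> S" "\<And>x. x \<in> S \<Longrightarrow> l x = inner r x"
proof -
  define J where "J = (\<lambda>x. (norm x)\<^sup>2 - 2 * l x)"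
  have low: "- (C\<^sup>2) \<le> J x" if "x \<in> S" for x
  proof -
    have "2 * (C * norm x) \<le> C\<^sup>2 + (norm x)\<^sup>2"
      using sum_squares_bound[of C "norm x"] by (simp add: mult.assoc)
    then show ?thesis using bound[OF that] unfolding J_def by (simp add: abs_le_iff)
  qed
  have zero: "0 \<in> S" using S(1) by (rule subspace_0)
  define d where "d = Inf (J ` S)"
  have bdd: "bdd_below (J ` S)" using low by (auto simp: bdd_below_def)
  have d: "d \<le> J x" if "x \<in> S" for x
    unfolding d_def using bdd that by (auto intro: cInf_lower)
  have "\<exists>x\<in>S. J x < d + inverse (real (Suc n))" for n
  proof -
    have "Inf (J ` S) < d + inverse (real (Suc n))" unfolding d_def[symmetric] by simp
    then show ?thesis using bdd zero by (subst (asm) cInf_less_iff) auto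
  qed
  then obtain u where u: "\<And>n. u n \<in> S" "\<And>n. J (u n) < d + inverse (real (Suc n))" by metis
  have par: "(norm (x - y))\<^sup>2 \<le> 2 * (J x - d) + 2 * (J y - d)" if "x \<in> S" "y \<in> S" for x y
  proof -
    define m where "m = (1/2) *\<^sub>R (x + y)"
    have m: "m \<in> S" unfolding m_def using S(1) that by (intro subspace_scale subspace_add)
    have lm: "l m = (l x + l y) / 2"
      unfolding m_def using that S(1) by (simp add: scale add subspace_add)
    have nm: "(norm m)\<^sup>2 = (norm (x + y))\<^sup>2 / 4"
      unfolding m_def by (simp add: power_divide)
    have "(norm (x - y))\<^sup>2 = 2 * (norm x)\<^sup>2 + 2 * (norm y)\<^sup>2 - 4 * (norm m)\<^sup>2"
      using parallelogram[of x y] nm by simp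
    also have "\<dots> = 2 * J x + 2 * J y - 4 * J m"
      unfolding J_def lm by (simp add: field_simps)
    also have "\<dots> \<le> 2 * (J x - d) + 2 * (J y - d)"
      using d[OF m] by simp
    finally show ?thesis .
  qed
  have "Cauchy u"
  proof (rule metric_CauchyI)
    fix e :: real assume "e > 0"
    then obtain N where N: "inverse (real (Suc N)) < e\<^sup>2 / 4"
      using reals_Archimedean[of "e\<^sup>2/4"] by auto
    have small: "J (u n) - d < e\<^sup>2 / 4" if "n \<ge> N" for n
    proof -
      have "inverse (real (Suc n)) \<le> inverse (real (Suc N))"
        using that by (intro le_imp_inverse_le) auto
      then show ?thesis using u(2)[of n] N by linarith
    qed
    show "\<exists>N. \<forall>m\<ge>N. \<forall>n\<ge>N. dist (u m) (u n) < e"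
    proof (intro exI allI impI)
      fix m n assume mn: "m \<ge> N" "n \<ge> N"
      have "(norm (u m - u n))\<^sup>2 < e\<^sup>2"
        using par[OF u(1) u(1), of m n] small[OF mn(1)] small[OF mn(2)] by simp
      then show "dist (u m) (u n) < e"
        unfolding dist_norm by (rule power2_less_imp_less) (use \<open>e > 0\<close> in simp)
    qed
  qed
  then obtain r where r: "r \<in> S" "u \<longlonglongrightarrow> r"
    using S(2) u(1) unfolding complete_def by blast
  have "(\<lambda>n. l (u n)) \<longlonglongrightarrow> l r"
  proof -
    have diff: "l (u n) - l r = l (u n - r)" for n
      using add[of "u n" "(-1) *\<^sub>R r"] scale[of r "-1"] u(1) r(1) subspace_scale[OF S(1) r(1), of "-1"]
      by simp
    have "(\<lambda>n. C * norm (u n - r)) \<longlonglongrightarrow> C * 0"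
      by (rule tendsto_mult[OF tendsto_const tendsto_norm_zero[OF LIM_zero[OF r(2)]]])
    then have "(\<lambda>n. l (u n) - l r) \<longlonglongrightarrow> 0"
      using Lim_null_comparison[of "\<lambda>n. l (u n) - l r" "\<lambda>n. C * norm (u n - r)" sequentially]
        bound[OF subspace_diff[OF S(1) u(1) r(1)]] unfolding diff by simp
    then show ?thesis by (rule LIM_zero_cancel)
  qed
  then have Ju: "(\<lambda>n. J (u n)) \<longlonglongrightarrow> J r"
    unfolding J_def by (intro tendsto_intros r(2))
  moreover have "(\<lambda>n. d + inverse (real (Suc n))) \<longlonglongrightarrow> d + 0"
    by (rule tendsto_add[OF tendsto_const LIMSEQ_inverse_real_of_nat])
  ultimately have "J r \<le> d + 0"
    by (rule LIMSEQ_le) (use u(2) in \<open>auto intro: less_imp_le\<close>)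
  then have min: "J r \<le> J x" if "x \<in> S" for x
    using d[OF that] by simp
  have "l x = inner r x" if x: "x \<in> S" for x
  proof (rule ccontr)
    assume ne: "l x \<noteq> inner r x"
    define c where "c = inner r x - l x"
    have q: "0 \<le> 2 * t * c + t\<^sup>2 * (norm x)\<^sup>2" for t :: real
    proof -
      have "J r \<le> J (r + t *\<^sub>R x)"
        using S(1) x r by (intro min subspace_add subspace_scale)
      moreover have "J (r + t *\<^sub>R x) = J r + 2 * t * c + t\<^sup>2 * (norm x)\<^sup>2"
        unfolding J_def c_def power2_norm_eq_inner using S(1) x r
        by (simp add: add scale subspace_scale inner_add_left inner_add_right inner_commute[of x r] algebra_simps power2_eq_square)
      ultimately show ?thesis by simp
    qed
    \<comment> \<open>The quadratic in \<open>t\<close> is negative near its minimiser, which is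
      \<open>- c\<close> divided by the squared norm of \<open>x\<close>. The added 1 allows
      \<open>x = 0\<close> and leaves the sign of the value unchanged.\<close>
    define m where "m = (norm x)\<^sup>2 + 1"
    define t where "t = - c / m"
    have m: "m > 0" unfolding m_def by (simp add: add_nonneg_pos)
    then have "t * m = - c" unfolding t_def by simp
    then have tm: "t\<^sup>2 * m = - (t * c)"
      by (metis mult.assoc mult_minus_right power2_eq_square)
    have "2 * t * c + t\<^sup>2 * (norm x)\<^sup>2 \<le> 2 * t * c + t\<^sup>2 * m"
      unfolding m_def by (simp add: mult_left_mono)
    also have "\<dots> = - (c\<^sup>2 / m)"
      unfolding tm by (simp add: t_def power2_eq_square)
    also have "\<dots> < 0"
    proof -
      have "c \<noteq> 0" using ne unfolding c_def by simp
      then show ?thesis using m by simp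
    qed
    finally show False using q[of t] by simp
  qed
  then show ?thesis using that r(1) by blast
qed

text \<open>The Riesz representative on \<open>V\<close> of the functional \<open>inner x\<close> is
  the orthogonal projection of \<open>x\<close>, so its difference to \<open>x\<close> is orthogonal
  to \<open>V\<close>.\<close>

lemma closed_subspace_eq_if_orthogonal_trivial:
  fixes S V :: "'a::real_inner set"
  assumes "subspace S" "complete S" "subspace V" "closed V" "V \<subseteq> S"
    and orth: "\<And>x. x \<in> S \<Longrightarrow> (\<And>v. v \<in> V \<Longrightarrow> inner x v = 0) \<Longrightarrow> x = 0"
  shows "V = S"
proof
  show "S \<subseteq> V"
  proof
    fix x assume x: "x \<in> S"
    have "complete V"
      using assms(2,4,5) complete_closed_subset by blast
    then obtain r where r: "r \<in> V" "\<And>v. v \<in> V \<Longrightarrow> inner x v = inner r v"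
      using riesz_representation[OF assms(3), of "inner x" "norm x"]
      by (metis Cauchy_Schwarz_ineq2 inner_add_right inner_scaleR_right)
    then have "x - r = 0"
      using assms(1,5) x by (intro orth) (auto simp: inner_diff_left intro: subspace_diff)
    with r show "x \<in> V" by simp
  qed
qed fact

text \<open>Applied with \<open>a x y = b (F x) y\<close> for an operator \<open>F\<close> that is self-adjoint in the inner product \<open>b\<close>,
  and \<open>y\<close> a multiple of \<open>F x\<close>, this bounds the norm of \<open>F\<close>.\<close>

lemma polarised_bound:
  fixes a :: "'v::real_vector \<Rightarrow> 'v \<Rightarrow> real"
  assumes X: "subspace X"
    and a: "\<And>x y. x \<in> X \<Longrightarrow> y \<in> X \<Longrightarrow> a (x + y) (x + y) - a (x - y) (x - y) = 4 * a x y"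
    and n: "\<And>x y. x \<in> X \<Longrightarrow> y \<in> X \<Longrightarrow> n (x + y) + n (x - y) = 2 * n x + 2 * n y"
    and bound: "\<And>x. x \<in> X \<Longrightarrow> \<bar>a x x\<bar> \<le> c * n x"
    and "x \<in> X" "y \<in> X"
  shows "2 * a x y \<le> c * (n x + n y)"
proof -
  have "4 * a x y \<le> c * n (x + y) + c * n (x - y)"
    using a[OF assms(5,6)] bound[OF subspace_add[OF X assms(5,6)]] bound[OF subspace_diff[OF X assms(5,6)]]
    by (simp add: abs_le_iff)
  also have "\<dots> = c * (2 * n x + 2 * n y)"
    by (simp only: n[OF assms(5,6)] flip: distrib_left)
  finally show ?thesis by (simp add: algebra_simps)
qed

subsection \<open>Smooth functions\<close>

lemma pd_eqI: "(f has_derivative D) (at x) \<Longrightarrow> pd i f x = D i"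
  unfolding pd_def using frechet_derivative_at by metis

lemma has_derivative_pd:
  "f differentiable (at x) \<Longrightarrow> (f has_derivative (\<lambda>h. pd h f x)) (at x)"
  unfolding pd_def by (simp add: frechet_derivative_works)

text \<open>The product rule pairs a derivative with an undifferentiated factor, so the induction
  for products needs the lower order of smoothness of that factor. Continuity is only demanded at
  the bottom of the recursion and is recovered there from differentiability.\<close>

lemma C_k_Suc_imp: "C_k (Suc k) f \<Longrightarrow> C_k k f"
proof (induction k arbitrary: f)
  case 0
  then show ?case
    by (auto intro!: differentiable_imp_continuous_on simp: differentiable_on_def intro: differentiable_at_withinI)
next
  case (Suc k)
  from Suc.prems have "\<forall>x. f differentiable (at x)" "\<forall>i\<in>Basis. C_k k (pd i f)"
    using Suc.IH by (auto simp del: C_k.simps(1) simp: C_k.simps(2)[of "Suc k"])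
  then show ?case by simp
qed

lemma C_k_differentiable: "C_k (Suc k) f \<Longrightarrow> f differentiable (at x)"
  by simp

lemma C_k_const: "C_k k (\<lambda>x. c)"
proof (induction k arbitrary: c)
  case (Suc k)
  have "pd i (\<lambda>x::'a. c) = (\<lambda>x. 0)" for i :: 'a
    by (rule ext) (rule pd_eqI, rule has_derivative_const)
  with Suc show ?case by simp
qed simp

lemma C_k_add: "C_k k f \<Longrightarrow> C_k k g \<Longrightarrow> C_k k (\<lambda>x. f x + g x)"
proof (induction k arbitrary: f g)
  case (Suc k)
  have d: "f differentiable (at x)" "g differentiable (at x)" for x
    using C_k_differentiable[OF Suc.prems(1)] C_k_differentiable[OF Suc.prems(2)] by blast+
  have D: "C_k k (pd i f)" "C_k k (pd i g)" if "i \<in> Basis" for i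
    using Suc.prems that by simp_all
  have "pd i (\<lambda>x. f x + g x) = (\<lambda>x. pd i f x + pd i g x)" for i
    by (rule ext) (rule pd_eqI, rule has_derivative_add; rule has_derivative_pd; rule d)
  then show ?case using d D by (simp add: Suc.IH differentiable_add)
qed (auto intro: continuous_on_add)

lemma C_k_mult: "C_k k f \<Longrightarrow> C_k k g \<Longrightarrow> C_k k (\<lambda>x. f x * g x)"
proof (induction k arbitrary: f g)
  case (Suc k)
  have d: "f differentiable (at x)" "g differentiable (at x)" for x
    using C_k_differentiable[OF Suc.prems(1)] C_k_differentiable[OF Suc.prems(2)] by blast+
  have D: "C_k k (pd i f)" "C_k k (pd i g)" if "i \<in> Basis" for i
    using Suc.prems that by simp_all
  have "pd i (\<lambda>x. f x * g x) = (\<lambda>x. f x * pd i g x + pd i f x * g x)" for i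
    by (rule ext) (rule pd_eqI, rule has_derivative_mult; rule has_derivative_pd; rule d)
  then show ?case
    using d D Suc.IH C_k_Suc_imp[OF Suc.prems(1)] C_k_Suc_imp[OF Suc.prems(2)]
    by (simp add: C_k_add differentiable_mult)
qed (auto intro: continuous_on_mult)

lemma C_k_prod: "(\<And>j. j \<in> J \<Longrightarrow> C_k k (f j)) \<Longrightarrow> C_k k (\<lambda>x. \<Prod>j\<in>J. f j x)"
  by (induction J rule: infinite_finite_induct) (auto intro: C_k_const C_k_mult simp del: C_k.simps)

lemma C_k_scale: "C_k k f \<Longrightarrow> C_k k (\<lambda>x. c * f x)"
  by (rule C_k_mult[OF C_k_const])

text \<open>The derivative in direction \<open>i\<close> is the constant
  \<open>i \<bullet> v\<close> times the composition of \<open>pd 1 g\<close> with the same affine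
  map, so the induction stays within this form.\<close>

lemma C_k_compose_affine:
  fixes g :: "real \<Rightarrow> real" and v :: "'a::euclidean_space"
  assumes "C_k k g"
  shows "C_k k (\<lambda>x. g (x \<bullet> v + c))"
  using assms
proof (induction k arbitrary: g)
  case 0
  then show ?case
    by (auto intro!: continuous_on_compose2[of UNIV g] continuous_intros)
next
  case (Suc k)
  have d: "((\<lambda>x. g (x \<bullet> v + c)) has_derivative (\<lambda>h. pd (h \<bullet> v) g (x \<bullet> v + c))) (at x)" for x :: 'a
  proof (rule has_derivative_compose[of "\<lambda>x. x \<bullet> v + c" "\<lambda>h. h \<bullet> v"])
    show "((\<lambda>x. x \<bullet> v + c) has_derivative (\<lambda>h. h \<bullet> v)) (at x)"
      by (auto intro!: derivative_eq_intros)
    show "(g has_derivative (\<lambda>h. pd h g (x \<bullet> v + c))) (at (x \<bullet> v + c))"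
      using Suc.prems by (intro has_derivative_pd) auto
  qed
  have lin: "pd (r * 1) g t = r * pd 1 g t" for r t
  proof -
    have "linear (\<lambda>h. pd h g t)"
      using Suc.prems by (intro has_derivative_linear[OF has_derivative_pd]) auto
    then show ?thesis by (metis linear_scale real_scaleR_def)
  qed
  have "pd i (\<lambda>x. g (x \<bullet> v + c)) = (\<lambda>x. (i \<bullet> v) * pd 1 g (x \<bullet> v + c))" for i
  proof
    fix x show "pd i (\<lambda>x. g (x \<bullet> v + c)) x = (i \<bullet> v) * pd 1 g (x \<bullet> v + c)"
      using pd_eqI[OF d[of x], of i] lin[of "i \<bullet> v"] by simp
  qed
  moreover have "(\<lambda>x. g (x \<bullet> v + c)) differentiable (at x)" for x :: 'a
    using d unfolding differentiable_def by blast
  moreover have "C_k k (pd 1 g)" using Suc.prems by simp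
  ultimately show ?case using C_k_scale[OF Suc.IH] by simp
qed

lemma C_k_real_Suc_iff:
  fixes f :: "real \<Rightarrow> real"
  assumes "\<And>x. (f has_real_derivative f' x) (at x)"
  shows "C_k (Suc k) f \<longleftrightarrow> C_k k f'"
proof -
  have d: "(f has_derivative (*) (f' x)) (at x)" for x
    using assms[of x] by (simp add: has_field_derivative_def)
  have "pd 1 f = f'"
  proof
    fix x show "pd 1 f x = f' x" using pd_eqI[OF d[of x], of 1] by simp
  qed
  moreover have "f differentiable (at x)" for x
    using d unfolding differentiable_def by blast
  ultimately show ?thesis by simp
qed

text \<open>For \<open>p = 1\<close> this is the usual flat function \<open>exp (- 1 / s)\<close>.
  The polynomial factor in \<open>1 / s\<close> makes the family closed under
  differentiation.\<close>

definition exp_decay :: "real poly \<Rightarrow> real \<Rightarrow> real" where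
  "exp_decay p s = (if s > 0 then poly p (1 / s) * exp (- (1 / s)) else 0)"

lemma exp_decay_tendsto_0: "(exp_decay p \<longlongrightarrow> 0) (at_right 0)"
proof -
  have "((\<lambda>r. \<Sum>i\<le>degree p. coeff p i * (r ^ i / exp r)) \<longlongrightarrow> (\<Sum>i\<le>degree p. coeff p i * 0)) at_top"
    by (intro tendsto_sum tendsto_mult tendsto_const tendsto_power_div_exp_0)
  then have "((\<lambda>r. poly p r * exp (- r)) \<longlongrightarrow> 0) at_top"
    by (simp add: poly_altdef exp_minus divide_inverse sum_distrib_right mult.assoc)
  then have "((\<lambda>s. poly p (inverse s) * exp (- inverse s)) \<longlongrightarrow> 0) (at_right 0)"
    by (rule filterlim_compose[OF _ filterlim_inverse_at_top_right])
  then show ?thesis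
    by (rule Lim_transform_eventually)
       (auto simp: exp_decay_def eventually_at_filter inverse_eq_divide)
qed

text \<open>In the variable \<open>r = 1 / s\<close> differentiation by \<open>s\<close> is
  \<open>- r^2\<close> times differentiation by \<open>r\<close>, and the derivative of
  \<open>p(r) exp (- r)\<close> is \<open>(p' - p)(r) exp (- r)\<close>. At 0 the difference
  quotient is again a function of the family and tends to 0.\<close>

lemma exp_decay_has_derivative:
  "(exp_decay p has_real_derivative exp_decay (monom 1 2 * (p - pderiv p)) s) (at s)"
proof -
  consider "s > 0" | "s < 0" | "s = 0" by linarith
  then show ?thesis
  proof cases
    case 1
    have "((\<lambda>s. poly p (1 / s) * exp (- (1 / s))) has_real_derivative
        exp_decay (monom 1 2 * (p - pderiv p)) s) (at s)"
      using 1 unfolding exp_decay_def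
      by (auto intro!: derivative_eq_intros DERIV_chain2[OF poly_DERIV]
          simp: poly_monom power2_eq_square field_simps)
    then show ?thesis
      by (rule has_field_derivative_transform_within_open[of _ _ _ "{0<..}"])
         (use 1 in \<open>auto simp: exp_decay_def\<close>)
  next
    case 2
    have "((\<lambda>s. 0) has_real_derivative 0) (at s)" by simp
    then have "(exp_decay p has_real_derivative 0) (at s)"
      by (rule has_field_derivative_transform_within_open[of _ _ _ "{..<0}"])
         (use 2 in \<open>auto simp: exp_decay_def\<close>)
    then show ?thesis using 2 by (simp add: exp_decay_def)
  next
    case 3
    \<comment> \<open>Prefixing the coefficient 0 multiplies the polynomial by its argument
      \<open>1 / t\<close>, which turns the function into its difference quotient at 0.\<close>
    have "((\<lambda>t. exp_decay p t / t) \<longlongrightarrow> 0) (at_right 0)"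
      using exp_decay_tendsto_0[of "pCons 0 p"]
      by (rule Lim_transform_eventually)
         (auto simp: exp_decay_def eventually_at_filter)
    moreover have "((\<lambda>t. exp_decay p t / t) \<longlongrightarrow> 0) (at_left 0)"
      by (rule Lim_transform_eventually[OF tendsto_const])
         (auto simp: exp_decay_def eventually_at_filter)
    ultimately have "((\<lambda>t. exp_decay p t / t) \<longlongrightarrow> 0) (at 0)"
      by (simp add: filterlim_at_split)
    then show ?thesis
      using 3 by (simp add: DERIV_def exp_decay_def)
  qed
qed

lemma C_k_exp_decay: "C_k k (exp_decay p)"
proof (induction k arbitrary: p)
  case 0
  then show ?case
    using exp_decay_has_derivative by (auto simp: continuous_on_eq_continuous_at intro: DERIV_isCont)
next
  case (Suc k)
  then show ?case using C_k_real_Suc_iff[OF exp_decay_has_derivative] by simp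
qed

subsection \<open>Test functions\<close>

lemma test_funI:
  assumes "\<And>k. C_k k \<phi>" "compact K" "K \<subseteq> S" "\<And>x. x \<notin> K \<Longrightarrow> \<phi> x = 0"
  shows "test_fun S \<phi>"
proof -
  have "{x. \<phi> x \<noteq> 0} \<subseteq> K" using assms(4) by auto
  then have sub: "closure {x. \<phi> x \<noteq> 0} \<subseteq> K"
    using assms(2) by (simp add: closure_minimal compact_imp_closed)
  then have "compact (closure {x. \<phi> x \<noteq> 0})"
    using assms(2) compact_Int_closed[of K "closure {x. \<phi> x \<noteq> 0}"] by (simp add: Int_absorb1)
  with sub assms show ?thesis unfolding test_fun_def by blast
qed

lemma test_fun_support:
  assumes "test_fun S \<phi>"
  obtains K where "compact K" "K \<subseteq> S" "\<And>x. x \<notin> K \<Longrightarrow> \<phi> x = 0"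
proof
  show "compact (closure {x. \<phi> x \<noteq> 0})" "closure {x. \<phi> x \<noteq> 0} \<subseteq> S"
    using assms unfolding test_fun_def by auto
  fix x assume "x \<notin> closure {x. \<phi> x \<noteq> 0}"
  then show "\<phi> x = 0" using closure_subset[of "{x. \<phi> x \<noteq> 0}"] by blast
qed

lemma test_fun_C_k: "test_fun S \<phi> \<Longrightarrow> C_k k \<phi>"
  by (simp add: test_fun_def)

lemma test_fun_outside: "test_fun S \<phi> \<Longrightarrow> x \<notin> S \<Longrightarrow> \<phi> x = 0"
  by (erule test_fun_support) blast

lemma test_fun_zero: "test_fun S (\<lambda>x. 0)"
  by (rule test_funI[of _ "{}"]) (auto intro: C_k_const simp del: C_k.simps)

lemma test_fun_add:
  assumes "test_fun S f" "test_fun S g"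
  shows "test_fun S (\<lambda>x. f x + g x)"
proof -
  obtain K where K: "compact K" "K \<subseteq> S" "\<And>x. x \<notin> K \<Longrightarrow> f x = 0"
    using test_fun_support[OF assms(1)] by blast
  obtain L where L: "compact L" "L \<subseteq> S" "\<And>x. x \<notin> L \<Longrightarrow> g x = 0"
    using test_fun_support[OF assms(2)] by blast
  show ?thesis
    using K L test_fun_C_k[OF assms(1)] test_fun_C_k[OF assms(2)]
    by (intro test_funI[of _ "K \<union> L"] C_k_add) auto
qed

lemma test_fun_scale:
  assumes "test_fun S f"
  shows "test_fun S (\<lambda>x. c * f x)"
proof -
  obtain K where K: "compact K" "K \<subseteq> S" "\<And>x. x \<notin> K \<Longrightarrow> f x = 0"
    using test_fun_support[OF assms(1)] by blast
  then show ?thesis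
    using test_fun_C_k[OF assms] by (intro test_funI[of _ "K"] C_k_scale) auto
qed

lemma test_fun_pd:
  assumes "test_fun S \<phi>" "i \<in> Basis"
  shows "test_fun S (pd i \<phi>)"
proof -
  obtain K where K: "compact K" "K \<subseteq> S" "\<And>x. x \<notin> K \<Longrightarrow> \<phi> x = 0"
    using test_fun_support[OF assms(1)] by blast
  have "pd i \<phi> x = 0" if "x \<notin> K" for x
  proof -
    have "(\<phi> has_derivative (\<lambda>h. 0)) (at x)"
      by (rule has_derivative_transform_within_open[of "\<lambda>x. 0" _ _ _ "- K"])
         (use K that compact_imp_closed in auto)
    then show ?thesis by (rule pd_eqI)
  qed
  moreover have "C_k k (pd i \<phi>)" for k
    using test_fun_C_k[OF assms(1), of "Suc k"] assms(2) by simp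
  ultimately show ?thesis using K by (intro test_funI[of _ K]) auto
qed

lemma test_fun_continuous: "test_fun S \<phi> \<Longrightarrow> continuous_on UNIV \<phi>"
  using test_fun_C_k[of S \<phi> 0] by simp

lemma test_fun_borel [measurable_dest]: "test_fun S \<phi> \<Longrightarrow> \<phi> \<in> borel_measurable borel"
  by (rule borel_measurable_continuous_onI) (rule test_fun_continuous)

lemma test_fun_bounded:
  assumes "test_fun S \<phi>"
  obtains B where "B > 0" "\<And>x. \<bar>\<phi> x\<bar> \<le> B"
proof -
  obtain K where K: "compact K" "K \<subseteq> S" "\<And>x. x \<notin> K \<Longrightarrow> \<phi> x = 0"
    using test_fun_support[OF assms(1)] by blast
  have "compact (\<phi> ` K)"
    using K(1) test_fun_continuous[OF assms]
    by (intro compact_continuous_image) (auto intro: continuous_on_subset)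
  then obtain B where B: "B > 0" "\<forall>y\<in>\<phi> ` K. norm y \<le> B"
    using compact_imp_bounded bounded_pos by blast
  have "\<bar>\<phi> x\<bar> \<le> B" for x using B K(3) by (cases "x \<in> K") auto
  with B(1) show ?thesis by (rule that)
qed

lemma bounded_compact_support_sq_integrable:
  fixes f :: "'a::euclidean_space \<Rightarrow> real"
  assumes "f \<in> borel_measurable borel" "compact K" "\<And>x. x \<notin> K \<Longrightarrow> f x = 0" "\<And>x. \<bar>f x\<bar> \<le> B"
  shows "sq_integrable f"
proof -
  have "integrable lborel (\<lambda>x. B\<^sup>2 * indicator K x)"
    using assms(2) by (intro integrable_mult_right integrable_real_indicator)
      (use emeasure_compact_finite[of K] in \<open>auto intro: borel_compact\<close>)
  then have "integrable lborel (\<lambda>x. (f x)\<^sup>2)"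
  proof (rule Bochner_Integration.integrable_bound)
    show "(\<lambda>x. (f x)\<^sup>2) \<in> borel_measurable lborel" using assms(1) by measurable
    have "(f x)\<^sup>2 \<le> B\<^sup>2" for x
      using power_mono[OF assms(4)[of x], of 2] by simp
    then have "norm ((f x)\<^sup>2) \<le> norm (B\<^sup>2 * indicator K x)" for x
      using assms(3)[of x] by (cases "x \<in> K") auto
    then show "AE x in lborel. norm ((f x)\<^sup>2) \<le> norm (B\<^sup>2 * indicator K x)" by simp
  qed
  then show ?thesis using sq_integrable_borel[OF assms(1)] by blast
qed

lemma test_fun_sq_integrable: 
  assumes "test_fun S \<phi>" shows "sq_integrable \<phi>"
proof -
  obtain K where "compact K" "\<And>x. x \<notin> K \<Longrightarrow> \<phi> x = 0"
    using test_fun_support[OF assms] by metis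
  moreover obtain B where "\<And>x. \<bar>\<phi> x\<bar> \<le> B" using test_fun_bounded[OF assms] by metis
  ultimately show ?thesis
    using bounded_compact_support_sq_integrable[OF test_fun_borel[OF assms]] by metis
qed

lemma test_fun_in_L2_on: "test_fun S \<phi> \<Longrightarrow> l2_class \<phi> \<in> L2_on S"
  using test_fun_outside by (intro l2_class_in_L2_on test_fun_sq_integrable) auto

section \<open>Smooth approximation of indicators of boxes\<close>

text \<open>Rescaling by \<open>Suc n\<close> leaves the support alone and steepens the flanks: the
  functions stay between 0 and 1 and converge pointwise to the indicator of the open interval, as
  dominated convergence requires.\<close>

definition bump1 :: "real \<Rightarrow> real \<Rightarrow> nat \<Rightarrow> real \<Rightarrow> real" where
  "bump1 a b n t = exp_decay 1 (real (Suc n) * (t - a)) * exp_decay 1 (real (Suc n) * (b - t))"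

text \<open>A product over coordinates, so that a bump on a space-time box splits into a factor in
  time and one in space (\<open>bump_Pair\<close>).\<close>

definition bump :: "'a::euclidean_space \<Rightarrow> 'a \<Rightarrow> nat \<Rightarrow> 'a \<Rightarrow> real" where
  "bump a b n x = (\<Prod>i\<in>Basis. bump1 (a \<bullet> i) (b \<bullet> i) n (x \<bullet> i))"

lemma exp_decay_1_bounds: "0 \<le> exp_decay 1 s" "exp_decay 1 s \<le> 1"
  by (auto simp: exp_decay_def)

lemma bump1_bounds: "0 \<le> bump1 a b n t" "bump1 a b n t \<le> 1"
  unfolding bump1_def using exp_decay_1_bounds by (auto intro: mult_le_one)

lemma bump1_zero: "\<not> (a < t \<and> t < b) \<Longrightarrow> bump1 a b n t = 0"
  unfolding bump1_def exp_decay_def by (auto simp: zero_less_mult_iff)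

lemma C_k_bump1: "C_k k (bump1 a b n)"
proof -
  have "C_k k (\<lambda>t::real. exp_decay 1 (t \<bullet> real (Suc n) + (- real (Suc n) * a)))"
    "C_k k (\<lambda>t::real. exp_decay 1 (t \<bullet> (- real (Suc n)) + real (Suc n) * b))"
    by (rule C_k_compose_affine[OF C_k_exp_decay])+
  then have "C_k k (\<lambda>t::real. exp_decay 1 (t \<bullet> real (Suc n) + (- real (Suc n) * a)) *
      exp_decay 1 (t \<bullet> (- real (Suc n)) + real (Suc n) * b))"
    by (rule C_k_mult)
  moreover have "(\<lambda>t::real. exp_decay 1 (t \<bullet> real (Suc n) + (- real (Suc n) * a)) *
      exp_decay 1 (t \<bullet> (- real (Suc n)) + real (Suc n) * b)) = bump1 a b n"
    unfolding bump1_def by (rule ext) (simp add: algebra_simps)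
  ultimately show ?thesis by simp
qed

lemma exp_decay_1_limit:
  "(\<lambda>n. exp_decay 1 (real (Suc n) * s)) \<longlonglongrightarrow> (if s > 0 then 1 else 0)"
proof (cases "s > 0")
  case True
  have "(\<lambda>n. exp (- (inverse (real (Suc n)) * (1 / s)))) \<longlonglongrightarrow> exp (- (0 * (1 / s)))"
    by (intro tendsto_exp tendsto_minus tendsto_mult_right LIMSEQ_inverse_real_of_nat)
  moreover have "exp_decay 1 (real (Suc n) * s) = exp (- (inverse (real (Suc n)) * (1 / s)))" for n
    using True by (simp add: exp_decay_def field_simps zero_less_mult_iff del: of_nat_Suc)
  ultimately show ?thesis using True by simp
qed (simp add: exp_decay_def zero_less_mult_iff)

lemma bump1_limit: "(\<lambda>n. bump1 a b n t) \<longlonglongrightarrow> (if a < t \<and> t < b then 1 else 0)"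
  using tendsto_mult[OF exp_decay_1_limit[of "t - a"] exp_decay_1_limit[of "b - t"]]
  unfolding bump1_def by (auto split: if_splits)

lemma bump_bounds: "0 \<le> bump a b n x" "bump a b n x \<le> 1"
  unfolding bump_def using bump1_bounds by (auto intro: prod_nonneg prod_le_1)

lemma bump_zero: "x \<notin> box a b \<Longrightarrow> bump a b n x = 0"
  unfolding bump_def mem_box by (rule prod_zero) (use bump1_zero in fastforce)+

lemma bump_limit: "(\<lambda>n. bump a b n x) \<longlonglongrightarrow> indicator (box a b) x"
proof -
  have "(\<lambda>n. bump a b n x) \<longlonglongrightarrow> (\<Prod>i\<in>Basis. if a \<bullet> i < x \<bullet> i \<and> x \<bullet> i < b \<bullet> i then 1 else 0)"
    unfolding bump_def by (intro tendsto_prod bump1_limit)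
  also have "(\<Prod>i\<in>Basis. if a \<bullet> i < x \<bullet> i \<and> x \<bullet> i < b \<bullet> i then 1 else 0) = (indicator (box a b) x :: real)"
    by (cases "x \<in> box a b") (auto simp: mem_box intro!: prod_zero)
  finally show ?thesis .
qed

lemma C_k_bump: "C_k k (bump a b n)"
proof -
  have "C_k k (\<lambda>x. \<Prod>i\<in>Basis. bump1 (a \<bullet> i) (b \<bullet> i) n (x \<bullet> i + 0))"
    by (intro C_k_prod C_k_compose_affine C_k_bump1)
  then show ?thesis unfolding bump_def by simp
qed

lemma test_fun_bump: "cbox a b \<subseteq> S \<Longrightarrow> test_fun S (bump a b n)"
  by (rule test_funI[of _ "cbox a b"]) (auto intro: C_k_bump bump_zero dest: subsetD[OF box_subset_cbox] simp del: C_k.simps)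

section \<open>The fundamental lemma of the calculus of variations\<close>

text \<open>The sets over which \<open>g\<close> integrates to 0 form a Dynkin system;
  \<open>total\<close> supplies the complements. Open boxes are an intersection-stable generator of
  the Borel sets, so all Borel sets belong to it.\<close>

lemma integral_zero_on_boxes_imp_AE_zero:
  fixes g :: "'a::euclidean_space \<Rightarrow> real"
  assumes g: "integrable lborel g" and total: "(\<integral>x. g x \<partial>lborel) = 0"
    and box: "\<And>a b. (\<integral>x. indicator (box a b) x * g x \<partial>lborel) = 0"
  shows "AE x in lborel. g x = 0"
proof -
  let ?G = "range (\<lambda>(a, b). box a b :: 'a set)"
  have int: "integrable lborel (\<lambda>x. indicator A x * g x)" if "A \<in> sets borel" for A
    using integrable_mult_indicator[of A lborel g] g that by simp
  have "(\<integral>x. indicator A x * g x \<partial>lborel) = 0" if "A \<in> sigma_sets UNIV ?G" for A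
  proof (rule sigma_sets_induct_disjoint[of ?G UNIV])
    show "Int_stable ?G"
      by (auto simp: Int_stable_def box_Int_box)
    show "?G \<subseteq> Pow UNIV" "A \<in> sigma_sets UNIV ?G" using that by auto
    show "(\<integral>x. indicator A x * g x \<partial>lborel) = 0" if "A \<in> ?G" for A using that box by auto
    show "(\<integral>x. indicator {} x * g x \<partial>lborel) = 0" by simp
  next
    fix A assume A: "A \<in> sigma_sets UNIV ?G" "(\<integral>x. indicator A x * g x \<partial>lborel) = 0"
    then have "A \<in> sets borel" unfolding borel_eq_box by simp
    then have "(\<integral>x. g x - indicator A x * g x \<partial>lborel) = 0"
      using A(2) total g int by simp
    moreover have "g x - indicator A x * g x = indicator (UNIV - A) x * g x" for x
      by (auto simp: indicator_def)
    ultimately show "(\<integral>x. indicator (UNIV - A) x * g x \<partial>lborel) = 0" by simp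
  next
    fix A :: "nat \<Rightarrow> 'a set"
    assume A: "disjoint_family A" "range A \<subseteq> sigma_sets UNIV ?G"
      "\<And>i. (\<integral>x. indicator (A i) x * g x \<partial>lborel) = 0"
    then have s: "A i \<in> sets borel" for i unfolding borel_eq_box by auto
    have "(LINT x:(\<Union>i. A i)|lborel. g x) = (\<Sum>i. LINT x:A i|lborel. g x)"
      using A(1) s int by (intro lebesgue_integral_countable_add)
        (auto simp: disjoint_family_on_def set_integrable_def)
    then show "(\<integral>x. indicator (\<Union>i. A i) x * g x \<partial>lborel) = 0"
      using A(3) by (simp add: set_lebesgue_integral_def)
  qed
  then have "(LINT x:A|lborel. g x) = (LINT x:A|lborel. 0)" if "A \<in> sets lborel" for A
    using that unfolding set_lebesgue_integral_def by (simp add: borel_eq_box)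
  then show ?thesis
    using density_unique_real[OF g, of "\<lambda>x. 0"] by simp
qed

text \<open>Letting \<open>n\<close> tend to infinity replaces bumps by indicators of boxes. On a
  fixed box with closure in \<open>S\<close> the truncated function then integrates to 0 over every
  box, because the intersection of two boxes is a box. Countably many boxes cover \<open>S\<close>.
  Only bumps are tested, which matters where the test functions are built from them by hand.\<close>

lemma bump_orthogonal_imp_AE_zero:
  fixes f :: "'a::euclidean_space \<Rightarrow> real"
  assumes S: "open S" and f [measurable]: "f \<in> borel_measurable borel" and sq: "sq_integrable f"
    and orth: "\<And>a b n. cbox a b \<subseteq> S \<Longrightarrow> (\<integral>x. f x * bump a b n x \<partial>lborel) = 0"
  shows "AE x in lborel. x \<in> S \<longrightarrow> f x = 0"
proof -
  have sqi: "sq_integrable (indicator (cbox a b) :: 'a \<Rightarrow> real)" for a b :: 'a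
    by (rule bounded_compact_support_sq_integrable[of _ "cbox a b" 1]) auto
  have int: "integrable lborel (\<lambda>x. f x * indicator (cbox a b) x)" for a b
    by (rule integrable_mult_borel[OF sq sqi]) auto
  have int': "integrable lborel (\<lambda>x. f x * indicator (box a b) x)" for a b
    by (rule Bochner_Integration.integrable_bound[OF int[of a b]])
       (use box_subset_cbox[of a b] in \<open>auto split: split_indicator\<close>)
  have zero: "(\<integral>x. f x * indicator (box a b) x \<partial>lborel) = 0" if "cbox a b \<subseteq> S" for a b
  proof -
    have "(\<lambda>n. (\<integral>x. f x * bump a b n x \<partial>lborel)) \<longlonglongrightarrow> (\<integral>x. f x * indicator (box a b) x \<partial>lborel)"
    proof (rule integral_dominated_convergence[of _ _ _ "\<lambda>x. \<bar>f x * indicator (cbox a b) x\<bar>"])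
      have "bump a b n \<in> borel_measurable borel" for n
        by (rule test_fun_borel[OF test_fun_bump[OF that]])
      then show "(\<lambda>x. f x * bump a b n x) \<in> borel_measurable lborel" for n by measurable
      show "AE x in lborel. norm (f x * bump a b n x) \<le> \<bar>f x * indicator (cbox a b) x\<bar>" for n
      proof (rule AE_I2)
        fix x
        show "norm (f x * bump a b n x) \<le> \<bar>f x * indicator (cbox a b) x\<bar>"
          using bump_zero[of x a b n] bump_bounds[of a b n x] subsetD[OF box_subset_cbox, of x a b]
          by (cases "x \<in> cbox a b"; cases "x \<in> box a b") (auto simp: abs_mult intro: mult_left_le)
      qed
    qed (use int[of a b] in \<open>auto intro!: tendsto_mult bump_limit\<close>)
    then show ?thesis using orth[OF that] by (simp add: LIMSEQ_const_iff)
  qed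
  have box: "AE x in lborel. x \<in> box c d \<longrightarrow> f x = 0" if cd: "cbox c d \<subseteq> S" for c d
  proof -
    have "AE x in lborel. f x * indicator (box c d) x = 0"
    proof (rule integral_zero_on_boxes_imp_AE_zero)
      fix a b
      obtain c' d' where i: "cbox a b \<inter> cbox c d = cbox c' d'" "box a b \<inter> box c d = box c' d'"
        using Int_interval[of a b c d] box_Int_box[of a b c d] by blast
      have "(\<integral>x. f x * indicator (box c' d') x \<partial>lborel) = 0"
        using i(1) cd by (intro zero) blast
      moreover have "indicator (box a b) x * (f x * indicator (box c d) x) = f x * indicator (box c' d') x" for x
        unfolding i(2)[symmetric] by (auto simp: indicator_def)
      ultimately show "(\<integral>x. indicator (box a b) x * (f x * indicator (box c d) x) \<partial>lborel) = 0"
        by (simp only:)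
    qed (use int' zero[OF cd] in auto)
    then show ?thesis by eventually_elim (auto simp: indicator_def split: if_splits)
  qed
  obtain D where D: "countable D" "\<And>X. X \<in> D \<Longrightarrow> X \<subseteq> S" "\<And>X. X \<in> D \<Longrightarrow> \<exists>a b. X = cbox a b" "\<Union>D = S"
    using open_countable_Union_open_cbox[OF S] by (metis PowD subset_eq)
  have "AE x in lborel. x \<in> X \<longrightarrow> f x = 0" if X: "X \<in> D" for X
  proof -
    obtain a b where ab: "X = cbox a b" using D(3)[OF X] by blast
    \<comment> \<open>The cover consists of closed boxes, the vanishing is known on open ones; the
      boundary is a null set.\<close>
    have "AE x in lebesgue. x \<notin> cbox a b - box a b"
      using negligible_frontier_interval[of a b] unfolding negligible_iff_null_sets
      by (rule AE_not_in)
    moreover have "AE x in lborel. x \<in> box a b \<longrightarrow> f x = 0"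
      using box D(2)[OF X] ab by blast
    ultimately show ?thesis unfolding AE_lebesgue_iff by eventually_elim (auto simp: ab)
  qed
  then have "AE x in lborel. \<forall>X\<in>D. x \<in> X \<longrightarrow> f x = 0"
    unfolding AE_ball_countable[OF D(1)] by blast
  then show ?thesis by eventually_elim (use D(4) in auto)
qed

text \<open>The source of uniqueness for weak derivatives and weak Laplacians, and of the density of
  the test functions.\<close>

lemma test_orthogonal_imp_zero:
  assumes S: "open S" and u: "u \<in> L2_on S"
    and orth: "\<And>\<phi>. test_fun S \<phi> \<Longrightarrow> inner u (l2_class \<phi>) = 0"
  shows "u = 0"
proof -
  obtain f where f: "f \<in> borel_measurable borel" "sq_integrable f" "u = l2_class f"
    "\<And>x. x \<notin> S \<Longrightarrow> f x = 0"
    using l2_borel_on[OF u] S by auto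
  have "AE x in lborel. x \<in> S \<longrightarrow> f x = 0"
  proof (rule bump_orthogonal_imp_AE_zero[OF S f(1,2)])
    fix a b n assume "cbox a b \<subseteq> S"
    then have t: "test_fun S (bump a b n)" by (rule test_fun_bump)
    show "(\<integral>x. f x * bump a b n x \<partial>lborel) = 0"
      using orth[OF t] inner_l2_borel[OF f(2) test_fun_sq_integrable[OF t] f(1) test_fun_borel[OF t]] f(3)
      by simp
  qed
  then have "AE x in lborel. f x = 0" by eventually_elim (use f(4) in auto)
  then show ?thesis
    using l2_class_eq_iff[OF f(2) sq_integrable_zero] f(3) by (simp add: l2_class_zero AE_lebesgue_iff)
qed

section \<open>Restriction to a set as an orthogonal projection\<close>

text \<open>The orthogonal projection onto \<open>L2_on S\<close>. It turns the form
  \<open>inner_on S\<close> into an ordinary inner product of projections, so the observation on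
  \<open>q\<close> fits an abstract Hilbert space setting.\<close>

definition cut :: "'a::euclidean_space set \<Rightarrow> 'a l2 \<Rightarrow> 'a l2" where
  "cut S u = l2_class (\<lambda>x. indicator S x * rep_l2 u x)"

lemma sq_integrable_indicator_mult:
  assumes "S \<in> sets lebesgue" "sq_integrable f"
  shows "sq_integrable (\<lambda>x. indicator S x * f x)"
proof (rule sq_integrable_bound[OF assms(2)])
  show "(\<lambda>x. indicator S x * f x) \<in> borel_measurable lebesgue"
    using assms by (intro borel_measurable_times borel_measurable_indicator) (auto simp: sq_integrable_def)
qed (auto simp: indicator_def)

lemma cut_class:
  assumes "S \<in> sets lebesgue" "sq_integrable f"
  shows "cut S (l2_class f) = l2_class (\<lambda>x. indicator S x * f x)"
  unfolding cut_def
  using rep_l2_class[OF assms(2)]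
  by (subst l2_class_eq_iff) (auto intro: sq_integrable_indicator_mult assms sq_integrable_rep_l2)

lemma inner_cut:
  assumes "S \<in> sets lebesgue"
  shows "inner (cut S u) v = inner u (cut S v)"
proof -
  have "inner (cut S (l2_class (rep_l2 u))) (l2_class (rep_l2 v))
      = inner (l2_class (rep_l2 u)) (cut S (l2_class (rep_l2 v)))"
    unfolding cut_class[OF assms sq_integrable_rep_l2]
    by (simp add: inner_l2_class sq_integrable_indicator_mult[OF assms] mult.left_commute mult.assoc
        del: l2_class_rep_l2)
  then show ?thesis by simp
qed

lemma cut_eq_iff:
  assumes "S \<in> sets lebesgue"
  shows "cut S u = u \<longleftrightarrow> u \<in> L2_on S"
proof -
  have "cut S u = u \<longleftrightarrow> (AE x in lebesgue. indicator S x * rep_l2 u x = rep_l2 u x)"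
    using l2_class_eq_iff[OF sq_integrable_indicator_mult[OF assms sq_integrable_rep_l2] sq_integrable_rep_l2]
    unfolding cut_def by simp
  also have "\<dots> \<longleftrightarrow> u \<in> L2_on S"
    unfolding L2_on_def mem_Collect_eq by (rule AE_cong) (auto simp: indicator_def)
  finally show ?thesis .
qed

lemma cut_in_L2_on: "S \<in> sets lebesgue \<Longrightarrow> cut S u \<in> L2_on S"
  unfolding cut_def by (intro l2_class_in_L2_on sq_integrable_indicator_mult sq_integrable_rep_l2) auto

text \<open>Because \<open>cut S\<close> is self-adjoint, its fixed vectors are exactly the vectors
  orthogonal to all \<open>cut S v - v\<close>. The space is thus an intersection of closed
  hyperplanes.\<close>

lemma closed_L2_on:
  assumes "S \<in> sets lebesgue"
  shows "closed (L2_on S)"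
proof -
  have "L2_on S = (\<Inter>v. {u. inner (cut S v - v) u = 0})"
  proof safe
    fix u v assume "u \<in> L2_on S"
    then have "cut S u = u" using cut_eq_iff[OF assms] by blast
    then show "inner (cut S v - v) u = 0"
      using inner_cut[OF assms, of v u] by (simp add: inner_diff_left)
  next
    fix u assume "u \<in> (\<Inter>v. {u. inner (cut S v - v) u = 0})"
    then have "inner (cut S v - v) u = 0" for v by blast
    then have "inner v (cut S u - u) = 0" for v
      using inner_cut[OF assms, of v u] by (simp add: inner_diff_left inner_diff_right)
    from this[of "cut S u - u"] show "u \<in> L2_on S"
      using cut_eq_iff[OF assms] by simp
  qed
  then show ?thesis by (simp add: closed_hyperplane closed_INT)
qed

lemma complete_L2_on:
  assumes "S \<in> sets lebesgue"
  shows "complete (L2_on S)"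
  using complete_closed_subset[OF closed_L2_on[OF assms] _ complete_l2] by blast

lemma linear_cut:
  assumes "S \<in> sets lebesgue"
  shows "linear (cut S)"
proof (rule linearI)
  fix u v c
  show "cut S (u + v) = cut S u + cut S v"
    unfolding cut_def l2_class_add[OF sq_integrable_indicator_mult[OF assms sq_integrable_rep_l2] sq_integrable_indicator_mult[OF assms sq_integrable_rep_l2]]
    using rep_l2_add[of u v]
    by (subst l2_class_eq_iff)
       (auto intro!: sq_integrable_indicator_mult[OF assms] sq_integrable_add sq_integrable_rep_l2
         elim!: AE_mp simp: distrib_left)
  show "cut S (c *\<^sub>R u) = c *\<^sub>R cut S u"
    unfolding cut_def l2_class_scaleR[OF sq_integrable_indicator_mult[OF assms sq_integrable_rep_l2]]
    using rep_l2_scaleR[of c u]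
    by (subst l2_class_eq_iff)
       (auto intro!: sq_integrable_indicator_mult[OF assms] sq_integrable_scale sq_integrable_rep_l2
         elim!: AE_mp)
qed

lemma inner_on_eq_cut:
  assumes "S \<in> sets lebesgue"
  shows "inner_on S u v = inner (cut S u) (cut S v)"
proof -
  have "inner (cut S u) (cut S v) = (\<integral>x. (indicator S x * rep_l2 u x) * (indicator S x * rep_l2 v x) \<partial>lebesgue)"
    unfolding cut_def by (intro inner_l2_class sq_integrable_indicator_mult[OF assms] sq_integrable_rep_l2)
  also have "(\<lambda>x. (indicator S x * rep_l2 u x) * (indicator S x * rep_l2 v x))
      = (\<lambda>x. indicator S x *\<^sub>R (rep_l2 u x * rep_l2 v x) :: real)"
    by (auto simp: indicator_def)
  finally show ?thesis by (simp add: inner_on_def set_lebesgue_integral_def)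
qed

lemma norm_cut_le: "S \<in> sets lebesgue \<Longrightarrow> norm (cut S u) \<le> norm u"
proof -
  assume S: "S \<in> sets lebesgue"
  have "cut S (cut S u) = cut S u" using cut_eq_iff[OF S] cut_in_L2_on[OF S] by blast
  then have "(norm (cut S u))\<^sup>2 = inner u (cut S u)"
    using inner_cut[OF S, of u "cut S u"] by (simp add: power2_norm_eq_inner)
  also have "\<dots> \<le> norm u * norm (cut S u)" by (rule norm_cauchy_schwarz)
  finally show ?thesis
    by (cases "norm (cut S u) = 0") (auto simp: power2_eq_square)
qed

section \<open>Density of the test functions\<close>

lemma subspace_closure:
  fixes V :: "'a::real_normed_vector set"
  assumes "subspace V"
  shows "subspace (closure V)"
proof (rule subspaceI)
  show "0 \<in> closure V" using subspace_0[OF assms] closure_subset by blast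
next
  fix x y assume "x \<in> closure V" "y \<in> closure V"
  then obtain u v where "\<And>n. u n \<in> V" "u \<longlonglongrightarrow> x" "\<And>n. v n \<in> V" "v \<longlonglongrightarrow> y"
    unfolding closure_sequential by blast
  then have "(\<lambda>n. u n + v n) \<longlonglongrightarrow> x + y" "\<And>n. u n + v n \<in> V"
    using assms by (auto intro: tendsto_add subspace_add)
  then show "x + y \<in> closure V" unfolding closure_sequential by (intro exI[of _ "\<lambda>n. u n + v n"]) auto
next
  fix c x assume "x \<in> closure V"
  then obtain u where "\<And>n. u n \<in> V" "u \<longlonglongrightarrow> x"
    unfolding closure_sequential by blast
  then have "(\<lambda>n. c *\<^sub>R u n) \<longlonglongrightarrow> c *\<^sub>R x" "\<And>n. c *\<^sub>R u n \<in> V"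
    using assms by (auto intro: tendsto_intros subspace_scale)
  then show "c *\<^sub>R x \<in> closure V" unfolding closure_sequential by (intro exI[of _ "\<lambda>n. c *\<^sub>R u n"]) auto
qed

lemma subspace_test_classes: "subspace {l2_class \<phi> |\<phi>. test_fun S \<phi>}"
proof (rule subspaceI)
  show "0 \<in> {l2_class \<phi> |\<phi>. test_fun S \<phi>}"
    using test_fun_zero l2_class_zero by force
next
  fix u v assume "u \<in> {l2_class \<phi> |\<phi>. test_fun S \<phi>}" "v \<in> {l2_class \<phi> |\<phi>. test_fun S \<phi>}"
  then show "u + v \<in> {l2_class \<phi> |\<phi>. test_fun S \<phi>}"
    using l2_class_add test_fun_sq_integrable test_fun_add by fastforce
next
  fix u c assume "u \<in> {l2_class \<phi> |\<phi>. test_fun S \<phi>}"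
  then show "c *\<^sub>R u \<in> {l2_class \<phi> |\<phi>. test_fun S \<phi>}"
    using l2_class_scaleR test_fun_sq_integrable test_fun_scale by fastforce
qed

lemma sets_lebesgue_open: "open S \<Longrightarrow> S \<in> sets lebesgue"
  by (simp add: lmeasurable_open sets_completionI_sets)

text \<open>Difference quotients in time can be evaluated in the limit only against test functions;
  density extends that limit to the pairing with an arbitrary Laplacian in
  \<open>L2_on S\<close>.\<close>

lemma closure_test_classes:
  assumes "open S"
  shows "closure {l2_class \<phi> |\<phi>. test_fun S \<phi>} = L2_on S"
proof (rule closed_subspace_eq_if_orthogonal_trivial[OF subspace_L2_on complete_L2_on])
  show S: "S \<in> sets lebesgue" by (rule sets_lebesgue_open[OF assms])
  show "subspace (closure {l2_class \<phi> |\<phi>. test_fun S \<phi>})"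
    using subspace_test_classes by (rule subspace_closure)
  show "closed (closure {l2_class \<phi> |\<phi>. test_fun S \<phi>})" by simp
  show "closure {l2_class \<phi> |\<phi>. test_fun S \<phi>} \<subseteq> L2_on S"
    using closed_L2_on[OF S] test_fun_in_L2_on by (intro closure_minimal) auto
  fix u assume u: "u \<in> L2_on S" "\<And>v. v \<in> closure {l2_class \<phi> |\<phi>. test_fun S \<phi>} \<Longrightarrow> inner u v = 0"
  show "u = 0"
  proof (rule test_orthogonal_imp_zero[OF assms u(1)])
    fix \<phi> :: "'a \<Rightarrow> real" assume "test_fun S \<phi>"
    then have "l2_class \<phi> \<in> closure {l2_class \<phi> |\<phi>. test_fun S \<phi>}"
      by (intro subsetD[OF closure_subset]) blast
    then show "inner u (l2_class \<phi>) = 0" by (rule u(2))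
  qed
qed

subsection \<open>Time slices\<close>

lemma AE_lborel_pair:
  fixes P :: "'a::euclidean_space \<times> 'b::euclidean_space \<Rightarrow> bool"
  assumes "AE p in lborel. P p"
  shows "AE t in lborel. AE x in lborel. P (t, x)"
  using lborel_pair.AE_pair[of P] assms unfolding lborel_prod by blast

lemma AE_lborel_translation:
  fixes a :: "'a::euclidean_space"
  assumes "AE x in lborel. P x"
  shows "AE x in lborel. P (x + a)"
proof -
  obtain N where N: "N \<in> null_sets lborel" "{x. \<not> P x} \<subseteq> N"
    using assms unfolding eventually_ae_filter by auto
  then have "{x. x - (- a) \<in> N} \<in> null_sets lborel" by (intro null_sets_translation)
  moreover have "{x \<in> space lborel. \<not> P (x + a)} \<subseteq> {x. x - (- a) \<in> N}" using N(2) by auto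
  ultimately show ?thesis by (rule AE_I')
qed

lemma sq_integrable_AE_eq:
  fixes f g :: "'a::euclidean_space \<Rightarrow> real"
  assumes "sq_integrable f" "AE x in lborel. g x = f x"
  shows "sq_integrable g" "l2_class g = l2_class f"
proof -
  have ae: "AE x in lebesgue. f x = g x"
    using assms(2) unfolding AE_lebesgue_iff by eventually_elim simp
  then have "g \<in> borel_measurable lebesgue"
    using borel_measurable_AE assms(1) unfolding sq_integrable_def by blast
  then show g: "sq_integrable g" by (rule sq_integrable_AE_cong[OF assms(1) _ ae])
  show "l2_class g = l2_class f"
    using l2_class_eq_iff[OF g assms(1)] ae by (auto simp: eq_commute)
qed

lemma section_borel:
  fixes f :: "'b::second_countable_topology \<times> 'a::second_countable_topology \<Rightarrow> real"
  assumes "f \<in> borel_measurable borel"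
  shows "(\<lambda>x. f (t, x)) \<in> borel_measurable borel"
  using assms unfolding borel_prod[symmetric] by measurable

lemma AE_sq_integrable_section:
  fixes f :: "real \<times> 'a::euclidean_space \<Rightarrow> real"
  assumes "f \<in> borel_measurable borel" "sq_integrable f"
  shows "AE t in lborel. sq_integrable (\<lambda>x. f (t, x))"
proof -
  have "integrable (lborel \<Otimes>\<^sub>M lborel) (\<lambda>p. (f p)\<^sup>2)"
    unfolding lborel_prod using assms by (simp add: sq_integrable_borel)
  from lborel_pair.AE_integrable_fst'[OF this]
  have "AE t in lborel. integrable lborel (\<lambda>x. (f (t, x))\<^sup>2)" .
  moreover have "(\<lambda>x. f (t, x)) \<in> borel_measurable borel" for t
    by (rule section_borel[OF assms(1)])
  ultimately show ?thesis
    by (auto simp: sq_integrable_borel)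
qed

text \<open>\<open>slice\<close> is defined through an arbitrary representative. By Fubini almost
  every section of it agrees almost everywhere with the section of \<open>f\<close>, so slices may
  be computed from a Borel representative.\<close>

lemma slice_class:
  fixes f :: "real \<times> 'a::euclidean_space \<Rightarrow> real"
  assumes "f \<in> borel_measurable borel" "sq_integrable f"
  shows "AE t in lborel. sq_integrable (\<lambda>x. f (t, x)) \<and> slice (l2_class f) t = l2_class (\<lambda>x. f (t, x))"
proof -
  have "AE p in lborel. rep_l2 (l2_class f) p = f p"
    using rep_l2_class[OF assms(2)] unfolding AE_lebesgue_iff .
  from AE_lborel_pair[OF this] AE_sq_integrable_section[OF assms]
  show ?thesis
  proof eventually_elim
    case (elim t)
    then have "sq_integrable (\<lambda>x. rep_l2 (l2_class f) (t, x))"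
      "l2_class (\<lambda>x. rep_l2 (l2_class f) (t, x)) = l2_class (\<lambda>x. f (t, x))"
      using sq_integrable_AE_eq[of "\<lambda>x. f (t, x)" "\<lambda>x. rep_l2 (l2_class f) (t, x)"] by auto
    with elim show ?case by (simp add: slice_def)
  qed
qed

text \<open>The isometry between \<open>L^2\<close> of the product and square integrable functions
  of time with values in \<open>L^2\<close>. Fubini is applied to Borel representatives, and the
  result is carried over to the completed measure.\<close>

lemma slice_inner:
  fixes y v :: "(real \<times> 'a::euclidean_space) l2"
  shows "integrable lebesgue (\<lambda>t. inner (slice y t) (slice v t))"
    and "(\<integral>t. inner (slice y t) (slice v t) \<partial>lebesgue) = inner y v"
proof -
  obtain f where f: "f \<in> borel_measurable borel" "sq_integrable f" "y = l2_class f" using l2_borel .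
  obtain g where g: "g \<in> borel_measurable borel" "sq_integrable g" "v = l2_class g" using l2_borel .
  have int: "integrable (lborel \<Otimes>\<^sub>M lborel) (\<lambda>p. f p * g p)"
    unfolding lborel_prod by (rule integrable_mult_borel[OF f(2) g(2) f(1) g(1)])
  define I where "I = (\<lambda>t. \<integral>x. f (t, x) * g (t, x) \<partial>lborel)"
  have I: "integrable lborel I" "integral\<^sup>L lborel I = inner y v"
    using lborel_pair.integrable_fst'[OF int] lborel_pair.integral_fst'[OF int]
    unfolding lborel_prod I_def by (simp_all add: f(3) g(3) inner_l2_borel f g)
  have Ib: "I \<in> borel_measurable borel" using I(1) by simp
  have ae: "AE t in lebesgue. I t = inner (slice y t) (slice v t)"
    using slice_class[OF f(1,2)] slice_class[OF g(1,2)] unfolding AE_lebesgue_iff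
    by eventually_elim (simp add: I_def f(3) g(3) inner_l2_borel section_borel f(1) g(1))
  have Il: "integrable lebesgue I" "integral\<^sup>L lebesgue I = inner y v"
    using I Ib by (auto simp: integrable_completion integral_completion)
  have m: "(\<lambda>t. inner (slice y t) (slice v t)) \<in> borel_measurable lebesgue"
    using borel_measurable_AE[OF _ ae] Il(1) by blast
  show "integrable lebesgue (\<lambda>t. inner (slice y t) (slice v t))"
    using integrable_cong_AE[OF borel_measurable_integrable[OF Il(1)] m ae] Il(1) by blast
  show "(\<integral>t. inner (slice y t) (slice v t) \<partial>lebesgue) = inner y v"
    using integral_cong_AE[OF borel_measurable_integrable[OF Il(1)] m ae] Il(2) by simp
qed

lemma slice_norm:
  fixes y :: "(real \<times> 'a::euclidean_space) l2"
  shows "integrable lebesgue (\<lambda>t. (norm (slice y t))\<^sup>2)"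
    and "(\<integral>t. (norm (slice y t))\<^sup>2 \<partial>lebesgue) = (norm y)\<^sup>2"
  unfolding power2_norm_eq_inner by (rule slice_inner)+

lemma slice_add: "AE t in lebesgue. slice (y + v) t = slice y t + slice v t"
proof -
  obtain f where f: "f \<in> borel_measurable borel" "sq_integrable f" "y = l2_class f" using l2_borel .
  obtain g where g: "g \<in> borel_measurable borel" "sq_integrable g" "v = l2_class g" using l2_borel .
  have "(\<lambda>p. f p + g p) \<in> borel_measurable borel" using f(1) g(1) by measurable
  from slice_class[OF this sq_integrable_add[OF f(2) g(2)]] slice_class[OF f(1,2)] slice_class[OF g(1,2)]
  show ?thesis unfolding AE_lebesgue_iff f(3) g(3) l2_class_add[OF f(2) g(2)]
    by eventually_elim (simp add: l2_class_add)
qed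

lemma slice_scaleR: "AE t in lebesgue. slice (c *\<^sub>R y) t = c *\<^sub>R slice y t"
proof -
  obtain f where f: "f \<in> borel_measurable borel" "sq_integrable f" "y = l2_class f" using l2_borel .
  have "(\<lambda>p. c * f p) \<in> borel_measurable borel" using f(1) by measurable
  from slice_class[OF this sq_integrable_scale[OF f(2)]] slice_class[OF f(1,2)]
  show ?thesis unfolding AE_lebesgue_iff f(3) l2_class_scaleR[OF f(2)]
    by eventually_elim (simp add: l2_class_scaleR)
qed

lemma slice_diff: "AE t in lebesgue. slice (y - v) t = slice y t - slice v t"
  using slice_add[of y "(-1) *\<^sub>R v"] slice_scaleR[of "-1" v] by eventually_elim simp

lemma slice_zero: "AE t in lebesgue. slice 0 t = 0"
  using slice_scaleR[of 0 0] by simp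

lemma slice_eqI: "AE t in lebesgue. slice y t = slice v t \<Longrightarrow> y = v"
proof -
  assume "AE t in lebesgue. slice y t = slice v t"
  then have "AE t in lebesgue. (norm (slice (y - v) t))\<^sup>2 = 0"
    using slice_diff[of y v] by eventually_elim simp
  then have "(\<integral>t. (norm (slice (y - v) t))\<^sup>2 \<partial>lebesgue) = 0"
    by (rule integral_eq_zero_AE)
  then show "y = v" by (simp add: slice_norm)
qed

lemma slice_in_L2_on:
  assumes "y \<in> L2_on (cyl \<Omega> T)"
  shows "AE t in lebesgue. slice y t \<in> L2_on \<Omega> \<and> (t \<notin> {0<..<T} \<longrightarrow> slice y t = 0)"
proof -
  have "AE p in lborel. p \<notin> cyl \<Omega> T \<longrightarrow> rep_l2 y p = 0"
    using assms unfolding L2_on_def AE_lebesgue_iff by simp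
  from AE_lborel_pair[OF this] show ?thesis
    unfolding AE_lebesgue_iff
  proof eventually_elim
    case (elim t)
    show ?case
    proof (cases "sq_integrable (\<lambda>x. rep_l2 y (t, x))")
      case True
      have "l2_class (\<lambda>x. rep_l2 y (t, x)) \<in> L2_on \<Omega>"
        using elim by (intro l2_class_in_L2_on[OF True]) (auto simp: AE_lebesgue_iff cyl_def)
      moreover have "l2_class (\<lambda>x. rep_l2 y (t, x)) = 0" if "t \<notin> {0<..<T}"
        using elim that sq_integrable_AE_eq[OF sq_integrable_zero, of "\<lambda>x. rep_l2 y (t, x)"]
        by (auto simp: cyl_def l2_class_zero)
      ultimately show ?thesis using True by (simp add: slice_def)
    next
      case False
      \<comment> \<open>In this case \<open>slice\<close> takes its default value 0, which lies in
        every \<open>L2_on\<close>.\<close>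
      then show ?thesis using subspace_0[OF subspace_L2_on] by (auto simp: slice_def)
    qed
  qed
qed

text \<open>The squared slice norms of \<open>y n - v\<close> are functions of time whose integrals
  tend to 0, so a subsequence of them tends to 0 almost everywhere.\<close>

lemma slice_subseq_convergent:
  fixes y :: "nat \<Rightarrow> (real \<times> 'a::euclidean_space) l2"
  assumes "y \<longlonglongrightarrow> v"
  shows "\<exists>r. strict_mono r \<and> (AE t in lebesgue. (\<lambda>n. slice (y (r n)) t) \<longlonglongrightarrow> slice v t)"
proof -
  have lim: "(\<lambda>n. (norm (y n - v))\<^sup>2) \<longlonglongrightarrow> 0"
    using tendsto_power[OF tendsto_norm_zero[OF LIM_zero[OF assms]], of 2] by simp
  have "\<exists>r::nat\<Rightarrow>nat. strict_mono r \<and> (AE t in lebesgue. (\<lambda>n. (norm (slice (y (r n) - v) t))\<^sup>2) \<longlonglongrightarrow> 0)"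
    by (rule tendsto_L1_AE_subseq) (use lim in \<open>auto simp: slice_norm\<close>)
  then obtain r where r: "strict_mono r" "AE t in lebesgue. (\<lambda>n. (norm (slice (y (r n) - v) t))\<^sup>2) \<longlonglongrightarrow> 0"
    by blast
  have "AE t in lebesgue. \<forall>n. slice (y (r n) - v) t = slice (y (r n)) t - slice v t"
    unfolding AE_all_countable using slice_diff by blast
  with r(2) have "AE t in lebesgue. (\<lambda>n. slice (y (r n)) t) \<longlonglongrightarrow> slice v t"
  proof eventually_elim
    case (elim t)
    then have "(\<lambda>n. sqrt ((norm (slice (y (r n)) t - slice v t))\<^sup>2)) \<longlonglongrightarrow> sqrt 0"
      by (intro tendsto_real_sqrt) simp
    then show ?case
      by (intro LIM_zero_cancel[of _ "slice v t"]) (simp add: tendsto_norm_zero_iff)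
  qed
  with r(1) show ?thesis by blast
qed

section \<open>Translations\<close>

definition shift :: "'a::euclidean_space \<Rightarrow> 'a l2 \<Rightarrow> 'a l2" where
  "shift a u = l2_class (\<lambda>x. rep_l2 u (x + a))"

lemma integral_translation:
  fixes f :: "'a::euclidean_space \<Rightarrow> real"
  assumes "f \<in> borel_measurable borel"
  shows "integrable lborel (\<lambda>x. f (x + a)) \<longleftrightarrow> integrable lborel f"
    "(\<integral>x. f (x + a) \<partial>lborel) = (\<integral>x. f x \<partial>lborel)"
proof -
  have d: "distr lborel borel (\<lambda>x. x + a) = lborel"
  proof -
    have "(\<lambda>x. x + a) = (+) a" by (auto simp: add.commute)
    then show ?thesis using lborel_distr_plus[of a] by (simp only:)
  qed
  have m: "(\<lambda>x. x + a) \<in> lborel \<rightarrow>\<^sub>M borel" by simp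
  show "integrable lborel (\<lambda>x. f (x + a)) \<longleftrightarrow> integrable lborel f"
    using integrable_distr_eq[OF m assms] unfolding d by simp
  show "(\<integral>x. f (x + a) \<partial>lborel) = (\<integral>x. f x \<partial>lborel)"
    using integral_distr[OF m assms] unfolding d by simp
qed

lemma translation_borel:
  fixes f :: "'a::euclidean_space \<Rightarrow> real"
  assumes "f \<in> borel_measurable borel"
  shows "(\<lambda>x. f (x + a)) \<in> borel_measurable borel"
  by (rule measurable_compose[OF _ assms]) simp

lemma sq_integrable_translation:
  assumes "f \<in> borel_measurable borel" "sq_integrable f"
  shows "sq_integrable (\<lambda>x. f (x + a))"
proof -
  have "(\<lambda>x. (f x)\<^sup>2) \<in> borel_measurable borel" using assms(1) by measurable
  from integral_translation(1)[OF this, of a] show ?thesis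
    using assms by (simp add: sq_integrable_borel translation_borel)
qed

lemma shift_class:
  assumes "f \<in> borel_measurable borel" "sq_integrable f"
  shows "shift a (l2_class f) = l2_class (\<lambda>x. f (x + a))"
  unfolding shift_def
  by (rule sq_integrable_AE_eq(2)[OF sq_integrable_translation[OF assms]])
    (use AE_lborel_translation[OF rep_l2_class[OF assms(2), unfolded AE_lebesgue_iff]] in simp)

lemma inner_shift:
  fixes u v :: "'a::euclidean_space l2"
  shows "inner (shift a u) v = inner u (shift (- a) v)"
proof -
  obtain f where f: "f \<in> borel_measurable borel" "sq_integrable f" "u = l2_class f" using l2_borel .
  obtain g where g: "g \<in> borel_measurable borel" "sq_integrable g" "v = l2_class g" using l2_borel .
  have "(\<lambda>x. f x * g (x - a)) \<in> borel_measurable borel"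
    using f(1) translation_borel[OF g(1), of "- a"] by simp
  from integral_translation(2)[OF this, of a]
  show ?thesis
    using sq_integrable_translation[OF f(1,2), of a] sq_integrable_translation[OF g(1,2), of "- a"]
      translation_borel[OF g(1), of "- a"]
    by (simp add: f(3) g(3) shift_class f g inner_l2_borel translation_borel)
qed

lemma slice_shift:
  fixes u :: "(real \<times> 'a::euclidean_space) l2"
  shows "AE t in lebesgue. slice (shift (h, 0) u) t = slice u (t + h)"
proof -
  obtain f where f: "f \<in> borel_measurable borel" "sq_integrable f" "u = l2_class f" using l2_borel .
  from slice_class[OF translation_borel[OF f(1), of "(h, 0)"] sq_integrable_translation[OF f(1,2), of "(h, 0)"]]
    AE_lborel_translation[OF slice_class[OF f(1,2)], of h]
  show ?thesis unfolding AE_lebesgue_iff f(3) shift_class[OF f(1,2)]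
    by eventually_elim simp
qed

subsection \<open>Weak derivatives and \<open>H^1_0\<close>\<close>

lemma l2_class_sum:
  assumes "finite J" "\<And>j. j \<in> J \<Longrightarrow> sq_integrable (f j)"
  shows "sq_integrable (\<lambda>x. \<Sum>j\<in>J. f j x) \<and> l2_class (\<lambda>x. \<Sum>j\<in>J. f j x) = (\<Sum>j\<in>J. l2_class (f j))"
  using assms
  by (induction J rule: finite_induct)
     (auto simp: sq_integrable_zero l2_class_zero l2_class_add[symmetric] sq_integrable_add)

lemma weak_pd_add: "weak_pd S i v w \<Longrightarrow> weak_pd S i v' w' \<Longrightarrow> weak_pd S i (v + v') (w + w')"
  by (simp add: weak_pd_def inner_add_left)

lemma weak_pd_scaleR: "weak_pd S i v w \<Longrightarrow> weak_pd S i (c *\<^sub>R v) (c *\<^sub>R w)"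
  by (simp add: weak_pd_def)

lemma weak_pd_tendsto:
  assumes "\<And>n. weak_pd S i (v n) (w n)" "v \<longlonglongrightarrow> v'" "w \<longlonglongrightarrow> w'"
  shows "weak_pd S i v' w'"
  unfolding weak_pd_def
proof (intro allI impI)
  fix \<phi> assume "test_fun S \<phi>"
  then have "(\<lambda>n. inner (v n) (l2_class (pd i \<phi>))) = (\<lambda>n. - inner (w n) (l2_class \<phi>))"
    using assms(1) unfolding weak_pd_def by blast
  then show "inner v' (l2_class (pd i \<phi>)) = - inner w' (l2_class \<phi>)"
    using tendsto_inner[OF assms(2) tendsto_const[of "l2_class (pd i \<phi>)"]]
      tendsto_minus[OF tendsto_inner[OF assms(3) tendsto_const[of "l2_class \<phi>"]]]
    by (simp only: LIMSEQ_unique)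
qed

lemma weak_pd_unique:
  assumes "open S" "w \<in> L2_on S" "w' \<in> L2_on S" "weak_pd S i v w" "weak_pd S i v w'"
  shows "w = w'"
proof -
  have "w - w' = 0"
  proof (rule test_orthogonal_imp_zero[OF assms(1)])
    show "w - w' \<in> L2_on S" using assms subspace_diff[OF subspace_L2_on] by blast
    show "inner (w - w') (l2_class \<phi>) = 0" if "test_fun S \<phi>" for \<phi>
      using assms(4,5) that unfolding weak_pd_def by (simp add: inner_diff_left)
  qed
  then show ?thesis by simp
qed

lemma weak_laplacian_add:
  "weak_laplacian S v w \<Longrightarrow> weak_laplacian S v' w' \<Longrightarrow> weak_laplacian S (v + v') (w + w')"
  by (simp add: weak_laplacian_def inner_add_left)

lemma weak_laplacian_scaleR: "weak_laplacian S v w \<Longrightarrow> weak_laplacian S (c *\<^sub>R v) (c *\<^sub>R w)"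
  by (simp add: weak_laplacian_def)

lemma weak_laplacian_tendsto:
  assumes "\<And>n. weak_laplacian S (v n) (w n)" "v \<longlonglongrightarrow> v'" "w \<longlonglongrightarrow> w'"
  shows "weak_laplacian S v' w'"
  unfolding weak_laplacian_def
proof (intro allI impI)
  fix \<phi> assume "test_fun S \<phi>"
  then have "(\<lambda>n. inner (v n) (l2_class (\<lambda>x. \<Sum>i\<in>Basis. pd i (pd i \<phi>) x))) = (\<lambda>n. inner (w n) (l2_class \<phi>))"
    using assms(1) unfolding weak_laplacian_def by blast
  then show "inner v' (l2_class (\<lambda>x. \<Sum>i\<in>Basis. pd i (pd i \<phi>) x)) = inner w' (l2_class \<phi>)"
    using tendsto_inner[OF assms(2) tendsto_const[of "l2_class (\<lambda>x. \<Sum>i\<in>Basis. pd i (pd i \<phi>) x)"]]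
      tendsto_inner[OF assms(3) tendsto_const[of "l2_class \<phi>"]]
    by (simp only: LIMSEQ_unique)
qed

lemma weak_laplacian_unique:
  assumes "open S" "w \<in> L2_on S" "w' \<in> L2_on S" "weak_laplacian S v w" "weak_laplacian S v w'"
  shows "w = w'"
proof -
  have "w - w' = 0"
  proof (rule test_orthogonal_imp_zero[OF assms(1)])
    show "w - w' \<in> L2_on S" using assms subspace_diff[OF subspace_L2_on] by blast
    show "inner (w - w') (l2_class \<phi>) = 0" if "test_fun S \<phi>" for \<phi>
      using assms(4,5) that unfolding weak_laplacian_def by (simp add: inner_diff_left)
  qed
  then show ?thesis by simp
qed

section \<open>Green's formula and closedness of \<open>H^1_0\<close>\<close>

text \<open>\<open>H1_0\<close> hides the gradient under an existential quantifier. Here it is an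
  argument, so that Green's formula and the limits of gradients can refer to it.\<close>

definition H1_0_grad :: "'a::euclidean_space set \<Rightarrow> 'a l2 \<Rightarrow> ('a \<Rightarrow> 'a l2) \<Rightarrow> bool" where
  "H1_0_grad \<Omega> v Dv \<longleftrightarrow> v \<in> L2_on \<Omega> \<and> (\<forall>i\<in>Basis. Dv i \<in> L2_on \<Omega> \<and> weak_pd \<Omega> i v (Dv i)) \<and>
     (\<exists>\<phi>. (\<forall>n::nat. test_fun \<Omega> (\<phi> n)) \<and> (\<lambda>n. l2_class (\<phi> n)) \<longlonglongrightarrow> v \<and>
        (\<forall>i\<in>Basis. (\<lambda>n. l2_class (pd i (\<phi> n))) \<longlonglongrightarrow> Dv i))"

lemma H1_0_iff: "v \<in> H1_0 \<Omega> \<longleftrightarrow> (\<exists>Dv. H1_0_grad \<Omega> v Dv)"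
  by (auto simp: H1_0_def H1_0_grad_def)

lemma test_fun_differentiable: "test_fun S f \<Longrightarrow> f differentiable (at x)"
  using C_k_differentiable[OF test_fun_C_k] .

lemma pd_add:
  assumes "test_fun S f" "test_fun S g"
  shows "pd i (\<lambda>x. f x + g x) = (\<lambda>x. pd i f x + pd i g x)"
  using has_derivative_add[OF has_derivative_pd has_derivative_pd,
      OF test_fun_differentiable[OF assms(1)] test_fun_differentiable[OF assms(2)]]
  by (intro ext pd_eqI)

lemma pd_scale:
  assumes "test_fun S f"
  shows "pd i (\<lambda>x. c * f x) = (\<lambda>x. c * pd i f x)"
  using has_derivative_mult_right[OF has_derivative_pd, OF test_fun_differentiable[OF assms(1)]]
  by (intro ext pd_eqI)

lemma H1_0_grad_add:
  assumes "H1_0_grad \<Omega> v D" "H1_0_grad \<Omega> w E"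
  shows "H1_0_grad \<Omega> (v + w) (\<lambda>i. D i + E i)"
proof -
  obtain \<phi> where \<phi>: "\<And>n::nat. test_fun \<Omega> (\<phi> n)" "(\<lambda>n. l2_class (\<phi> n)) \<longlonglongrightarrow> v"
    "\<And>i. i \<in> Basis \<Longrightarrow> (\<lambda>n. l2_class (pd i (\<phi> n))) \<longlonglongrightarrow> D i"
    using assms(1) unfolding H1_0_grad_def by blast
  obtain \<psi> where \<psi>: "\<And>n::nat. test_fun \<Omega> (\<psi> n)" "(\<lambda>n. l2_class (\<psi> n)) \<longlonglongrightarrow> w"
    "\<And>i. i \<in> Basis \<Longrightarrow> (\<lambda>n. l2_class (pd i (\<psi> n))) \<longlonglongrightarrow> E i"
    using assms(2) unfolding H1_0_grad_def by blast
  have 1: "l2_class (\<lambda>x. \<phi> n x + \<psi> n x) = l2_class (\<phi> n) + l2_class (\<psi> n)" for n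
    by (rule l2_class_add[symmetric]; rule test_fun_sq_integrable; rule \<phi> \<psi>)
  have 2: "l2_class (pd i (\<lambda>x. \<phi> n x + \<psi> n x)) = l2_class (pd i (\<phi> n)) + l2_class (pd i (\<psi> n))"
    if "i \<in> Basis" for i n
    unfolding pd_add[OF \<phi>(1) \<psi>(1)]
    by (rule l2_class_add[symmetric]; rule test_fun_sq_integrable; rule test_fun_pd; rule \<phi> \<psi> that)
  have "\<exists>\<phi>. (\<forall>n::nat. test_fun \<Omega> (\<phi> n)) \<and> (\<lambda>n. l2_class (\<phi> n)) \<longlonglongrightarrow> v + w \<and>
        (\<forall>i\<in>Basis. (\<lambda>n. l2_class (pd i (\<phi> n))) \<longlonglongrightarrow> D i + E i)"
    by (rule exI[of _ "\<lambda>n x. \<phi> n x + \<psi> n x"])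
       (simp add: 1 2 test_fun_add \<phi> \<psi> tendsto_add)
  then show ?thesis
    using assms subspace_add[OF subspace_L2_on] weak_pd_add unfolding H1_0_grad_def by blast
qed

lemma H1_0_grad_scaleR:
  assumes "H1_0_grad \<Omega> v D"
  shows "H1_0_grad \<Omega> (c *\<^sub>R v) (\<lambda>i. c *\<^sub>R D i)"
proof -
  obtain \<phi> where \<phi>: "\<And>n::nat. test_fun \<Omega> (\<phi> n)" "(\<lambda>n. l2_class (\<phi> n)) \<longlonglongrightarrow> v"
    "\<And>i. i \<in> Basis \<Longrightarrow> (\<lambda>n. l2_class (pd i (\<phi> n))) \<longlonglongrightarrow> D i"
    using assms(1) unfolding H1_0_grad_def by blast
  have 1: "l2_class (\<lambda>x. c * \<phi> n x) = c *\<^sub>R l2_class (\<phi> n)" for n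
    by (rule l2_class_scaleR[symmetric], rule test_fun_sq_integrable, rule \<phi>)
  have 2: "l2_class (pd i (\<lambda>x. c * \<phi> n x)) = c *\<^sub>R l2_class (pd i (\<phi> n))"
    if "i \<in> Basis" for i n
    unfolding pd_scale[OF \<phi>(1)]
    by (rule l2_class_scaleR[symmetric], rule test_fun_sq_integrable, rule test_fun_pd; rule \<phi> that)
  have "\<exists>\<phi>. (\<forall>n::nat. test_fun \<Omega> (\<phi> n)) \<and> (\<lambda>n. l2_class (\<phi> n)) \<longlonglongrightarrow> c *\<^sub>R v \<and>
        (\<forall>i\<in>Basis. (\<lambda>n. l2_class (pd i (\<phi> n))) \<longlonglongrightarrow> c *\<^sub>R D i)"
    by (rule exI[of _ "\<lambda>n x. c * \<phi> n x"])
       (simp add: 1 2 test_fun_scale \<phi> tendsto_scaleR)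
  then show ?thesis
    using assms subspace_scale[OF subspace_L2_on] weak_pd_scaleR unfolding H1_0_grad_def by blast
qed

text \<open>If \<open>v\<close> is a test function, the weak Laplacian of \<open>w\<close> followed
  by its weak gradient gives the formula, since partial derivatives of test functions are test
  functions. Both sides are continuous along the sequence that approximates \<open>v\<close>
  together with its gradient.\<close>

lemma green:
  assumes "H1_0_grad \<Omega> v D" "H1_0_grad \<Omega> w E" "weak_laplacian \<Omega> w g"
  shows "inner v g = - (\<Sum>i\<in>Basis. inner (D i) (E i))"
proof -
  have test: "inner (l2_class \<phi>) g = - (\<Sum>i\<in>Basis. inner (l2_class (pd i \<phi>)) (E i))"
    if \<phi>: "test_fun \<Omega> \<phi>" for \<phi>
  proof -
    have "inner g (l2_class \<phi>) = inner w (l2_class (\<lambda>x. \<Sum>i\<in>Basis. pd i (pd i \<phi>) x))"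
      using assms(3) \<phi> unfolding weak_laplacian_def by simp
    also have "l2_class (\<lambda>x. \<Sum>i\<in>Basis. pd i (pd i \<phi>) x) = (\<Sum>i\<in>Basis. l2_class (pd i (pd i \<phi>)))"
      using l2_class_sum[of Basis "\<lambda>i. pd i (pd i \<phi>)"] test_fun_sq_integrable[OF test_fun_pd[OF test_fun_pd[OF \<phi>]]]
      by simp
    also have "inner w \<dots> = (\<Sum>i\<in>Basis. inner w (l2_class (pd i (pd i \<phi>))))"
      by (rule inner_sum_right)
    also have "\<dots> = (\<Sum>i\<in>Basis. - inner (E i) (l2_class (pd i \<phi>)))"
      using assms(2) test_fun_pd[OF \<phi>] unfolding H1_0_grad_def weak_pd_def by (intro sum.cong) auto
    finally show ?thesis by (simp add: sum_negf inner_commute)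
  qed
  obtain \<phi> where \<phi>: "\<And>n::nat. test_fun \<Omega> (\<phi> n)" "(\<lambda>n. l2_class (\<phi> n)) \<longlonglongrightarrow> v"
    "\<And>i. i \<in> Basis \<Longrightarrow> (\<lambda>n. l2_class (pd i (\<phi> n))) \<longlonglongrightarrow> D i"
    using assms(1) unfolding H1_0_grad_def by blast
  have "(\<lambda>n. - (\<Sum>i\<in>Basis. inner (l2_class (pd i (\<phi> n))) (E i))) \<longlonglongrightarrow> - (\<Sum>i\<in>Basis. inner (D i) (E i))"
    by (intro tendsto_minus tendsto_sum tendsto_inner \<phi>(3) tendsto_const)
  moreover have "(\<lambda>n. inner (l2_class (\<phi> n)) g) \<longlonglongrightarrow> inner v g"
    by (intro tendsto_inner \<phi>(2) tendsto_const)
  ultimately show ?thesis unfolding test[OF \<phi>(1)] by (intro LIMSEQ_unique)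
qed

lemma subspace_H1_0: "subspace (H1_0 \<Omega>)"
proof (rule subspaceI)
  have "H1_0_grad \<Omega> 0 (\<lambda>i. 0)"
    unfolding H1_0_grad_def
  proof (intro conjI exI[of _ "\<lambda>n x. 0"])
    have "pd i (\<lambda>x. 0::real) = (\<lambda>x. 0)" for i :: 'a
      by (rule ext, rule pd_eqI, rule has_derivative_const)
    then show "\<forall>i\<in>Basis. (\<lambda>n::nat. l2_class (pd i (\<lambda>x::'a. 0))) \<longlonglongrightarrow> 0"
      by (simp add: l2_class_zero)
  qed (simp_all add: subspace_0[OF subspace_L2_on] weak_pd_def test_fun_zero l2_class_zero)
  then show "0 \<in> H1_0 \<Omega>" unfolding H1_0_iff by blast
next
  fix v w assume "v \<in> H1_0 \<Omega>" "w \<in> H1_0 \<Omega>"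
  then show "v + w \<in> H1_0 \<Omega>" unfolding H1_0_iff using H1_0_grad_add by blast
next
  fix c v assume "v \<in> H1_0 \<Omega>"
  then show "c *\<^sub>R v \<in> H1_0 \<Omega>" unfolding H1_0_iff using H1_0_grad_scaleR by blast
qed

lemma laplacian_symmetric:
  assumes "v \<in> H1_0 \<Omega>" "w \<in> H1_0 \<Omega>" "weak_laplacian \<Omega> v f" "weak_laplacian \<Omega> w g"
  shows "inner v g = inner w f"
proof -
  obtain D E where DE: "H1_0_grad \<Omega> v D" "H1_0_grad \<Omega> w E" using assms H1_0_iff by metis
  then show ?thesis using green[OF DE assms(4)] green[OF DE(2,1) assms(3)]
    by (simp add: inner_commute)
qed

lemma laplacian_nonpos:
  assumes "v \<in> H1_0 \<Omega>" "weak_laplacian \<Omega> v f"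
  shows "inner v f \<le> 0"
proof -
  obtain D where D: "H1_0_grad \<Omega> v D" using assms H1_0_iff by metis
  show ?thesis using green[OF D D assms(2)] by (simp add: sum_nonneg)
qed

text \<open>Green's formula for \<open>v n - v m\<close> bounds the gradient differences by the
  differences of the functions and of their Laplacians, so the gradients form Cauchy sequences. A
  diagonal choice of test functions, the \<open>n\<close>-th one close to \<open>v n\<close> and its
  gradient, approximates the limit.\<close>

lemma H1_0_closed:
  fixes v g :: "nat \<Rightarrow> 'a::euclidean_space l2"
  assumes \<Omega>: "open \<Omega>" and v: "\<And>n. v n \<in> H1_0 \<Omega>" "\<And>n. weak_laplacian \<Omega> (v n) (g n)"
    and lim: "v \<longlonglongrightarrow> v'" "g \<longlonglongrightarrow> g'"
  shows "v' \<in> H1_0 \<Omega>"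
proof -
  have cl: "closed (L2_on \<Omega>)"
    by (rule closed_L2_on[OF sets_lebesgue_open[OF \<Omega>]])
  obtain D where D: "\<And>n. H1_0_grad \<Omega> (v n) (D n)"
    using v(1) unfolding H1_0_iff by metis
  have diff: "(norm (D n i - D m i))\<^sup>2 \<le> norm (v n - v m) * norm (g n - g m)" if "i \<in> Basis" for n m i
  proof -
    have grad: "H1_0_grad \<Omega> (v n + (-1) *\<^sub>R v m) (\<lambda>i. D n i + (-1) *\<^sub>R D m i)"
      by (intro H1_0_grad_add H1_0_grad_scaleR D)
    have "inner (v n + (-1) *\<^sub>R v m) (g n + (-1) *\<^sub>R g m)
      = - (\<Sum>i\<in>Basis. inner (D n i + (-1) *\<^sub>R D m i) (D n i + (-1) *\<^sub>R D m i))"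
      by (rule green[OF grad grad]) (intro weak_laplacian_add weak_laplacian_scaleR v)
    then have "(\<Sum>i\<in>Basis. (norm (D n i - D m i))\<^sup>2) = - inner (v n - v m) (g n - g m)"
      by (simp add: power2_norm_eq_inner)
    also have "\<dots> \<le> norm (v n - v m) * norm (g n - g m)"
      using Cauchy_Schwarz_ineq2[of "v n - v m" "g n - g m"] by (simp add: abs_le_iff)
    finally show ?thesis
      using member_le_sum[of i Basis "\<lambda>i. (norm (D n i - D m i))\<^sup>2"] that by simp
  qed
  have "\<exists>l. (\<lambda>n. D n i) \<longlonglongrightarrow> l" if i: "i \<in> Basis" for i
  proof -
    have "Cauchy (\<lambda>n. D n i)"
    proof (rule metric_CauchyI)
      fix e :: real assume e: "e > 0"
      obtain M where M: "\<And>n m. n \<ge> M \<Longrightarrow> m \<ge> M \<Longrightarrow> norm (v n - v m) < e"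
        using LIMSEQ_imp_Cauchy[OF lim(1)] e unfolding Cauchy_def dist_norm by metis
      obtain N where N: "\<And>n m. n \<ge> N \<Longrightarrow> m \<ge> N \<Longrightarrow> norm (g n - g m) < e"
        using LIMSEQ_imp_Cauchy[OF lim(2)] e unfolding Cauchy_def dist_norm by metis
      show "\<exists>M. \<forall>m\<ge>M. \<forall>n\<ge>M. dist (D m i) (D n i) < e"
      proof (intro exI[of _ "max M N"] allI impI)
        fix m n assume mn: "m \<ge> max M N" "n \<ge> max M N"
        have "(norm (D m i - D n i))\<^sup>2 \<le> norm (v m - v n) * norm (g m - g n)" by (rule diff[OF i])
        also have "\<dots> < e * e"
          using M[of m n] N[of m n] mn e by (intro mult_strict_mono) auto
        finally have "norm (D m i - D n i) < e"
          using e by (intro power2_less_imp_less[of _ e]) (auto simp: power2_eq_square)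
        then show "dist (D m i) (D n i) < e" by (simp add: dist_norm)
      qed
    qed
    then show ?thesis using complete_l2 unfolding complete_def by blast
  qed
  then obtain D' where D': "\<And>i. i \<in> Basis \<Longrightarrow> (\<lambda>n. D n i) \<longlonglongrightarrow> D' i" by metis
  have "\<exists>\<phi>. test_fun \<Omega> \<phi> \<and> norm (l2_class \<phi> - v n) < inverse (real (Suc n)) \<and>
      (\<forall>i\<in>Basis. norm (l2_class (pd i \<phi>) - D n i) < inverse (real (Suc n)))" for n
  proof -
    obtain \<phi> where \<phi>: "\<And>k::nat. test_fun \<Omega> (\<phi> k)" "(\<lambda>k. l2_class (\<phi> k)) \<longlonglongrightarrow> v n"
      "\<And>i. i \<in> Basis \<Longrightarrow> (\<lambda>k. l2_class (pd i (\<phi> k))) \<longlonglongrightarrow> D n i"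
      using D[of n] unfolding H1_0_grad_def by blast
    have pos: "inverse (real (Suc n)) > 0" by simp
    have "\<forall>\<^sub>F k in sequentially. norm (l2_class (\<phi> k) - v n) < inverse (real (Suc n))"
      using tendstoD[OF \<phi>(2) pos] by (simp add: dist_norm)
    moreover have "\<forall>\<^sub>F k in sequentially. \<forall>i\<in>Basis. norm (l2_class (pd i (\<phi> k)) - D n i) < inverse (real (Suc n))"
      using tendstoD[OF \<phi>(3) pos] by (intro eventually_ball_finite) (auto simp: dist_norm)
    ultimately have "\<forall>\<^sub>F k in sequentially. norm (l2_class (\<phi> k) - v n) < inverse (real (Suc n)) \<and>
      (\<forall>i\<in>Basis. norm (l2_class (pd i (\<phi> k)) - D n i) < inverse (real (Suc n)))"
      by (rule eventually_conj)
    then show ?thesis using \<phi>(1) eventually_happens'[OF sequentially_bot] by blast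
  qed
  then obtain \<phi> where \<phi>: "\<And>n. test_fun \<Omega> (\<phi> n)" "\<And>n. norm (l2_class (\<phi> n) - v n) < inverse (real (Suc n))"
    "\<And>n i. i \<in> Basis \<Longrightarrow> norm (l2_class (pd i (\<phi> n)) - D n i) < inverse (real (Suc n))"
    by metis
  have close: "a \<longlonglongrightarrow> l" if "b \<longlonglongrightarrow> l" "\<And>n. norm (a n - b n) < inverse (real (Suc n))" for a b :: "nat \<Rightarrow> 'a l2" and l
  proof -
    have "(\<lambda>n. a n - b n) \<longlonglongrightarrow> 0"
      using Lim_null_comparison[OF _ LIMSEQ_inverse_real_of_nat] that(2) less_imp_le
      by (metis (mono_tags, lifting) eventuallyI)
    from tendsto_add[OF this that(1)] show ?thesis by simp
  qed
  have "H1_0_grad \<Omega> v' D'"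
    unfolding H1_0_grad_def
  proof (intro conjI ballI exI[of _ \<phi>] allI)
    show "v' \<in> L2_on \<Omega>"
      using closed_sequentially[OF cl _ lim(1)] D unfolding H1_0_grad_def by blast
    show "test_fun \<Omega> (\<phi> n)" for n by (rule \<phi>)
    show "(\<lambda>n. l2_class (\<phi> n)) \<longlonglongrightarrow> v'" by (rule close[OF lim(1) \<phi>(2)])
  next
    fix i :: 'a assume i: "i \<in> Basis"
    show "D' i \<in> L2_on \<Omega>"
      using closed_sequentially[OF cl _ D'[OF i]] D i unfolding H1_0_grad_def by blast
    show "weak_pd \<Omega> i v' (D' i)"
      by (rule weak_pd_tendsto[OF _ lim(1) D'[OF i]]) (use D i in \<open>auto simp: H1_0_grad_def\<close>)
    show "(\<lambda>n. l2_class (pd i (\<phi> n))) \<longlonglongrightarrow> D' i" by (rule close[OF D'[OF i] \<phi>(3)[OF i]])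
  qed
  then show ?thesis unfolding H1_0_iff by blast
qed

subsection \<open>Weak time derivatives\<close>

text \<open>Membership in \<open>H1_0star\<close> with the time derivative as an explicit
  argument.\<close>

definition H1_time :: "'a::euclidean_space set \<Rightarrow> real \<Rightarrow> (real \<times> 'a) l2 \<Rightarrow> (real \<times> 'a) l2 \<Rightarrow> bool" where
  "H1_time \<Omega> T y w \<longleftrightarrow> y \<in> L2_on (cyl \<Omega> T) \<and> w \<in> L2_on (cyl \<Omega> T) \<and> weak_pd (cyl \<Omega> T) (1, 0) y w \<and>
     (\<exists>z. continuous_on {0..T} z \<and> z 0 = 0 \<and> (AE t in lebesgue. t \<in> {0<..<T} \<longrightarrow> slice y t = z t))"

lemma open_cyl: "open \<Omega> \<Longrightarrow> open (cyl \<Omega> T)"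
  unfolding cyl_def by (intro open_Times) auto

lemma test_fun_time_derivative:
  fixes \<phi> :: "real \<times> 'a::euclidean_space \<Rightarrow> real"
  assumes "test_fun S \<phi>"
  shows "((\<lambda>t. \<phi> (t, x)) has_real_derivative pd (1, 0) \<phi> (t, x)) (at t)"
proof -
  have D: "(\<phi> has_derivative (\<lambda>h. pd h \<phi> (t, x))) (at (t, x))"
    by (rule has_derivative_pd[OF test_fun_differentiable[OF assms]])
  have "((\<lambda>t. \<phi> (t, x)) has_derivative (\<lambda>h. pd (h, 0) \<phi> (t, x))) (at t)"
    by (rule has_derivative_compose[of "\<lambda>t. (t, x)" "\<lambda>h. (h, 0)", OF _ D])
       (auto intro!: derivative_eq_intros)
  moreover have "(\<lambda>h. pd (h, 0) \<phi> (t, x)) = (*) (pd (1, 0) \<phi> (t, x))"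
  proof
    fix h show "pd (h, 0) \<phi> (t, x) = pd (1, 0) \<phi> (t, x) * h"
      using linear_scale[OF has_derivative_linear[OF D], of h "(1, 0)"] by (simp add: mult.commute)
  qed
  ultimately show ?thesis
    unfolding has_field_derivative_def by metis
qed

section \<open>Primitives in time\<close>

text \<open>A nonnegative integral is meaningful before integrability is known, so Tonelli estimates
  can be fed in directly and yield membership in \<open>L^2\<close> along with the norm
  bound.\<close>

lemma norm_l2_class_bound:
  assumes f: "f \<in> borel_measurable borel" and "C \<ge> 0"
    and bound: "(\<integral>\<^sup>+x. ennreal ((f x)\<^sup>2) \<partial>lborel) \<le> ennreal (C\<^sup>2)"
  shows "sq_integrable f" "norm (l2_class f) \<le> C"
proof -
  have m: "(\<lambda>x. (f x)\<^sup>2) \<in> borel_measurable borel" using f by measurable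
  have "integrable lborel (\<lambda>x. (f x)\<^sup>2)"
  proof (rule integrableI_bounded)
    show "(\<integral>\<^sup>+x. ennreal (norm ((f x)\<^sup>2)) \<partial>lborel) < \<infinity>"
      using bound by (simp add: le_less_trans)
  qed (use m in simp)
  then show sq: "sq_integrable f" using f by (simp add: sq_integrable_borel)
  have "ennreal ((norm (l2_class f))\<^sup>2) = (\<integral>\<^sup>+x. ennreal ((f x)\<^sup>2) \<partial>lborel)"
    using sq m by (subst nn_integral_eq_integral) (auto simp: sq_integrable_borel[OF f] norm_l2_class integral_borel)
  then have "ennreal ((norm (l2_class f))\<^sup>2) \<le> ennreal (C\<^sup>2)"
    using bound by (simp only:)
  then have "(norm (l2_class f))\<^sup>2 \<le> C\<^sup>2"
    by (simp only: ennreal_le_iff zero_le_power2)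
  then show "norm (l2_class f) \<le> C"
    using assms(2) by (rule power2_le_imp_le)
qed

lemma nn_integral_sq_eq_norm:
  assumes "f \<in> borel_measurable borel" "sq_integrable f"
  shows "(\<integral>\<^sup>+x. ennreal ((f x)\<^sup>2) \<partial>lborel) = ennreal ((norm (l2_class f))\<^sup>2)"
proof -
  have m: "(\<lambda>x. (f x)\<^sup>2) \<in> borel_measurable borel" using assms by measurable
  show ?thesis using assms m
    by (subst nn_integral_eq_integral) (auto simp: sq_integrable_borel norm_l2_class integral_borel)
qed

text \<open>Cauchy-Schwarz for the indicator of the interval against the truncation of
  \<open>g\<close>. The truncation keeps the energy on the right local to the interval, which is
  what makes the bound integrable in \<open>t\<close> with a gain of a factor
  \<open>h\<close>.\<close>

lemma interval_Cauchy_Schwarz: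
  fixes g :: "real \<Rightarrow> real"
  assumes g [measurable]: "g \<in> borel_measurable borel" and sq: "sq_integrable g" and "s \<le> t"
  shows "ennreal ((\<integral>r. indicator {s<..t} r * g r \<partial>lborel)\<^sup>2)
    \<le> ennreal (t - s) * (\<integral>\<^sup>+r. indicator {s<..t} r * ennreal ((g r)\<^sup>2) \<partial>lborel)"
proof -
  define i :: "real \<Rightarrow> real" where "i = indicator {s<..t}"
  have i [measurable]: "i \<in> borel_measurable borel" unfolding i_def by measurable
  have sqi: "sq_integrable i"
    unfolding i_def by (rule bounded_compact_support_sq_integrable[of _ "{s..t}" 1]) (auto simp: indicator_def)
  have sqg: "sq_integrable (\<lambda>r. i r * g r)"
    unfolding i_def by (rule sq_integrable_indicator_mult[OF _ sq]) simp
  have "(\<integral>r. i r * g r \<partial>lborel) = inner (l2_class i) (l2_class (\<lambda>r. i r * g r))"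
    by (subst inner_l2_borel[OF sqi sqg]) (auto simp: i_def indicator_def intro!: Bochner_Integration.integral_cong)
  then have "(\<integral>r. i r * g r \<partial>lborel)\<^sup>2 \<le> (norm (l2_class i))\<^sup>2 * (norm (l2_class (\<lambda>r. i r * g r)))\<^sup>2"
    using Cauchy_Schwarz_ineq[of "l2_class i" "l2_class (\<lambda>r. i r * g r)"]
    by (simp add: power2_norm_eq_inner)
  then have "ennreal ((\<integral>r. i r * g r \<partial>lborel)\<^sup>2)
      \<le> ennreal ((norm (l2_class i))\<^sup>2) * ennreal ((norm (l2_class (\<lambda>r. i r * g r)))\<^sup>2)"
    by (simp add: ennreal_mult[symmetric] ennreal_leI)
  also have "ennreal ((norm (l2_class i))\<^sup>2) = (\<integral>\<^sup>+r. indicator {s<..t} r \<partial>lborel)"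
    unfolding nn_integral_sq_eq_norm[OF i sqi, symmetric]
    by (intro nn_integral_cong) (auto simp: i_def indicator_def)
  also have "\<dots> = ennreal (t - s)" using \<open>s \<le> t\<close> by simp
  also have "ennreal ((norm (l2_class (\<lambda>r. i r * g r)))\<^sup>2)
      = (\<integral>\<^sup>+r. indicator {s<..t} r * ennreal ((g r)\<^sup>2) \<partial>lborel)"
    using nn_integral_sq_eq_norm[OF _ sqg, symmetric]
    by (simp, intro nn_integral_cong) (auto simp: i_def indicator_def)
  finally show ?thesis unfolding i_def .
qed

text \<open>Fubini on the triangle \<open>r \<le> t\<close>: the inner integral of \<open>p'\<close>
  from \<open>r\<close> to \<open>T\<close> is \<open>p T - p r = - p r\<close>. The primitive of
  \<open>g\<close> is thereby never differentiated; smoothness is used of \<open>p\<close>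
  alone.\<close>

lemma primitive_by_parts:
  fixes g p p' :: "real \<Rightarrow> real"
  assumes g: "integrable lborel g" "\<And>r. r \<notin> {0<..<T} \<Longrightarrow> g r = 0" and T: "T > 0"
    and p: "\<And>t. (p has_real_derivative p' t) (at t)" "continuous_on UNIV p'" "p T = 0"
  shows "(\<integral>t. indicator {0<..<T} t * (\<integral>r. indicator {..t} r * g r \<partial>lborel) * p' t \<partial>lborel)
    = - (\<integral>r. g r * p r \<partial>lborel)"
proof -
  have p'm [measurable]: "p' \<in> borel_measurable borel" by (rule borel_measurable_continuous_onI) fact
  have gm [measurable]: "g \<in> borel_measurable borel" using g(1) by simp
  define k where "k = (\<lambda>t r. indicator {0<..<T} t * p' t * (indicator {..t} r * g r))"
  have km: "case_prod k \<in> borel_measurable (lborel \<Otimes>\<^sub>M lborel)"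
  proof -
    have eq: "(\<lambda>(t, r). indicator {0<..<T} t * p' t * (indicator {..t} r * g r))
       = (\<lambda>q::real \<times> real. indicator {0<..<T} (fst q) * p' (fst q) * ((if snd q \<le> fst q then 1 else 0) * g (snd q)))"
      by (auto simp: fun_eq_iff indicator_def)
    show ?thesis unfolding k_def eq by measurable
  qed
  have ip: "integrable lborel (\<lambda>t. indicator {0<..<T} t * p' t)"
  proof -
    have "integrable lborel (\<lambda>t. indicator {0..T} t *\<^sub>R p' t)"
      by (rule borel_integrable_compact) (auto intro: continuous_on_subset[OF p(2)])
    then show ?thesis
      by (rule Bochner_Integration.integrable_bound) (auto simp: indicator_def)
  qed
  have kint: "integrable (lborel \<Otimes>\<^sub>M lborel) (case_prod k)"
  proof (rule lborel_pair.Fubini_integrable[OF km])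
    have ir: "integrable lborel (\<lambda>r. indicator {..t} r * g r)" for t :: real
      using integrable_mult_indicator[OF _ g(1), of "{..t}"] by simp
    show "AE t in lborel. integrable lborel (\<lambda>r. case (t, r) of (t, r) \<Rightarrow> k t r)"
      using ir by (auto simp: k_def)
    show "integrable lborel (\<lambda>t. \<integral>r. norm (case (t, r) of (t, r) \<Rightarrow> k t r) \<partial>lborel)"
    proof (rule Bochner_Integration.integrable_bound)
      show "integrable lborel (\<lambda>t. (indicator {0<..<T} t * p' t) * (\<integral>r. \<bar>g r\<bar> \<partial>lborel))"
        using ip by simp
      have "(\<lambda>t. \<integral>r. norm (k t r) \<partial>lborel) \<in> borel_measurable lborel"
        by (rule lborel.borel_measurable_lebesgue_integral) (use km in simp)
      then show "(\<lambda>t. \<integral>r. norm (case (t, r) of (t, r) \<Rightarrow> k t r) \<partial>lborel) \<in> borel_measurable lborel"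
        by simp
      have "\<bar>\<integral>r. norm (k t r) \<partial>lborel\<bar> \<le> \<bar>indicator {0<..<T} t * p' t * (\<integral>r. \<bar>g r\<bar> \<partial>lborel)\<bar>" for t
      proof -
        have "(\<integral>r. norm (k t r) \<partial>lborel) = \<bar>indicator {0<..<T} t * p' t\<bar> * (\<integral>r. \<bar>indicator {..t} r * g r\<bar> \<partial>lborel)"
          unfolding k_def by (simp add: abs_mult)
        also have "\<dots> \<le> \<bar>indicator {0<..<T} t * p' t\<bar> * (\<integral>r. \<bar>g r\<bar> \<partial>lborel)"
          using ir[of t] g(1) by (intro mult_left_mono integral_mono) (auto simp: indicator_def)
        finally have "(\<integral>r. norm (k t r) \<partial>lborel) \<le> \<bar>indicator {0<..<T} t * p' t\<bar> * (\<integral>r. \<bar>g r\<bar> \<partial>lborel)" .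
        moreover have "(\<integral>r. norm (k t r) \<partial>lborel) \<ge> 0" by simp
        ultimately show ?thesis by (simp add: abs_mult)
      qed
      then show "AE t in lborel. norm (\<integral>r. norm (case (t, r) of (t, r) \<Rightarrow> k t r) \<partial>lborel)
          \<le> norm (indicator {0<..<T} t * p' t * (\<integral>r. \<bar>g r\<bar> \<partial>lborel))" by simp
    qed
  qed
  have inner: "(\<integral>t. k t r \<partial>lborel) = - (g r * p r)" for r
  proof (cases "r \<in> {0<..<T}")
    case True
    have "(\<integral>t. k t r \<partial>lborel) = g r * (\<integral>t. p' t * indicator {r..T} t \<partial>lborel)"
    proof -
      have "(\<integral>t. k t r \<partial>lborel) = (\<integral>t. g r * (p' t * indicator {r..T} t) \<partial>lborel)"
      proof (rule integral_cong_AE)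
        show "(\<lambda>t. k t r) \<in> borel_measurable lborel"
        proof -
          have "(\<lambda>t. k t r) = (\<lambda>t. indicator {0<..<T} t * p' t * (indicator {r..} t * g r))"
            by (auto simp: k_def fun_eq_iff indicator_def)
          then show ?thesis by simp
        qed
        \<comment> \<open>The two integrands differ at most at \<open>t = T\<close>.\<close>
        show "AE t in lborel. k t r = g r * (p' t * indicator {r..T} t)"
          using AE_lborel_singleton[of T] by eventually_elim (use True in \<open>auto simp: k_def indicator_def\<close>)
      qed measurable
      then show ?thesis by simp
    qed
    also have "(\<integral>t. p' t * indicator {r..T} t \<partial>lborel) = p T - p r"
      by (rule integral_FTC_Icc_real)
         (use True p in \<open>auto simp: continuous_on_eq_continuous_at\<close>)
    finally show ?thesis using p(3) by simp
  next
    case False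
    then show ?thesis using g(2) by (simp add: k_def)
  qed
  have "(\<integral>t. (\<integral>r. k t r \<partial>lborel) \<partial>lborel) = (\<integral>r. (\<integral>t. k t r \<partial>lborel) \<partial>lborel)"
    using lborel_pair.Fubini_integral[OF kint] by simp
  also have "\<dots> = - (\<integral>r. g r * p r \<partial>lborel)" unfolding inner by simp
  also have "(\<integral>t. (\<integral>r. k t r \<partial>lborel) \<partial>lborel)
      = (\<integral>t. indicator {0<..<T} t * (\<integral>r. indicator {..t} r * g r \<partial>lborel) * p' t \<partial>lborel)"
  proof -
    have "(\<integral>r. k t r \<partial>lborel) = (indicator {0<..<T} t * p' t) * (\<integral>r. indicator {..t} r * g r \<partial>lborel)" for t
      unfolding k_def by (rule integral_mult_right_zero)
    then show ?thesis by (simp only: mult_ac)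
  qed
  finally show ?thesis .
qed

lemma nn_integral_time_sections:
  fixes f :: "real \<times> 'a::euclidean_space \<Rightarrow> ennreal"
  assumes "f \<in> borel_measurable borel"
  shows "(\<lambda>x. \<integral>\<^sup>+r. f (r, x) \<partial>lborel) \<in> borel_measurable borel"
    "(\<integral>\<^sup>+x. (\<integral>\<^sup>+r. f (r, x) \<partial>lborel) \<partial>lborel) = (\<integral>\<^sup>+p. f p \<partial>lborel)"
proof -
  have "(\<lambda>q::'a \<times> real. f (snd q, fst q)) \<in> borel_measurable borel"
    by (rule measurable_compose[OF _ assms]) (intro borel_measurable_continuous_onI continuous_intros)
  then have "(\<lambda>(x, r). f (r, x)) \<in> borel_measurable (borel \<Otimes>\<^sub>M lborel)"
    unfolding borel_prod[symmetric] by (simp add: split_beta')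
  from lborel.borel_measurable_nn_integral[OF this]
  show "(\<lambda>x. \<integral>\<^sup>+r. f (r, x) \<partial>lborel) \<in> borel_measurable borel" by simp
  have "f \<in> borel_measurable (lborel \<Otimes>\<^sub>M lborel)" using assms by (simp add: lborel_prod)
  from lborel_pair.nn_integral_snd[OF this]
  show "(\<integral>\<^sup>+x. (\<integral>\<^sup>+r. f (r, x) \<partial>lborel) \<partial>lborel) = (\<integral>\<^sup>+p. f p \<partial>lborel)"
    unfolding lborel_prod .
qed

lemma time_section_borel:
  fixes f :: "real \<times> 'a::euclidean_space \<Rightarrow> 'b::topological_space"
  assumes "f \<in> borel_measurable borel"
  shows "(\<lambda>r. f (r, x)) \<in> borel_measurable borel"
  by (rule measurable_compose[OF _ assms]) (intro borel_measurable_continuous_onI continuous_intros)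

text \<open>Setting \<open>f\<close> to zero on the null set of \<open>x\<close> with a section of infinite norm lets the primitive in time
  be formed pointwise in \<open>x\<close>.\<close>

lemma l2_borel_time_sections:
  fixes w :: "(real \<times> 'a::euclidean_space) l2"
  assumes "w \<in> L2_on S" "open S"
  obtains f where "f \<in> borel_measurable borel" "sq_integrable f" "w = l2_class f"
    "\<And>p. p \<notin> S \<Longrightarrow> f p = 0" "\<And>x. sq_integrable (\<lambda>r. f (r, x))"
proof -
  obtain g where g: "g \<in> borel_measurable borel" "sq_integrable g" "w = l2_class g"
    "\<And>p. p \<notin> S \<Longrightarrow> g p = 0"
    using l2_borel_on[OF assms(1)] assms(2) by auto
  have gm: "(\<lambda>p. ennreal ((g p)\<^sup>2)) \<in> borel_measurable borel" using g(1) by measurable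
  define E where "E = (\<lambda>x. \<integral>\<^sup>+r. ennreal ((g (r, x))\<^sup>2) \<partial>lborel)"
  have E: "E \<in> borel_measurable borel"
    unfolding E_def by (rule nn_integral_time_sections[OF gm])
  define f where "f = (\<lambda>p. if E (snd p) < \<infinity> then g p else 0)"
  have fm: "f \<in> borel_measurable borel"
  proof -
    have "(\<lambda>p::real \<times> 'a. E (snd p)) \<in> borel_measurable borel"
      by (rule measurable_compose[OF _ E]) (intro borel_measurable_continuous_onI continuous_intros)
    then show ?thesis unfolding f_def using g(1) by measurable
  qed
  have "AE x in lborel. E x < \<infinity>"
  proof -
    have "(\<integral>\<^sup>+x. E x \<partial>lborel) < \<infinity>"
      unfolding E_def nn_integral_time_sections(2)[OF gm] nn_integral_sq_eq_norm[OF g(1,2)] by simp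
    then have "AE x in lborel. E x \<noteq> \<infinity>" using E by (intro nn_integral_PInf_AE) auto
    then show ?thesis by eventually_elim (simp add: less_top)
  qed
  then have "AE x in lborel. AE r in lborel. f (r, x) = g (r, x)"
    by eventually_elim (simp add: f_def)
  moreover have P: "{p \<in> space (lborel \<Otimes>\<^sub>M lborel). f (fst p, snd p) = g (fst p, snd p)} \<in> sets (lborel \<Otimes>\<^sub>M lborel)"
    unfolding lborel_prod prod.collapse using fm g(1) by measurable
  ultimately have ae: "AE p in lborel. f p = g p"
    using lborel_pair.AE_commute[OF P] lborel_pair.AE_pair_iff[OF P]
    unfolding lborel_prod prod.collapse by blast
  show ?thesis
  proof (rule that[of f])
    show "sq_integrable f" "w = l2_class f"
      using sq_integrable_AE_eq[OF g(2) ae] g(3) by auto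
    show "f p = 0" if "p \<notin> S" for p using g(4)[OF that] by (simp add: f_def)
    show "sq_integrable (\<lambda>r. f (r, x))" for x
    proof (cases "E x < \<infinity>")
      case True
      have m: "(\<lambda>r. g (r, x)) \<in> borel_measurable borel" by (rule time_section_borel[OF g(1)])
      have "integrable lborel (\<lambda>r. (g (r, x))\<^sup>2)"
        using True m unfolding E_def by (intro integrableI_bounded) auto
      then show ?thesis using True m by (simp add: f_def sq_integrable_borel)
    qed (simp add: f_def sq_integrable_zero)
  qed (rule fm)
qed

lemma integrable_if_interval_support:
  fixes g :: "real \<Rightarrow> real"
  assumes "g \<in> borel_measurable borel" "sq_integrable g" "\<And>r. r \<notin> {a..b} \<Longrightarrow> g r = 0"
  shows "integrable lborel g"
proof -
  have sqi: "sq_integrable (indicator {a..b} :: real \<Rightarrow> real)"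
    by (rule bounded_compact_support_sq_integrable[of _ "{a..b}" 1]) auto
  have "integrable lborel (\<lambda>r. indicator {a..b} r * g r)"
    by (rule integrable_mult_borel[OF sqi assms(2) _ assms(1)]) simp
  moreover have "indicator {a..b} r * g r = g r" for r
    using assms(3)[of r] by (auto simp: indicator_def)
  ultimately show ?thesis by simp
qed

text \<open>The witness is the integral of a Borel representative of \<open>w\<close> over the times
  up to \<open>t\<close>, formed pointwise in \<open>x\<close>; Cauchy-Schwarz in time gives its
  estimates. They are proved for this one function and reach every function with derivative
  \<open>w\<close> by uniqueness (\<open>H1_time_bounds\<close>).\<close>

lemma H1_time_exists:
  fixes w :: "(real \<times> 'a::euclidean_space) l2"
  assumes \<Omega>: "open \<Omega>" and T: "T > 0" and w: "w \<in> L2_on (cyl \<Omega> T)"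
  obtains y where "H1_time \<Omega> T y w" "norm y \<le> T * norm w"
    "\<And>h. h > 0 \<Longrightarrow> norm (cut (cyl \<Omega> T) (y - shift (- h, 0) y)) \<le> h * norm w"
proof -
  note oc = open_cyl[OF \<Omega>, of T]
  obtain f where f: "f \<in> borel_measurable borel" "sq_integrable f" "w = l2_class f"
    "\<And>p. p \<notin> cyl \<Omega> T \<Longrightarrow> f p = 0" "\<And>x. sq_integrable (\<lambda>r. f (r, x))"
    using l2_borel_time_sections[OF w oc] by blast
  note fm [measurable] = f(1)
  have secm [measurable]: "(\<lambda>r. f (r, x)) \<in> borel_measurable borel" for x
    by (rule time_section_borel[OF f(1)])
  have f0: "f (r, x) = 0" if "r \<notin> {0<..<T} \<or> x \<notin> \<Omega>" for r x
    using that f(4)[of "(r, x)"] by (auto simp: cyl_def)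
  have gi: "integrable lborel (\<lambda>r. f (r, x))" for x
    by (rule integrable_if_interval_support[OF secm f(5), of 0 T]) (use f0 in auto)
  have gi': "integrable lborel (\<lambda>r. indicator A r * f (r, x))" if "A \<in> sets borel" for A x
    using integrable_mult_indicator[OF _ gi, of A] that by simp
  define F where "F = (\<lambda>t x. \<integral>r. indicator {..t} r * f (r, x) \<partial>lborel)"
  have Fdiff: "F t x - F s x = (\<integral>r. indicator {s<..t} r * f (r, x) \<partial>lborel)" if "s \<le> t" for s t x
  proof -
    have "F t x - F s x = (\<integral>r. indicator {..t} r * f (r, x) - indicator {..s} r * f (r, x) \<partial>lborel)"
      unfolding F_def by (rule Bochner_Integration.integral_diff[symmetric]) (rule gi', simp)+
    also have "\<dots> = (\<integral>r. indicator {s<..t} r * f (r, x) \<partial>lborel)"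
      using that by (intro Bochner_Integration.integral_cong) (auto simp: indicator_def)
    finally show ?thesis .
  qed
  have F0: "F t x = 0" if "t \<le> 0 \<or> x \<notin> \<Omega>" for t x
  proof -
    have "indicator {..t} r * f (r, x) = 0" for r
      using that f0[of r x] by (auto simp: indicator_def)
    then show ?thesis unfolding F_def by (simp only: Bochner_Integration.integral_zero)
  qed
  have Fm: "(\<lambda>p. F (fst p) (snd p)) \<in> borel_measurable borel"
  proof -
    have "(\<lambda>q::(real \<times> 'a) \<times> real. f (snd q, snd (fst q))) \<in> borel_measurable borel"
      by (rule measurable_compose[OF _ f(1)]) (intro borel_measurable_continuous_onI continuous_intros)
    moreover have "(\<lambda>q::(real \<times> 'a) \<times> real. if snd q \<le> fst (fst q) then 1 else 0 :: real) \<in> borel_measurable borel"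
    proof -
      have "(\<lambda>q::(real \<times> 'a) \<times> real. snd q) \<in> borel_measurable borel"
        "(\<lambda>q::(real \<times> 'a) \<times> real. fst (fst q)) \<in> borel_measurable borel"
        by (intro borel_measurable_continuous_onI continuous_intros)+
      then show ?thesis by measurable
    qed
    ultimately have "(\<lambda>q::(real \<times> 'a) \<times> real. (if snd q \<le> fst (fst q) then 1 else 0) * f (snd q, snd (fst q)))
        \<in> borel_measurable borel"
      by measurable
    moreover have "(\<lambda>q::(real \<times> 'a) \<times> real. (if snd q \<le> fst (fst q) then 1 else 0) * f (snd q, snd (fst q)))
        = (\<lambda>(p, r). indicator {..fst p} r * f (r, snd p))"
      by (auto simp: fun_eq_iff indicator_def)
    ultimately have "(\<lambda>(p, r). indicator {..fst p} r * f (r, snd p)) \<in> borel_measurable (borel \<Otimes>\<^sub>M lborel)"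
      unfolding borel_prod[symmetric] by simp
    from lborel.borel_measurable_lebesgue_integral[OF this]
    show ?thesis unfolding F_def by simp
  qed
  have CS: "ennreal ((F t x - F s x)\<^sup>2)
      \<le> ennreal (t - s) * (\<integral>\<^sup>+r. indicator {s<..t} r * ennreal ((f (r, x))\<^sup>2) \<partial>lborel)" if "s \<le> t" for s t x
    unfolding Fdiff[OF that] by (rule interval_Cauchy_Schwarz[OF secm f(5) that])
  define E where "E = (\<lambda>x. \<integral>\<^sup>+r. ennreal ((f (r, x))\<^sup>2) \<partial>lborel)"
  have fm2: "(\<lambda>p. ennreal ((f p)\<^sup>2)) \<in> borel_measurable borel" by measurable
  have Em [measurable]: "E \<in> borel_measurable borel"
    unfolding E_def by (rule nn_integral_time_sections(1)[OF fm2])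
  have Ei: "(\<integral>\<^sup>+x. E x \<partial>lborel) = ennreal ((norm w)\<^sup>2)"
    unfolding E_def nn_integral_time_sections(2)[OF fm2] nn_integral_sq_eq_norm[OF f(1,2)] f(3) ..
  have CS': "ennreal ((F t x - F s x)\<^sup>2) \<le> ennreal (t - s) * E x" if "s \<le> t" for s t x
  proof -
    have "(\<integral>\<^sup>+r. indicator {s<..t} r * ennreal ((f (r, x))\<^sup>2) \<partial>lborel) \<le> E x"
      unfolding E_def by (intro nn_integral_mono) (auto simp: indicator_def)
    then show ?thesis using CS[OF that, of x] by (meson mult_left_mono order_trans zero_le)
  qed
  \<comment> \<open>The primitive stays constant after time \<open>T\<close>, so it must be cut off
    to lie in the space over the cylinder.\<close>
  define fy where "fy = (\<lambda>p. indicator (cyl \<Omega> T) p * F (fst p) (snd p))"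
  have cylm: "cyl \<Omega> T \<in> sets borel" using oc by simp
  have fym: "fy \<in> borel_measurable borel"
    unfolding fy_def using Fm cylm by measurable
  have fyb: "(\<integral>\<^sup>+p. ennreal ((fy p)\<^sup>2) \<partial>lborel) \<le> ennreal ((T * norm w)\<^sup>2)"
  proof -
    have m: "(\<lambda>p. ennreal ((fy p)\<^sup>2)) \<in> borel_measurable borel" using fym by measurable
    have "(\<integral>\<^sup>+p. ennreal ((fy p)\<^sup>2) \<partial>lborel) = (\<integral>\<^sup>+x. (\<integral>\<^sup>+t. ennreal ((fy (t, x))\<^sup>2) \<partial>lborel) \<partial>lborel)"
      by (rule nn_integral_time_sections(2)[OF m, symmetric])
    also have "\<dots> \<le> (\<integral>\<^sup>+x. (\<integral>\<^sup>+t. (ennreal T * E x) * indicator {0..T} t \<partial>lborel) \<partial>lborel)"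
    proof (intro nn_integral_mono)
      fix x t
      show "ennreal ((fy (t, x))\<^sup>2) \<le> (ennreal T * E x) * indicator {0..T} t"
      proof (cases "(t, x) \<in> cyl \<Omega> T")
        case True
        then have t: "0 \<le> t" "t \<le> T" by (auto simp: cyl_def)
        have "ennreal ((fy (t, x))\<^sup>2) \<le> ennreal t * E x"
          using CS'[OF t(1), of x] True by (simp add: fy_def F0)
        also have "\<dots> \<le> ennreal T * E x" using t by (intro mult_right_mono) auto
        finally show ?thesis using t by (simp add: indicator_def)
      qed (simp add: fy_def)
    qed
    also have "\<dots> = (\<integral>\<^sup>+x. ennreal T * ennreal T * E x \<partial>lborel)"
      using T by (intro nn_integral_cong) (subst nn_integral_cmult_indicator; simp add: mult_ac)
    also have "\<dots> = ennreal T * ennreal T * ennreal ((norm w)\<^sup>2)"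
      by (simp add: nn_integral_cmult Ei)
    also have "\<dots> = ennreal ((T * norm w)\<^sup>2)"
      using T by (simp add: ennreal_mult[symmetric] power2_eq_square mult_ac)
    finally show ?thesis .
  qed
  have Tw: "0 \<le> T * norm w" using T by simp
  note fysq = norm_l2_class_bound(1)[OF fym Tw fyb]
  define y where "y = l2_class fy"
  have yb: "norm y \<le> T * norm w"
    unfolding y_def by (rule norm_l2_class_bound(2)[OF fym Tw fyb])
  have yU: "y \<in> L2_on (cyl \<Omega> T)"
    unfolding y_def by (rule l2_class_in_L2_on[OF fysq]) (simp add: fy_def)
  have shiftb: "norm (cut (cyl \<Omega> T) (y - shift (- h, 0) y)) \<le> h * norm w" if h: "h > 0" for h
  proof -
    define d where "d = (\<lambda>p. indicator (cyl \<Omega> T) p * (fy p - fy (p + (- h, 0))))"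
    have dm: "d \<in> borel_measurable borel"
      unfolding d_def using fym translation_borel[OF fym, of "(- h, 0)"] cylm by measurable
    have dcut: "cut (cyl \<Omega> T) (y - shift (- h, 0) y) = l2_class d"
      unfolding y_def shift_class[OF fym fysq] d_def
        l2_class_diff[OF fysq sq_integrable_translation[OF fym fysq]]
      by (rule cut_class) (use cylm sq_integrable_diff[OF fysq sq_integrable_translation[OF fym fysq]] in auto)
    \<comment> \<open>Inside the cylinder the earlier time \<open>t - h\<close> lies below
      \<open>T\<close>, and if it is not positive both \<open>fy\<close> and \<open>F\<close> vanish
      there. The cut-off is therefore invisible in the difference, thanks to the zero initial
      value.\<close>
    have dval: "d (t, x) = indicator (cyl \<Omega> T) (t, x) * (F t x - F (t - h) x)" for t x
    proof (cases "(t, x) \<in> cyl \<Omega> T")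
      case True
      then have "fy (t - h, x) = F (t - h) x"
        using h F0[of "t - h" x] by (auto simp: fy_def cyl_def indicator_def)
      then show ?thesis using True by (simp add: d_def fy_def)
    qed (simp add: d_def)
    have "(\<integral>\<^sup>+p. ennreal ((d p)\<^sup>2) \<partial>lborel) \<le> ennreal ((h * norm w)\<^sup>2)"
    proof -
      have m: "(\<lambda>p. ennreal ((d p)\<^sup>2)) \<in> borel_measurable borel" using dm by measurable
      have "(\<integral>\<^sup>+p. ennreal ((d p)\<^sup>2) \<partial>lborel) = (\<integral>\<^sup>+x. (\<integral>\<^sup>+t. ennreal ((d (t, x))\<^sup>2) \<partial>lborel) \<partial>lborel)"
        by (rule nn_integral_time_sections(2)[OF m, symmetric])
      also have "\<dots> \<le> (\<integral>\<^sup>+x. ennreal h * ennreal h * E x \<partial>lborel)"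
      proof (rule nn_integral_mono)
        fix x
        define e where "e = (\<lambda>r. ennreal ((f (r, x))\<^sup>2))"
        have em [measurable]: "e \<in> borel_measurable borel" unfolding e_def by measurable
        \<comment> \<open>One factor \<open>h\<close> comes from Cauchy-Schwarz. The other comes
          from exchanging the integrals: each \<open>r\<close> is counted exactly for the
          \<open>t\<close> in an interval of length \<open>h\<close>.\<close>
        have "(\<integral>\<^sup>+t. ennreal ((d (t, x))\<^sup>2) \<partial>lborel)
            \<le> (\<integral>\<^sup>+t. ennreal h * (\<integral>\<^sup>+r. indicator {t - h<..t} r * e r \<partial>lborel) \<partial>lborel)"
        proof (rule nn_integral_mono)
          fix t
          show "ennreal ((d (t, x))\<^sup>2) \<le> ennreal h * (\<integral>\<^sup>+r. indicator {t - h<..t} r * e r \<partial>lborel)"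
            using CS[of "t - h" t x] h unfolding dval e_def by (cases "(t, x) \<in> cyl \<Omega> T") auto
        qed
        also have "\<dots> = ennreal h * (\<integral>\<^sup>+t. (\<integral>\<^sup>+r. indicator {t - h<..t} r * e r \<partial>lborel) \<partial>lborel)"
        proof (rule nn_integral_cmult)
          have "(\<lambda>(t, r). indicator {t - h<..t} r * e r) = (\<lambda>q. (if fst q - h < snd q \<and> snd q \<le> fst q then 1 else 0) * e (snd q))"
            by (auto simp: fun_eq_iff indicator_def)
          then have "(\<lambda>(t, r). indicator {t - h<..t} r * e r) \<in> borel_measurable (lborel \<Otimes>\<^sub>M lborel)"
            by simp
          from lborel.borel_measurable_nn_integral[OF this]
          show "(\<lambda>t. \<integral>\<^sup>+r. indicator {t - h<..t} r * e r \<partial>lborel) \<in> borel_measurable lborel" .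
        qed
        also have "(\<integral>\<^sup>+t. (\<integral>\<^sup>+r. indicator {t - h<..t} r * e r \<partial>lborel) \<partial>lborel)
            = (\<integral>\<^sup>+r. (\<integral>\<^sup>+t. indicator {t - h<..t} r * e r \<partial>lborel) \<partial>lborel)"
        proof -
          have eq: "(\<lambda>q::real \<times> real. indicator {fst q - h<..fst q} (snd q) * e (snd q))
             = (\<lambda>q. (if fst q - h < snd q \<and> snd q \<le> fst q then 1 else 0) * e (snd q))"
            by (auto simp: fun_eq_iff indicator_def)
          have "(\<lambda>q::real \<times> real. indicator {fst q - h<..fst q} (snd q) * e (snd q)) \<in> borel_measurable (lborel \<Otimes>\<^sub>M lborel)"
            unfolding eq by simp
          from lborel_pair.Fubini[OF this] show ?thesis by simp
        qed
        also have "\<dots> = (\<integral>\<^sup>+r. ennreal h * e r \<partial>lborel)"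
        proof (rule nn_integral_cong)
          fix r
          have "(\<integral>\<^sup>+t. indicator {t - h<..t} r * e r \<partial>lborel) = (\<integral>\<^sup>+t. e r * indicator {r..<r + h} t \<partial>lborel)"
            by (rule nn_integral_cong) (auto simp: indicator_def)
          also have "\<dots> = ennreal h * e r"
            using h by (simp add: nn_integral_cmult_indicator mult.commute)
          finally show "(\<integral>\<^sup>+t. indicator {t - h<..t} r * e r \<partial>lborel) = ennreal h * e r" .
        qed
        also have "\<dots> = ennreal h * E x" unfolding E_def e_def[symmetric] by (simp add: nn_integral_cmult e_def)
        finally show "(\<integral>\<^sup>+t. ennreal ((d (t, x))\<^sup>2) \<partial>lborel) \<le> ennreal h * ennreal h * E x"
          by (simp add: mult.assoc)
      qed
      also have "\<dots> = ennreal h * ennreal h * ennreal ((norm w)\<^sup>2)"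
        by (simp add: nn_integral_cmult Ei)
      also have "\<dots> = ennreal ((h * norm w)\<^sup>2)"
        using h by (simp add: ennreal_mult[symmetric] power2_eq_square mult_ac)
      finally show ?thesis .
    qed
    then show ?thesis
      unfolding dcut using h by (intro norm_l2_class_bound(2)[OF dm]) auto
  qed
  \<comment> \<open>The continuous representative; it is Hoelder continuous of exponent 1/2 by
    \<open>CS'\<close>.\<close>
  define z where "z = (\<lambda>t. l2_class (F t))"
  have Ftm: "F t \<in> borel_measurable borel" for t
    using section_borel[OF Fm, of t] by simp
  have Fdb: "(\<integral>\<^sup>+x. ennreal ((F t x - F s x)\<^sup>2) \<partial>lborel) \<le> ennreal ((sqrt \<bar>t - s\<bar> * norm w)\<^sup>2)" for s t
  proof -
    have "(\<integral>\<^sup>+x. ennreal ((F t x - F s x)\<^sup>2) \<partial>lborel) \<le> (\<integral>\<^sup>+x. ennreal \<bar>t - s\<bar> * E x \<partial>lborel)"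
    proof (rule nn_integral_mono)
      fix x show "ennreal ((F t x - F s x)\<^sup>2) \<le> ennreal \<bar>t - s\<bar> * E x"
        using CS'[of s t x] CS'[of t s x] by (cases "s \<le> t") (auto simp: power2_commute)
    qed
    also have "\<dots> = ennreal \<bar>t - s\<bar> * ennreal ((norm w)\<^sup>2)" by (simp add: nn_integral_cmult Ei)
    also have "\<dots> = ennreal ((sqrt \<bar>t - s\<bar> * norm w)\<^sup>2)"
      by (simp add: ennreal_mult[symmetric] power_mult_distrib)
    finally show ?thesis .
  qed
  have Fsq: "sq_integrable (F t)" for t
    using norm_l2_class_bound(1)[OF Ftm _ , of "sqrt \<bar>t - 0\<bar> * norm w"] Fdb[of t 0] by (simp add: F0)
  have zdiff: "norm (z t - z s) \<le> sqrt \<bar>t - s\<bar> * norm w" for s t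
    unfolding z_def l2_class_diff[OF Fsq Fsq]
    by (rule norm_l2_class_bound(2)[OF _ _ Fdb]) (use Ftm in auto)
  have "continuous_on {0..T} z"
    unfolding continuous_on_def
  proof
    fix t
    have "((\<lambda>s. sqrt \<bar>s - t\<bar> * norm w) \<longlongrightarrow> sqrt \<bar>t - t\<bar> * norm w) (at t within {0..T})"
      by (intro tendsto_intros)
    then have "((\<lambda>s. sqrt \<bar>s - t\<bar> * norm w) \<longlongrightarrow> 0) (at t within {0..T})" by simp
    then have "((\<lambda>s. z s - z t) \<longlongrightarrow> 0) (at t within {0..T})"
      by (rule Lim_null_comparison[rotated]) (simp add: zdiff)
    then show "(z \<longlongrightarrow> z t) (at t within {0..T})" by (rule LIM_zero_cancel)
  qed
  moreover have "z 0 = 0"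
  proof -
    have "F 0 = (\<lambda>x. 0)" using F0 by auto
    then show ?thesis by (simp add: z_def l2_class_zero)
  qed
  moreover have "AE t in lebesgue. t \<in> {0<..<T} \<longrightarrow> slice y t = z t"
    unfolding AE_lebesgue_iff y_def using slice_class[OF fym fysq]
  proof eventually_elim
    case (elim t)
    have "(\<lambda>x. fy (t, x)) = F t" if "t \<in> {0<..<T}"
      using that F0 by (auto simp: fun_eq_iff fy_def cyl_def indicator_def)
    with elim show ?case by (simp add: z_def)
  qed
  moreover have "weak_pd (cyl \<Omega> T) (1, 0) y w"
    unfolding weak_pd_def
  proof (intro allI impI)
    fix \<phi> assume \<phi>: "test_fun (cyl \<Omega> T) \<phi>"
    have Basis: "(1, 0) \<in> (Basis :: (real \<times> 'a) set)" by (auto simp: Basis_prod_def)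
    note \<phi>' = test_fun_pd[OF \<phi> Basis]
    have i1: "integrable (lborel \<Otimes>\<^sub>M lborel) (case_prod (\<lambda>t x. fy (t, x) * pd (1, 0) \<phi> (t, x)))"
      using integrable_mult_borel[OF fysq test_fun_sq_integrable[OF \<phi>'] fym test_fun_borel[OF \<phi>']]
      unfolding lborel_prod by (simp add: split_beta')
    have i2: "integrable (lborel \<Otimes>\<^sub>M lborel) (case_prod (\<lambda>t x. f (t, x) * \<phi> (t, x)))"
      using integrable_mult_borel[OF f(2) test_fun_sq_integrable[OF \<phi>] f(1) test_fun_borel[OF \<phi>]]
      unfolding lborel_prod by (simp add: split_beta')
    have parts: "(\<integral>t. fy (t, x) * pd (1, 0) \<phi> (t, x) \<partial>lborel) = - (\<integral>t. f (t, x) * \<phi> (t, x) \<partial>lborel)" for x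
    proof (cases "x \<in> \<Omega>")
      case True
      have "(\<integral>t. indicator {0<..<T} t * (\<integral>r. indicator {..t} r * f (r, x) \<partial>lborel) * pd (1, 0) \<phi> (t, x) \<partial>lborel)
          = - (\<integral>r. f (r, x) * \<phi> (r, x) \<partial>lborel)"
      proof (rule primitive_by_parts[OF gi _ T])
        show "f (r, x) = 0" if "r \<notin> {0<..<T}" for r using f0 that by blast
        show "((\<lambda>t. \<phi> (t, x)) has_real_derivative pd (1, 0) \<phi> (t, x)) (at t)" for t
          by (rule test_fun_time_derivative[OF \<phi>])
        show "continuous_on UNIV (\<lambda>t. pd (1, 0) \<phi> (t, x))"
          by (rule continuous_on_compose2[OF test_fun_continuous[OF \<phi>']]) (auto intro!: continuous_intros)
        show "\<phi> (T, x) = 0" using test_fun_outside[OF \<phi>] by (auto simp: cyl_def)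
      qed
      moreover have "indicator {0<..<T} t * F t x = fy (t, x)" for t
        using True by (auto simp: fy_def cyl_def indicator_def)
      ultimately show ?thesis unfolding F_def by (simp only:)
    next
      case False
      then show ?thesis by (simp add: fy_def f0 cyl_def)
    qed
    have "inner y (l2_class (pd (1, 0) \<phi>)) = (\<integral>p. fy p * pd (1, 0) \<phi> p \<partial>lborel)"
      unfolding y_def by (rule inner_l2_borel[OF fysq test_fun_sq_integrable[OF \<phi>'] fym test_fun_borel[OF \<phi>']])
    also have "\<dots> = (\<integral>x. (\<integral>t. fy (t, x) * pd (1, 0) \<phi> (t, x) \<partial>lborel) \<partial>lborel)"
      using lborel_pair.integral_snd[OF i1] unfolding lborel_prod by (simp add: split_beta')
    also have "\<dots> = - (\<integral>x. (\<integral>t. f (t, x) * \<phi> (t, x) \<partial>lborel) \<partial>lborel)"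
      unfolding parts by simp
    also have "(\<integral>x. (\<integral>t. f (t, x) * \<phi> (t, x) \<partial>lborel) \<partial>lborel) = (\<integral>p. f p * \<phi> p \<partial>lborel)"
      using lborel_pair.integral_snd[OF i2] unfolding lborel_prod by (simp add: split_beta')
    also have "\<dots> = inner w (l2_class \<phi>)"
      unfolding f(3) by (rule inner_l2_borel[OF f(2) test_fun_sq_integrable[OF \<phi>] f(1) test_fun_borel[OF \<phi>], symmetric])
    finally show "inner y (l2_class (pd (1, 0) \<phi>)) = - inner w (l2_class \<phi>)" .
  qed
  ultimately have "H1_time \<Omega> T y w"
    using yU w unfolding H1_time_def by blast
  then show ?thesis using yb shiftb by (rule that)
qed

section \<open>Uniqueness of the primitive\<close>

lemma bump_Pair:
  fixes a b x :: "'a::euclidean_space" and a0 b0 t :: real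
  shows "bump (a0, a) (b0, b) n (t, x) = bump1 a0 b0 n t * bump a b n x"
proof -
  have B: "(Basis :: (real \<times> 'a) set) = insert (1, 0) ((\<lambda>i. (0, i)) ` Basis)"
    by (auto simp: Basis_prod_def)
  have "(1, 0) \<notin> (\<lambda>i::'a. (0::real, i)) ` Basis" by auto
  then have "bump (a0, a) (b0, b) n (t, x)
      = bump1 a0 b0 n t * (\<Prod>p\<in>(\<lambda>i::'a. (0::real, i)) ` Basis. bump1 ((a0, a) \<bullet> p) ((b0, b) \<bullet> p) n ((t, x) \<bullet> p))"
    unfolding bump_def B by (subst prod.insert) auto
  also have "(\<Prod>p\<in>(\<lambda>i::'a. (0::real, i)) ` Basis. bump1 ((a0, a) \<bullet> p) ((b0, b) \<bullet> p) n ((t, x) \<bullet> p))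
      = bump a b n x"
    unfolding bump_def by (subst prod.reindex) (auto simp: inj_on_def)
  finally show ?thesis .
qed

text \<open>Since \<open>\<eta>\<close> below has derivative \<open>bump1 a b n t - bump1 a b n (t - c)\<close>, it tests a function of
  time for invariance under translation by \<open>c\<close>.\<close>

lemma bump1_difference_antiderivative:
  assumes "a \<le> b" "c > 0"
  obtains \<eta> where "\<And>t. (\<eta> has_real_derivative bump1 a b n t - bump1 a b n (t - c)) (at t)"
    "\<And>k. C_k k \<eta>" "\<And>t. t \<notin> {a..b + c} \<Longrightarrow> \<eta> t = 0"
proof -
  have cont: "isCont (bump1 a b n) t" for t
    using C_k_bump1[of 0 a b n] by (simp add: continuous_on_eq_continuous_at)
  have "\<exists>B. \<forall>t. -\<infinity> < ereal t \<longrightarrow> ereal t < \<infinity> \<longrightarrow> (B has_vector_derivative bump1 a b n t) (at t)"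
    by (rule einterval_antiderivative) (auto intro: cont)
  then obtain B where B: "\<And>t. (B has_real_derivative bump1 a b n t) (at t)"
    by (auto simp: has_real_derivative_iff_has_vector_derivative)
  have const: "B t = B s" if "s \<le> t" "\<And>r. s < r \<Longrightarrow> r < t \<Longrightarrow> bump1 a b n r = 0" for s t
  proof (cases "s = t")
    case False
    then have "s < t" using that(1) by simp
    then obtain r where "s < r" "r < t" "B t - B s = (t - s) * bump1 a b n r"
      using MVT2[of s t B "bump1 a b n"] B by blast
    with that(2) show ?thesis by simp
  qed simp
  define \<eta> where "\<eta> = (\<lambda>t. B t - B (t - c))"
  have d: "(\<eta> has_real_derivative bump1 a b n t - bump1 a b n (t - c)) (at t)" for t
    unfolding \<eta>_def
    by (auto intro!: derivative_eq_intros DERIV_chain2[OF B] B)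
  have "C_k k (\<lambda>t. bump1 a b n t + (-1) * bump1 a b n (t \<bullet> 1 + (- c)))" for k
    by (intro C_k_add C_k_scale C_k_compose_affine C_k_bump1)
  then have "C_k (Suc k) \<eta>" for k
    using C_k_real_Suc_iff[OF d] by simp
  then have "C_k k \<eta>" for k by (rule C_k_Suc_imp)
  \<comment> \<open>For such \<open>t\<close> the open interval from \<open>t - c\<close> to
    \<open>t\<close> misses the support of the bump, so \<open>B\<close> does not change on
    it.\<close>
  moreover have "\<eta> t = 0" if "t \<notin> {a..b + c}" for t
    unfolding \<eta>_def using that assms by (subst const[of "t - c" t]) (auto intro!: bump1_zero)
  ultimately show ?thesis using that d by blast
qed

text \<open>The product of \<open>\<eta>\<close> in time and a bump in space is a test function
  whose time derivative is a space-time bump minus its translate. A vanishing weak derivative thus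
  says that \<open>f\<close> and its translate have equal integrals against all bumps. The support
  of \<open>\<eta>\<close> reaches \<open>c\<close> beyond the bump, whence the shorter
  cylinder.\<close>

lemma H1_time_zero_translation_invariant:
  fixes f :: "real \<times> 'a::euclidean_space \<Rightarrow> real"
  assumes \<Omega>: "open \<Omega>" and f: "f \<in> borel_measurable borel" "sq_integrable f"
    and pd0: "weak_pd (cyl \<Omega> T) (1, 0) (l2_class f) 0" and c: "c > 0"
  shows "AE p in lborel. p \<in> cyl \<Omega> (T - c) \<longrightarrow> f p = f (p + (c, 0))"
proof -
  define g where "g = (\<lambda>p. f p - f (p + (c, 0)))"
  note fc = translation_borel[OF f(1), of "(c, 0)"] sq_integrable_translation[OF f, of "(c, 0)"]
  have g: "g \<in> borel_measurable borel" "sq_integrable g"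
    unfolding g_def using f(1) fc(1) sq_integrable_diff[OF f(2) fc(2)] by auto
  have "AE p in lborel. p \<in> cyl \<Omega> (T - c) \<longrightarrow> g p = 0"
  proof (rule bump_orthogonal_imp_AE_zero[OF open_cyl[OF \<Omega>] g])
    fix A B :: "real \<times> 'a" and n assume sub: "cbox A B \<subseteq> cyl \<Omega> (T - c)"
    obtain a0 a b0 b where AB: "A = (a0, a)" "B = (b0, b)" by (metis surj_pair)
    show "(\<integral>p. g p * bump A B n p \<partial>lborel) = 0"
    proof (cases "cbox A B = {}")
      case True
      then have "bump A B n p = 0" for p using box_subset_cbox[of A B] by (intro bump_zero) auto
      then show ?thesis by simp
    next
      case False
      then have ne: "a0 \<le> b0" "cbox a b \<noteq> {}"
        unfolding AB by (auto simp: cbox_Pair_eq)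
      obtain \<eta> where \<eta>: "\<And>t. (\<eta> has_real_derivative bump1 a0 b0 n t - bump1 a0 b0 n (t - c)) (at t)"
        "\<And>k. C_k k \<eta>" "\<And>t. t \<notin> {a0..b0 + c} \<Longrightarrow> \<eta> t = 0"
        using bump1_difference_antiderivative[OF ne(1) c] by blast
      define \<phi> where "\<phi> = (\<lambda>p::real \<times> 'a. \<eta> (fst p) * bump a b n (snd p))"
      have \<phi>C: "C_k k \<phi>" for k
      proof -
        have "C_k k (\<lambda>p::real \<times> 'a. \<eta> (p \<bullet> (1, 0) + 0) * (\<Prod>i\<in>Basis. bump1 (a \<bullet> i) (b \<bullet> i) n (p \<bullet> (0, i) + 0)))"
          by (intro C_k_mult C_k_prod C_k_compose_affine C_k_bump1 \<eta>(2))
        then show ?thesis by (simp add: \<phi>_def bump_def inner_prod_def)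
      qed
      have "{a0..b0} \<times> cbox a b \<subseteq> {0<..<T - c} \<times> \<Omega>"
        using sub unfolding AB cyl_def cbox_Pair_eq by simp
      then have s: "0 < a0" "b0 < T - c" "cbox a b \<subseteq> \<Omega>" using ne by (auto simp: subset_iff)
      have \<phi>: "test_fun (cyl \<Omega> T) \<phi>"
      proof (rule test_funI[OF \<phi>C])
        show "compact ({a0..b0 + c} \<times> cbox a b)" by (intro compact_Times) auto
        show "{a0..b0 + c} \<times> cbox a b \<subseteq> cyl \<Omega> T" using s by (auto simp: cyl_def)
        show "\<phi> p = 0" if "p \<notin> {a0..b0 + c} \<times> cbox a b" for p
        proof (cases "fst p \<in> {a0..b0 + c}")
          case True
          then have "snd p \<notin> cbox a b" using that by (metis mem_Times_iff)
          then have "snd p \<notin> box a b" using box_subset_cbox by blast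
          then show ?thesis by (simp add: \<phi>_def bump_zero)
        qed (simp add: \<phi>_def \<eta>(3))
      qed
      have pd: "pd (1, 0) \<phi> p = bump A B n p - bump A B n (p - (c, 0))" for p
      proof -
        obtain t x where p: "p = (t, x)" by (cases p)
        have "((\<lambda>t. \<phi> (t, x)) has_real_derivative pd (1, 0) \<phi> (t, x)) (at t)"
          by (rule test_fun_time_derivative[OF \<phi>])
        moreover have "((\<lambda>t. \<phi> (t, x)) has_real_derivative (bump1 a0 b0 n t - bump1 a0 b0 n (t - c)) * bump a b n x) (at t)"
          unfolding \<phi>_def fst_conv snd_conv by (rule DERIV_cmult_right[OF \<eta>(1)])
        ultimately show ?thesis
          unfolding p AB by (simp add: bump_Pair DERIV_unique left_diff_distrib)
      qed
      have tb: "test_fun UNIV (bump A B n)" by (rule test_fun_bump) simp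
      note tbb = test_fun_borel[OF tb] test_fun_sq_integrable[OF tb]
      have B: "(1, 0) \<in> (Basis :: (real \<times> 'a) set)" by (auto simp: Basis_prod_def)
      have m: "(\<lambda>p. f p * bump A B n (p - (c, 0))) \<in> borel_measurable borel"
        unfolding diff_conv_add_uminus by (intro borel_measurable_times f(1) translation_borel tbb(1))
      have i1: "integrable lborel (\<lambda>p. f p * bump A B n p)"
        by (rule integrable_mult_borel[OF f(2) tbb(2) f(1) tbb(1)])
      have i2: "integrable lborel (\<lambda>p. f (p + (c, 0)) * bump A B n p)"
        by (rule integrable_mult_borel[OF fc(2) tbb(2) fc(1) tbb(1)])
      have i3: "integrable lborel (\<lambda>p. f p * bump A B n (p - (c, 0)))"
        "(\<integral>p. f p * bump A B n (p - (c, 0)) \<partial>lborel) = (\<integral>p. f (p + (c, 0)) * bump A B n p \<partial>lborel)"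
        using integral_translation[OF m, of "(c, 0)"] i2 by simp_all
      have "0 = inner (l2_class f) (l2_class (pd (1, 0) \<phi>))"
        using pd0 \<phi> unfolding weak_pd_def by simp
      also have "\<dots> = (\<integral>p. f p * (bump A B n p - bump A B n (p - (c, 0))) \<partial>lborel)"
        using inner_l2_borel[OF f(2) test_fun_sq_integrable[OF test_fun_pd[OF \<phi> B]] f(1) test_fun_borel[OF test_fun_pd[OF \<phi> B]]]
        unfolding pd .
      also have "\<dots> = (\<integral>p. f p * bump A B n p \<partial>lborel) - (\<integral>p. f (p + (c, 0)) * bump A B n p \<partial>lborel)"
        using i1 i3 by (simp add: right_diff_distrib)
      also have "\<dots> = (\<integral>p. g p * bump A B n p \<partial>lborel)"
        using i1 i2 by (simp add: g_def left_diff_distrib)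
      finally show ?thesis by simp
    qed
  qed
  then show ?thesis by eventually_elim (simp add: g_def)
qed

text \<open>Translation invariance gives \<open>z t = z (t + c)\<close> for almost every small
  \<open>t\<close>. Letting \<open>t\<close> tend to 0 through such times, continuity turns this
  into \<open>z c = z 0 = 0\<close>.\<close>

lemma H1_time_zero_unique:
  fixes \<Omega> :: "'a::euclidean_space set"
  assumes \<Omega>: "open \<Omega>" and T: "T > 0" and y: "H1_time \<Omega> T y 0"
  shows "y = 0"
proof -
  have yU: "y \<in> L2_on (cyl \<Omega> T)" and pd0: "weak_pd (cyl \<Omega> T) (1, 0) y 0"
    using y unfolding H1_time_def by auto
  obtain z where z: "continuous_on {0..T} z" "z 0 = 0"
    "AE t in lebesgue. t \<in> {0<..<T} \<longrightarrow> slice y t = z t"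
    using y unfolding H1_time_def by auto
  obtain f where f: "f \<in> borel_measurable borel" "sq_integrable f" "y = l2_class f"
    "\<And>p. p \<notin> cyl \<Omega> T \<Longrightarrow> f p = 0"
    using l2_borel_on[OF yU] open_cyl[OF \<Omega>, of T] by auto
  have zc: "z c = 0" if c: "0 < c" "c < T" for c
  proof -
    have "AE t in lborel. AE x in lborel. (t, x) \<in> cyl \<Omega> (T - c) \<longrightarrow> f (t, x) = f ((t, x) + (c, 0))"
      by (rule AE_lborel_pair[OF H1_time_zero_translation_invariant[OF \<Omega> f(1,2) _ c(1)]])
        (use pd0 f(3) in simp)
    moreover note slice_class[OF f(1,2)] AE_lborel_translation[OF slice_class[OF f(1,2)], of c]
    moreover have z1: "AE t in lborel. t \<in> {0<..<T} \<longrightarrow> slice y t = z t" using z(3) unfolding AE_lebesgue_iff .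
    moreover note AE_lborel_translation[OF z1, of c]
    ultimately have ae: "AE t in lborel. t \<in> {0<..<T - c} \<longrightarrow> z t = z (t + c)"
    proof eventually_elim
      case (elim t)
      show ?case
      proof
        assume t: "t \<in> {0<..<T - c}"
        have "AE x in lborel. f (t, x) = f (t + c, x)"
          using elim(1)
        proof eventually_elim
          case (elim x)
          then show ?case using t f(4)[of "(t, x)"] f(4)[of "(t + c, x)"] by (cases "x \<in> \<Omega>") (auto simp: cyl_def)
        qed
        then have "l2_class (\<lambda>x. f (t, x)) = l2_class (\<lambda>x. f (t + c, x))"
          using elim(2,3) by (subst l2_class_eq_iff) (auto simp: AE_lebesgue_iff)
        then show "z t = z (t + c)" using elim t c by (simp add: f(3))
      qed
    qed
    \<comment> \<open>Otherwise the exceptional null set would contain an interval.\<close>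
    have "\<exists>t. 0 < t \<and> t < \<delta> \<and> t < T - c \<and> z t = z (t + c)" if \<delta>: "\<delta> > 0" for \<delta>
    proof (rule ccontr)
      assume no: "\<not> ?thesis"
      define m where "m = min \<delta> (T - c)"
      have m: "m > 0" using \<delta> c by (simp add: m_def)
      have "AE t in lborel. t \<notin> {0<..<m}"
        using ae by eventually_elim (use no in \<open>auto simp: m_def\<close>)
      then have "emeasure lborel {0<..<m} = 0"
        by (subst (asm) AE_iff_measurable[of "{0<..<m}"]) auto
      then show False using m by simp
    qed
    then have "\<exists>t. 0 < t \<and> t < inverse (real (Suc n)) \<and> t < T - c \<and> z t = z (t + c)" for n by simp
    then obtain t where t: "\<And>n. 0 < t n" "\<And>n. t n < inverse (real (Suc n))" "\<And>n. t n < T - c"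
      "\<And>n. z (t n) = z (t n + c)"
      by metis
    have t0: "t \<longlonglongrightarrow> 0"
      by (rule tendsto_sandwich[OF _ _ tendsto_const LIMSEQ_inverse_real_of_nat])
         (use less_imp_le[OF t(1)] less_imp_le[OF t(2)] in \<open>simp_all del: of_nat_Suc\<close>)
    have "(\<lambda>n. z (t n)) \<longlonglongrightarrow> z 0"
    proof (rule continuous_on_tendsto_compose[OF z(1) t0])
      have "t n \<in> {0..T}" for n using t(1)[of n] t(3)[of n] c by auto
      then show "\<forall>\<^sub>F n in sequentially. t n \<in> {0..T}" by simp
    qed (use T in auto)
    moreover have "(\<lambda>n. z (t n + c)) \<longlonglongrightarrow> z (0 + c)"
    proof (rule continuous_on_tendsto_compose[OF z(1)])
      show "(\<lambda>n. t n + c) \<longlonglongrightarrow> 0 + c" by (intro tendsto_intros t0)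
      have "t n + c \<in> {0..T}" for n using t(1)[of n] t(3)[of n] c by auto
      then show "\<forall>\<^sub>F n in sequentially. t n + c \<in> {0..T}" by simp
    qed (use c in auto)
    ultimately show ?thesis using t(4) z(2) LIMSEQ_unique by auto
  qed
  show ?thesis
  proof (rule slice_eqI)
    show "AE t in lebesgue. slice y t = slice 0 t"
      using z(3) slice_in_L2_on[OF yU] slice_zero[where 'a='a]
    proof eventually_elim
      case (elim t)
      then show ?case using zc[of t] by (cases "t \<in> {0<..<T}") auto
    qed
  qed
qed

section \<open>Linearity and closedness of the time derivative\<close>

lemma H1_time_add:
  assumes "H1_time \<Omega> T y w" "H1_time \<Omega> T y' w'"
  shows "H1_time \<Omega> T (y + y') (w + w')"
proof -
  obtain z where z: "continuous_on {0..T} z" "z 0 = 0" "AE t in lebesgue. t \<in> {0<..<T} \<longrightarrow> slice y t = z t"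
    using assms(1) unfolding H1_time_def by auto
  obtain z' where z': "continuous_on {0..T} z'" "z' 0 = 0" "AE t in lebesgue. t \<in> {0<..<T} \<longrightarrow> slice y' t = z' t"
    using assms(2) unfolding H1_time_def by auto
  have "AE t in lebesgue. t \<in> {0<..<T} \<longrightarrow> slice (y + y') t = z t + z' t"
    using z(3) z'(3) slice_add[of y y'] by eventually_elim auto
  moreover have "continuous_on {0..T} (\<lambda>t. z t + z' t)" "z 0 + z' 0 = 0"
    using z z' by (auto intro: continuous_on_add)
  ultimately have "\<exists>z. continuous_on {0..T} z \<and> z 0 = 0 \<and> (AE t in lebesgue. t \<in> {0<..<T} \<longrightarrow> slice (y + y') t = z t)"
    by (intro exI[of _ "\<lambda>t. z t + z' t"]) auto
  then show ?thesis
    using assms subspace_add[OF subspace_L2_on] weak_pd_add unfolding H1_time_def by blast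
qed

lemma H1_time_scaleR:
  assumes "H1_time \<Omega> T y w"
  shows "H1_time \<Omega> T (c *\<^sub>R y) (c *\<^sub>R w)"
proof -
  obtain z where z: "continuous_on {0..T} z" "z 0 = 0" "AE t in lebesgue. t \<in> {0<..<T} \<longrightarrow> slice y t = z t"
    using assms(1) unfolding H1_time_def by auto
  have "AE t in lebesgue. t \<in> {0<..<T} \<longrightarrow> slice (c *\<^sub>R y) t = c *\<^sub>R z t"
    using z(3) slice_scaleR[of c y] by eventually_elim auto
  moreover have "continuous_on {0..T} (\<lambda>t. c *\<^sub>R z t)" "c *\<^sub>R z 0 = 0"
    using z by (auto intro: continuous_on_scaleR)
  ultimately have "\<exists>z. continuous_on {0..T} z \<and> z 0 = 0 \<and> (AE t in lebesgue. t \<in> {0<..<T} \<longrightarrow> slice (c *\<^sub>R y) t = z t)"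
    by (intro exI[of _ "\<lambda>t. c *\<^sub>R z t"]) auto
  then show ?thesis
    using assms subspace_scale[OF subspace_L2_on] weak_pd_scaleR unfolding H1_time_def by blast
qed

lemma H1_time_diff:
  "H1_time \<Omega> T y w \<Longrightarrow> H1_time \<Omega> T y' w' \<Longrightarrow> H1_time \<Omega> T (y - y') (w - w')"
  using H1_time_add[of \<Omega> T y w "(-1) *\<^sub>R y'" "(-1) *\<^sub>R w'"] H1_time_scaleR[of \<Omega> T y' w' "-1"] by simp

lemma H1_time_unique:
  assumes "open \<Omega>" "T > 0" "H1_time \<Omega> T y w" "H1_time \<Omega> T y' w"
  shows "y = y'"
  using H1_time_zero_unique[OF assms(1,2)] H1_time_diff[OF assms(3,4)] by fastforce

lemma H1_time_bounds:
  assumes "open \<Omega>" "T > 0" "H1_time \<Omega> T y w"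
  shows "norm y \<le> T * norm w"
    "h > 0 \<Longrightarrow> norm (cut (cyl \<Omega> T) (y - shift (- h, 0) y)) \<le> h * norm w"
proof -
  have "w \<in> L2_on (cyl \<Omega> T)" using assms(3) unfolding H1_time_def by simp
  then obtain y' where y': "H1_time \<Omega> T y' w" "norm y' \<le> T * norm w"
    "\<And>h. h > 0 \<Longrightarrow> norm (cut (cyl \<Omega> T) (y' - shift (- h, 0) y')) \<le> h * norm w"
    using H1_time_exists[OF assms(1,2)] by blast
  have "y = y'" by (rule H1_time_unique[OF assms y'(1)])
  with y' show "norm y \<le> T * norm w"
    "h > 0 \<Longrightarrow> norm (cut (cyl \<Omega> T) (y - shift (- h, 0) y)) \<le> h * norm w" by auto
qed

text \<open>The candidate is the primitive of \<open>w'\<close>, which brings its continuous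
  representative and zero initial value along. The norm bound for differences then forces the
  sequence to converge to it.\<close>

lemma H1_time_closed:
  assumes \<Omega>: "open \<Omega>" and T: "T > 0" and y: "\<And>n. H1_time \<Omega> T (y n) (w n)" and lim: "w \<longlonglongrightarrow> w'"
  obtains y' where "y \<longlonglongrightarrow> y'" "H1_time \<Omega> T y' w'"
proof -
  have "closed (L2_on (cyl \<Omega> T))"
    by (rule closed_L2_on[OF sets_lebesgue_open[OF open_cyl[OF \<Omega>]]])
  then have "w' \<in> L2_on (cyl \<Omega> T)"
    using closed_sequentially[OF _ _ lim] y unfolding H1_time_def by blast
  then obtain y' where y': "H1_time \<Omega> T y' w'"
    using H1_time_exists[OF \<Omega> T] by blast
  have "norm (y n - y') \<le> T * norm (w n - w')" for n
    by (rule H1_time_bounds(1)[OF \<Omega> T H1_time_diff[OF y y']])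
  moreover have "(\<lambda>n. T * norm (w n - w')) \<longlonglongrightarrow> 0"
    using tendsto_mult[OF tendsto_const[of T] tendsto_norm_zero[OF LIM_zero[OF lim]]] by simp
  ultimately have "(\<lambda>n. y n - y') \<longlonglongrightarrow> 0"
    by (intro Lim_null_comparison[of "\<lambda>n. y n - y'" "\<lambda>n. T * norm (w n - w')"]) auto
  then have "y \<longlonglongrightarrow> y'" by (rule LIM_zero_cancel)
  then show ?thesis using y' that by blast
qed

subsection \<open>Energy estimate\<close>

lemma weak_limit_on_closure:
  fixes D :: "nat \<Rightarrow> 'a::real_inner"
  assumes b: "\<And>n. norm (D n) \<le> C"
    and V: "\<And>v. v \<in> V \<Longrightarrow> (\<lambda>n. inner (D n) v) \<longlonglongrightarrow> inner w v" and g: "g \<in> closure V"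
  shows "(\<lambda>n. inner (D n) g) \<longlonglongrightarrow> inner w g"
proof (rule LIMSEQ_I)
  fix e :: real assume e: "e > 0"
  define M where "M = \<bar>C\<bar> + norm w + 1"
  have M: "M > 0" unfolding M_def by (simp add: add_nonneg_pos)
  obtain v where v: "v \<in> V" "norm (g - v) < e / (2 * M)"
    using g e M unfolding closure_approachable by (metis dist_commute dist_norm divide_pos_pos mult_pos_pos zero_less_numeral)
  obtain N where N: "\<And>n. n \<ge> N \<Longrightarrow> \<bar>inner (D n) v - inner w v\<bar> < e / 2"
    using LIMSEQ_D[OF V[OF v(1)], of "e / 2"] e by auto
  have "\<bar>inner (D n) g - inner w g\<bar> < e" if "n \<ge> N" for n
  proof -
    have "norm (D n - w) \<le> M"
      using norm_triangle_ineq4[of "D n" w] b[of n] unfolding M_def by linarith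
    then have "\<bar>inner (D n - w) (g - v)\<bar> \<le> M * norm (g - v)"
      using Cauchy_Schwarz_ineq2[of "D n - w" "g - v"] mult_right_mono[of "norm (D n - w)" M "norm (g - v)"]
      by simp
    also have "\<dots> < M * (e / (2 * M))" using v(2) M by (rule mult_strict_left_mono)
    also have "\<dots> = e / 2" using M by simp
    finally have "\<bar>inner (D n - w) (g - v)\<bar> < e / 2" .
    moreover have "inner (D n) g - inner w g = inner (D n - w) (g - v) + (inner (D n) v - inner w v)"
      by (simp add: inner_diff_left inner_diff_right)
    ultimately show ?thesis using N[OF that] by argo
  qed
  then show "\<exists>N. \<forall>n\<ge>N. norm (inner (D n) g - inner w g) < e" by auto
qed

lemma shift_inverse: "shift (- a) (shift a u) = u"
proof -
  obtain f where f: "f \<in> borel_measurable borel" "sq_integrable f" "u = l2_class f" using l2_borel .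
  show ?thesis
    unfolding f(3) shift_class[OF f(1,2)]
      shift_class[OF translation_borel[OF f(1)] sq_integrable_translation[OF f(1,2)]] by simp
qed

text \<open>The form \<open>- inner v (\<Delta> v)\<close> is nonnegative, so that a backward difference in time pairs
  with \<open>\<Delta> y\<close> like a discrete derivative of a convex function: twice the pairing
  is bounded by a backward difference of \<open>inner y (\<Delta> y)\<close>, whose integral over all times vanishes.\<close>

lemma backward_difference_laplacian_nonpos:
  assumes \<Omega>: "open \<Omega>" and y: "y \<in> L2_on (cyl \<Omega> T)" and g: "g \<in> L2_on (cyl \<Omega> T)"
    and sp: "AE t in lebesgue. t \<in> {0<..<T} \<longrightarrow> slice y t \<in> H1_0 \<Omega> \<and> weak_laplacian \<Omega> (slice y t) (slice g t)"
  shows "inner (y - shift (- h, 0) y) g \<le> 0"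
proof -
  let ?s = "shift (- h, 0)"
  \<comment> \<open>Outside the time interval both slices vanish, so the spatial condition holds at
    almost every real time. It can then be used at the shifted time as well.\<close>
  have all: "AE t in lborel. slice y t \<in> H1_0 \<Omega> \<and> weak_laplacian \<Omega> (slice y t) (slice g t)"
    using sp slice_in_L2_on[OF y] slice_in_L2_on[OF g] unfolding AE_lebesgue_iff
  proof eventually_elim
    case (elim t)
    then show ?case
      using subspace_0[OF subspace_H1_0, of \<Omega>] by (cases "t \<in> {0<..<T}") (auto simp: weak_laplacian_def)
  qed
  have ae: "AE t in lebesgue. 2 * inner (slice (y - ?s y) t) (slice g t)
      \<le> inner (slice y t) (slice g t) - inner (slice (?s y) t) (slice (?s g) t)"
    using all AE_lborel_translation[OF all, of "- h"] slice_diff[of y "?s y"] slice_shift[of "- h" y] slice_shift[of "- h" g]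
    unfolding AE_lebesgue_iff
  proof eventually_elim
    case (elim t)
    let ?S = "slice y t" and ?G = "slice g t" and ?S' = "slice y (t + - h)" and ?G' = "slice g (t + - h)"
    have "inner (?S + (-1) *\<^sub>R ?S') (?G + (-1) *\<^sub>R ?G') \<le> 0"
      using elim by (intro laplacian_nonpos[of _ \<Omega>] weak_laplacian_add weak_laplacian_scaleR)
        (auto intro: subspace_diff[OF subspace_H1_0])
    moreover have "inner ?S ?G' = inner ?S' ?G" by (rule laplacian_symmetric) (use elim in auto)
    ultimately show ?case using elim by (simp add: inner_diff_left inner_diff_right)
  qed
  have "(\<integral>t. 2 * inner (slice (y - ?s y) t) (slice g t) \<partial>lebesgue)
      \<le> (\<integral>t. inner (slice y t) (slice g t) - inner (slice (?s y) t) (slice (?s g) t) \<partial>lebesgue)"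
    by (rule integral_mono_AE[OF _ _ ae]) (auto intro!: integrable_mult_right Bochner_Integration.integrable_diff slice_inner(1))
  then have "2 * inner (y - ?s y) g \<le> inner y g - inner (?s y) (?s g)"
    by (simp add: slice_inner)
  moreover have "inner (?s y) (?s g) = inner y g"
    using inner_shift[of "(- h, 0)" y "?s g"] shift_inverse[of "(- h, 0)" g] by simp
  ultimately show ?thesis by simp
qed

text \<open>The difference is moved to the test function, where it becomes a forward quotient with
  negative sign. That quotient converges pointwise to minus the time derivative and is bounded by
  the mean value theorem; boundedness of the cylinder makes \<open>f\<close> integrable, so the
  limit passes under the integral.\<close>

lemma time_difference_quotient_tendsto:
  fixes y w :: "(real \<times> 'a::euclidean_space) l2"
  assumes \<Omega>: "open \<Omega>" "bounded \<Omega>" and y: "H1_time \<Omega> T y w" and \<phi>: "test_fun (cyl \<Omega> T) \<phi>"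
  shows "(\<lambda>n. inner (real (Suc n) *\<^sub>R (y - shift (- inverse (real (Suc n)), 0) y)) (l2_class \<phi>))
    \<longlonglongrightarrow> inner w (l2_class \<phi>)"
proof -
  have yU: "y \<in> L2_on (cyl \<Omega> T)" and pd: "weak_pd (cyl \<Omega> T) (1, 0) y w"
    using y unfolding H1_time_def by auto
  obtain f where f: "f \<in> borel_measurable borel" "sq_integrable f" "y = l2_class f"
    "\<And>p. p \<notin> cyl \<Omega> T \<Longrightarrow> f p = 0"
    using l2_borel_on[OF yU] open_cyl[OF \<Omega>(1), of T] by auto
  have Basis: "(1, 0) \<in> (Basis :: (real \<times> 'a) set)" by (auto simp: Basis_prod_def)
  note \<phi>' = test_fun_pd[OF \<phi> Basis]
  note \<phi>m = test_fun_borel[OF \<phi>] test_fun_sq_integrable[OF \<phi>]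
  obtain B where B: "B > 0" "\<And>p. \<bar>pd (1, 0) \<phi> p\<bar> \<le> B" using test_fun_bounded[OF \<phi>'] by blast
  define q where "q = (\<lambda>n p. real (Suc n) * (\<phi> p - \<phi> (p + (inverse (real (Suc n)), 0))))"
  have qm: "q n \<in> borel_measurable borel" for n
    unfolding q_def
    using borel_measurable_diff[OF \<phi>m(1) translation_borel[OF \<phi>m(1), of "(inverse (real (Suc n)), 0)"]]
    by (intro borel_measurable_times borel_measurable_const)
  have "inner (real (Suc n) *\<^sub>R (y - shift (- inverse (real (Suc n)), 0) y)) (l2_class \<phi>)
      = (\<integral>p. f p * q n p \<partial>lborel)" for n
  proof -
    let ?h = "(inverse (real (Suc n)), 0::'a)"
    have sq: "sq_integrable (\<lambda>p. \<phi> p - \<phi> (p + ?h))"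
      by (rule sq_integrable_diff[OF \<phi>m(2) sq_integrable_translation[OF \<phi>m]])
    have "inner (real (Suc n) *\<^sub>R (y - shift (- inverse (real (Suc n)), 0) y)) (l2_class \<phi>)
        = real (Suc n) * (inner y (l2_class \<phi>) - inner y (shift ?h (l2_class \<phi>)))"
      using inner_shift[of "(- inverse (real (Suc n)), 0)" y "l2_class \<phi>"]
      by (simp add: inner_diff_left)
    also have "\<dots> = inner y (real (Suc n) *\<^sub>R (l2_class \<phi> - shift ?h (l2_class \<phi>)))"
      by (simp only: inner_scaleR_right inner_diff_right)
    also have "real (Suc n) *\<^sub>R (l2_class \<phi> - shift ?h (l2_class \<phi>)) = l2_class (q n)"
      unfolding shift_class[OF \<phi>m] l2_class_diff[OF \<phi>m(2) sq_integrable_translation[OF \<phi>m]]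
        l2_class_scaleR[OF sq] q_def ..
    also have "inner y (l2_class (q n)) = (\<integral>p. f p * q n p \<partial>lborel)"
      unfolding f(3) by (rule inner_l2_borel[OF f(2) _ f(1) qm]) (use sq_integrable_scale[OF sq] in \<open>simp add: q_def\<close>)
    finally show ?thesis .
  qed
  moreover have "(\<lambda>n. (\<integral>p. f p * q n p \<partial>lborel)) \<longlonglongrightarrow> (\<integral>p. f p * (- pd (1, 0) \<phi> p) \<partial>lborel)"
  proof (rule integral_dominated_convergence[of _ _ _ "\<lambda>p. \<bar>f p\<bar> * B"])
    show "(\<lambda>p. f p * (- pd (1, 0) \<phi> p)) \<in> borel_measurable lborel"
      using f(1) test_fun_borel[OF \<phi>'] by measurable
    show "(\<lambda>p. f p * q n p) \<in> borel_measurable lborel" for n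
      using f(1) qm by measurable
    show "integrable lborel (\<lambda>p. \<bar>f p\<bar> * B)"
    proof -
      have "bounded (cyl \<Omega> T)" unfolding cyl_def using \<Omega>(2) by (intro bounded_Times) auto
      then obtain C where C: "compact C" "cyl \<Omega> T \<subseteq> C"
        by (meson compact_cbox bounded_subset_cbox_symmetric)
      have "sq_integrable (indicator C :: real \<times> 'a \<Rightarrow> real)"
        using C(1) by (intro bounded_compact_support_sq_integrable[of _ C 1])
          (auto intro!: borel_measurable_indicator borel_compact simp: indicator_def)
      from integrable_mult_borel[OF this f(2) _ f(1)]
      have "integrable lborel (\<lambda>p. indicator C p * f p)"
        using C(1) by (simp add: borel_compact borel_measurable_indicator)
      moreover have "indicator C p * f p = f p" for p
        using f(4)[of p] C(2) by (auto simp: indicator_def)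
      ultimately show ?thesis by simp
    qed
    have mvt: "\<exists>s. t < s \<and> s < t + h \<and> \<phi> (t + h, x) - \<phi> (t, x) = h * pd (1, 0) \<phi> (s, x)" if "h > 0" for t h x
      using MVT2[of t "t + h" "\<lambda>t. \<phi> (t, x)" "\<lambda>t. pd (1, 0) \<phi> (t, x)"] that
        test_fun_time_derivative[OF \<phi>] by auto
    show "AE p in lborel. norm (f p * q n p) \<le> \<bar>f p\<bar> * B" for n
    proof (rule AE_I2)
      fix p :: "real \<times> 'a"
      obtain t x where p: "p = (t, x)" by (cases p)
      obtain s where "\<phi> (t + inverse (real (Suc n)), x) - \<phi> (t, x) = inverse (real (Suc n)) * pd (1, 0) \<phi> (s, x)"
        using mvt[of "inverse (real (Suc n))" t x] by auto
      then have "q n p = - pd (1, 0) \<phi> (s, x)"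
        unfolding q_def p by (simp add: field_simps del: of_nat_Suc)
      then show "norm (f p * q n p) \<le> \<bar>f p\<bar> * B"
        using B(2)[of "(s, x)"] by (simp add: abs_mult mult_left_mono)
    qed
    show "AE p in lborel. (\<lambda>n. f p * q n p) \<longlonglongrightarrow> f p * (- pd (1, 0) \<phi> p)"
    proof (rule AE_I2)
      fix p :: "real \<times> 'a"
      obtain t x where p: "p = (t, x)" by (cases p)
      have "((\<lambda>h. (\<phi> (t + h, x) - \<phi> (t, x)) / h) \<longlongrightarrow> pd (1, 0) \<phi> p) (at 0)"
        using test_fun_time_derivative[OF \<phi>, of x t] unfolding DERIV_def p .
      moreover have "filterlim (\<lambda>n. inverse (real (Suc n))) (at 0) sequentially"
        using LIMSEQ_inverse_real_of_nat by (simp add: filterlim_at)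
      ultimately have "(\<lambda>n. (\<phi> (t + inverse (real (Suc n)), x) - \<phi> (t, x)) / inverse (real (Suc n))) \<longlonglongrightarrow> pd (1, 0) \<phi> p"
        by (rule filterlim_compose)
      then have "(\<lambda>n. - ((\<phi> (t + inverse (real (Suc n)), x) - \<phi> (t, x)) / inverse (real (Suc n)))) \<longlonglongrightarrow> - pd (1, 0) \<phi> p"
        by (rule tendsto_minus)
      moreover have "- ((\<phi> (t + inverse (real (Suc n)), x) - \<phi> (t, x)) / inverse (real (Suc n))) = q n p" for n
        unfolding q_def p by (simp add: field_simps del: of_nat_Suc)
      ultimately show "(\<lambda>n. f p * q n p) \<longlonglongrightarrow> f p * (- pd (1, 0) \<phi> p)"
        by (intro tendsto_mult tendsto_const) simp
    qed
  qed
  moreover have "(\<integral>p. f p * (- pd (1, 0) \<phi> p) \<partial>lborel) = inner w (l2_class \<phi>)"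
  proof -
    have "inner y (l2_class (pd (1, 0) \<phi>)) = (\<integral>p. f p * pd (1, 0) \<phi> p \<partial>lborel)"
      unfolding f(3) by (rule inner_l2_borel[OF f(2) test_fun_sq_integrable[OF \<phi>'] f(1) test_fun_borel[OF \<phi>']])
    then show ?thesis using pd \<phi> unfolding weak_pd_def by simp
  qed
  ultimately show ?thesis by simp
qed

lemma time_derivative_laplacian_nonpos:
  assumes \<Omega>: "open \<Omega>" "bounded \<Omega>" and T: "T > 0" and y: "H1_time \<Omega> T y w" and g: "g \<in> L2_on (cyl \<Omega> T)"
    and sp: "AE t in lebesgue. t \<in> {0<..<T} \<longrightarrow> slice y t \<in> H1_0 \<Omega> \<and> weak_laplacian \<Omega> (slice y t) (slice g t)"
  shows "inner w g \<le> 0"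
proof -
  let ?Q = "cyl \<Omega> T"
  have Q: "?Q \<in> sets lebesgue" by (rule sets_lebesgue_open[OF open_cyl[OF \<Omega>(1)]])
  define h where "h = (\<lambda>n. inverse (real (Suc n)))"
  have h: "h n > 0" "real (Suc n) * h n = 1" for n unfolding h_def by (simp_all del: of_nat_Suc)
  \<comment> \<open>Without the cut, the jump at time \<open>T\<close> of \<open>y\<close> extended
    by 0 would in general make the quotients unbounded in \<open>L^2\<close>. Since \<open>g\<close>
    vanishes off the cylinder, the cut does not change the pairing with \<open>g\<close>.\<close>
  define D where "D = (\<lambda>n. real (Suc n) *\<^sub>R cut ?Q (y - shift (- h n, 0) y))"
  have inner_D: "inner (D n) v = inner (real (Suc n) *\<^sub>R (y - shift (- h n, 0) y)) v" if "v \<in> L2_on ?Q" for n v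
    using inner_cut[OF Q, of _ v] cut_eq_iff[OF Q, of v] that unfolding D_def by simp
  have bound: "norm (D n) \<le> norm w" for n
  proof -
    have "norm (D n) \<le> real (Suc n) * (h n * norm w)"
      unfolding D_def using H1_time_bounds(2)[OF \<Omega>(1) T y h(1)] by (simp add: mult_left_mono del: of_nat_Suc)
    then show ?thesis using h(2)[of n] by (simp add: mult.assoc[symmetric] del: of_nat_Suc)
  qed
  have "(\<lambda>n. inner (D n) g) \<longlonglongrightarrow> inner w g"
  proof (rule weak_limit_on_closure[OF bound])
    show "g \<in> closure {l2_class \<phi> |\<phi>. test_fun ?Q \<phi>}"
      using closure_test_classes[OF open_cyl[OF \<Omega>(1)]] g by blast
    fix v assume "v \<in> {l2_class \<phi> |\<phi>. test_fun ?Q \<phi>}"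
    then obtain \<phi> where \<phi>: "test_fun ?Q \<phi>" "v = l2_class \<phi>" by blast
    then show "(\<lambda>n. inner (D n) v) \<longlonglongrightarrow> inner w v"
      using time_difference_quotient_tendsto[OF \<Omega> y \<phi>(1)] inner_D[OF test_fun_in_L2_on[OF \<phi>(1)]]
      unfolding h_def by simp
  qed
  moreover have "inner (D n) g \<le> 0" for n
  proof -
    have yU: "y \<in> L2_on ?Q" using y unfolding H1_time_def by simp
    show ?thesis
      unfolding inner_D[OF g] using backward_difference_laplacian_nonpos[OF \<Omega>(1) yU g sp, of "h n"]
      by (simp add: mult_nonneg_nonpos)
  qed
  ultimately show ?thesis by (intro LIMSEQ_le_const2) auto
qed

subsection \<open>The space \<open>Y\<close>\<close>

text \<open>Carries the time derivative \<open>w\<close> and the Laplacian \<open>g\<close> as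
  witnesses in place of the definite descriptions \<open>time_deriv\<close> and
  \<open>laplace\<close>, so that sums, multiples and limits are those of a graph.\<close>

definition heat_triple ::
  "'a::euclidean_space set \<Rightarrow> real \<Rightarrow> (real \<times> 'a) l2 \<Rightarrow> (real \<times> 'a) l2 \<Rightarrow> (real \<times> 'a) l2 \<Rightarrow> bool" where
  "heat_triple \<Omega> T y w g \<longleftrightarrow> H1_time \<Omega> T y w \<and> g \<in> L2_on (cyl \<Omega> T) \<and>
     (AE t in lebesgue. t \<in> {0<..<T} \<longrightarrow> slice y t \<in> H1_0 \<Omega> \<and> weak_laplacian \<Omega> (slice y t) (slice g t))"

lemma Y_space_iff: "y \<in> Y_space \<Omega> T \<longleftrightarrow> (\<exists>w g. heat_triple \<Omega> T y w g)"
proof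
  assume "y \<in> Y_space \<Omega> T"
  then obtain w z g where yw: "y \<in> L2_on (cyl \<Omega> T)" "w \<in> L2_on (cyl \<Omega> T)" "weak_pd (cyl \<Omega> T) (1, 0) y w"
    "continuous_on {0..T} z" "z 0 = 0" "AE t in lebesgue. t \<in> {0<..<T} \<longrightarrow> slice y t = z t"
    and g: "g \<in> L2_on (cyl \<Omega> T)" "AE t in lebesgue. t \<in> {0<..<T} \<longrightarrow> weak_laplacian \<Omega> (slice y t) (slice g t)"
    and s: "AE t in lebesgue. t \<in> {0<..<T} \<longrightarrow> slice y t \<in> H_Laplace \<Omega> \<inter> H1_0 \<Omega>"
    unfolding Y_space_def L2_H_Laplace_H1_0_def H1_0star_def spatial_laplacian_def by blast
  have "AE t in lebesgue. t \<in> {0<..<T} \<longrightarrow> slice y t \<in> H1_0 \<Omega> \<and> weak_laplacian \<Omega> (slice y t) (slice g t)"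
    using g(2) s by eventually_elim blast
  then show "\<exists>w g. heat_triple \<Omega> T y w g"
    using yw g(1) unfolding heat_triple_def H1_time_def by blast
next
  assume "\<exists>w g. heat_triple \<Omega> T y w g"
  then obtain w g where H: "H1_time \<Omega> T y w" and g: "g \<in> L2_on (cyl \<Omega> T)"
    and s: "AE t in lebesgue. t \<in> {0<..<T} \<longrightarrow> slice y t \<in> H1_0 \<Omega> \<and> weak_laplacian \<Omega> (slice y t) (slice g t)"
    unfolding heat_triple_def by blast
  have "AE t in lebesgue. t \<in> {0<..<T} \<longrightarrow> slice y t \<in> H_Laplace \<Omega> \<inter> H1_0 \<Omega>"
    using s slice_in_L2_on[OF g] by eventually_elim (auto simp: H_Laplace_def H1_0_def)
  moreover have "spatial_laplacian \<Omega> T y g"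
    unfolding spatial_laplacian_def using s by eventually_elim blast
  ultimately show "y \<in> Y_space \<Omega> T"
    using H g unfolding Y_space_def L2_H_Laplace_H1_0_def H1_0star_def H1_time_def by blast
qed

lemma heat_triple_add:
  assumes "heat_triple \<Omega> T y w g" "heat_triple \<Omega> T y' w' g'"
  shows "heat_triple \<Omega> T (y + y') (w + w') (g + g')"
proof -
  have 1: "AE t in lebesgue. t \<in> {0<..<T} \<longrightarrow> slice y t \<in> H1_0 \<Omega> \<and> weak_laplacian \<Omega> (slice y t) (slice g t)"
    and 2: "AE t in lebesgue. t \<in> {0<..<T} \<longrightarrow> slice y' t \<in> H1_0 \<Omega> \<and> weak_laplacian \<Omega> (slice y' t) (slice g' t)"
    using assms unfolding heat_triple_def by auto
  have "AE t in lebesgue. t \<in> {0<..<T} \<longrightarrow> slice (y + y') t \<in> H1_0 \<Omega> \<and>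
      weak_laplacian \<Omega> (slice (y + y') t) (slice (g + g') t)"
    using 1 2 slice_add[of y y'] slice_add[of g g']
    by eventually_elim (auto intro: weak_laplacian_add subspace_add[OF subspace_H1_0])
  then show ?thesis
    using assms H1_time_add subspace_add[OF subspace_L2_on] unfolding heat_triple_def by blast
qed

lemma heat_triple_scaleR:
  assumes "heat_triple \<Omega> T y w g"
  shows "heat_triple \<Omega> T (c *\<^sub>R y) (c *\<^sub>R w) (c *\<^sub>R g)"
proof -
  have 1: "AE t in lebesgue. t \<in> {0<..<T} \<longrightarrow> slice y t \<in> H1_0 \<Omega> \<and> weak_laplacian \<Omega> (slice y t) (slice g t)"
    using assms unfolding heat_triple_def by auto
  have "AE t in lebesgue. t \<in> {0<..<T} \<longrightarrow> slice (c *\<^sub>R y) t \<in> H1_0 \<Omega> \<and>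
      weak_laplacian \<Omega> (slice (c *\<^sub>R y) t) (slice (c *\<^sub>R g) t)"
    using 1 slice_scaleR[of c y] slice_scaleR[of c g]
    by eventually_elim (auto intro: weak_laplacian_scaleR subspace_scale[OF subspace_H1_0])
  then show ?thesis
    using assms H1_time_scaleR subspace_scale[OF subspace_L2_on] unfolding heat_triple_def by blast
qed

lemma time_deriv_eq:
  assumes "open \<Omega>" "H1_time \<Omega> T y w"
  shows "time_deriv \<Omega> T y = w"
  unfolding time_deriv_def
  using assms weak_pd_unique[OF open_cyl[OF assms(1)]] unfolding H1_time_def
  by (intro the_equality) blast+

lemma laplace_eq:
  assumes \<Omega>: "open \<Omega>" and g: "g \<in> L2_on (cyl \<Omega> T)" "spatial_laplacian \<Omega> T y g"
  shows "laplace \<Omega> T y = g"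
  unfolding laplace_def
proof (rule the_equality)
  fix g' assume g': "g' \<in> L2_on (cyl \<Omega> T) \<and> spatial_laplacian \<Omega> T y g'"
  then have g'U: "g' \<in> L2_on (cyl \<Omega> T)" ..
  show "g' = g"
  proof (rule slice_eqI)
    have "AE t in lebesgue. t \<in> {0<..<T} \<longrightarrow> weak_laplacian \<Omega> (slice y t) (slice g' t)"
      "AE t in lebesgue. t \<in> {0<..<T} \<longrightarrow> weak_laplacian \<Omega> (slice y t) (slice g t)"
      using g g' unfolding spatial_laplacian_def by auto
    then show "AE t in lebesgue. slice g' t = slice g t"
      using slice_in_L2_on[OF g(1)] slice_in_L2_on[OF g'U]
    proof eventually_elim
      case (elim t)
      then show ?case using weak_laplacian_unique[OF \<Omega>] by (cases "t \<in> {0<..<T}") auto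
    qed
  qed
qed (use g in simp)

lemma heat_eq:
  assumes "open \<Omega>" "heat_triple \<Omega> T y w g"
  shows "heat \<kappa> \<Omega> T y = w - \<kappa> *\<^sub>R g"
proof -
  have "spatial_laplacian \<Omega> T y g"
    using assms(2) unfolding heat_triple_def spatial_laplacian_def by (auto elim: AE_mp)
  then show ?thesis
    using assms time_deriv_eq laplace_eq unfolding heat_def heat_triple_def by metis
qed

lemma subspace_Y_space:
  fixes \<Omega> :: "'a::euclidean_space set"
  assumes "open \<Omega>" "T > 0"
  shows "subspace (Y_space \<Omega> T)"
proof (rule subspaceI)
  obtain y where y: "H1_time \<Omega> T y 0"
    using H1_time_exists[OF assms subspace_0[OF subspace_L2_on]] by blast
  have "y = 0" by (rule H1_time_zero_unique[OF assms y])
  then have "heat_triple \<Omega> T 0 0 0"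
    using y slice_zero[where 'a='a] subspace_0[OF subspace_L2_on, of "cyl \<Omega> T"] subspace_0[OF subspace_H1_0, of \<Omega>]
    unfolding heat_triple_def by (auto elim!: AE_mp simp: weak_laplacian_def)
  then show "0 \<in> Y_space \<Omega> T" unfolding Y_space_iff by blast
next
  fix x y assume "x \<in> Y_space \<Omega> T" "y \<in> Y_space \<Omega> T"
  then show "x + y \<in> Y_space \<Omega> T" unfolding Y_space_iff using heat_triple_add by blast
next
  fix x c assume "x \<in> Y_space \<Omega> T"
  then show "c *\<^sub>R x \<in> Y_space \<Omega> T" unfolding Y_space_iff using heat_triple_scaleR by blast
qed

lemma heat_add:
  assumes "open \<Omega>" "x \<in> Y_space \<Omega> T" "y \<in> Y_space \<Omega> T"
  shows "heat \<kappa> \<Omega> T (x + y) = heat \<kappa> \<Omega> T x + heat \<kappa> \<Omega> T y"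
proof -
  obtain w g w' g' where 1: "heat_triple \<Omega> T x w g" and 2: "heat_triple \<Omega> T y w' g'"
    using assms Y_space_iff by metis
  show ?thesis
    unfolding heat_eq[OF assms(1) 1] heat_eq[OF assms(1) 2] heat_eq[OF assms(1) heat_triple_add[OF 1 2]]
    by (simp add: algebra_simps)
qed

lemma heat_scaleR:
  assumes "open \<Omega>" "x \<in> Y_space \<Omega> T"
  shows "heat \<kappa> \<Omega> T (c *\<^sub>R x) = c *\<^sub>R heat \<kappa> \<Omega> T x"
proof -
  obtain w g where 1: "heat_triple \<Omega> T x w g"
    using assms Y_space_iff by metis
  show ?thesis
    unfolding heat_eq[OF assms(1) 1] heat_eq[OF assms(1) heat_triple_scaleR[OF 1]]
    by (simp add: algebra_simps)
qed

lemma heat_in_U_space: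
  assumes "open \<Omega>" "x \<in> Y_space \<Omega> T"
  shows "heat \<kappa> \<Omega> T x \<in> U_space \<Omega> T"
proof -
  obtain w g where 1: "heat_triple \<Omega> T x w g"
    using assms Y_space_iff by metis
  show ?thesis
    unfolding heat_eq[OF assms(1) 1] using 1 unfolding heat_triple_def H1_time_def
    by (intro subspace_diff[OF subspace_L2_on] subspace_scale[OF subspace_L2_on]) auto
qed

lemma maximal_regularity:
  assumes "open \<Omega>" "bounded \<Omega>" "T > 0" "\<kappa> > 0" "heat_triple \<Omega> T y w g"
  shows "norm w \<le> norm (w - \<kappa> *\<^sub>R g)" "\<kappa> * norm g \<le> norm (w - \<kappa> *\<^sub>R g)"
proof -
  have "inner w g \<le> 0"
    using assms(5) time_derivative_laplacian_nonpos[OF assms(1-3)] unfolding heat_triple_def by blast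
  then have "\<kappa> * inner w g \<le> 0" using assms(4) by (simp add: mult_nonneg_nonpos)
  moreover have "(norm (w - \<kappa> *\<^sub>R g))\<^sup>2 = (norm w)\<^sup>2 + (\<kappa> * norm g)\<^sup>2 - 2 * (\<kappa> * inner w g)"
    unfolding power2_norm_eq_inner power_mult_distrib
    by (simp add: inner_diff_left inner_diff_right inner_commute[of g w] power2_eq_square algebra_simps)
  ultimately have "(norm w)\<^sup>2 + (\<kappa> * norm g)\<^sup>2 \<le> (norm (w - \<kappa> *\<^sub>R g))\<^sup>2" by simp
  then have "(norm w)\<^sup>2 \<le> (norm (w - \<kappa> *\<^sub>R g))\<^sup>2" "(\<kappa> * norm g)\<^sup>2 \<le> (norm (w - \<kappa> *\<^sub>R g))\<^sup>2"
    using zero_le_power2[of "norm w"] zero_le_power2[of "\<kappa> * norm g"] by linarith+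
  then show "norm w \<le> norm (w - \<kappa> *\<^sub>R g)" "\<kappa> * norm g \<le> norm (w - \<kappa> *\<^sub>R g)"
    by (auto intro: power2_le_imp_le)
qed

text \<open>Supplies both the injectivity of the heat operator and the constant with which it
  controls the observation.\<close>

lemma norm_le_heat:
  assumes "open \<Omega>" "bounded \<Omega>" "T > 0" "\<kappa> > 0" "y \<in> Y_space \<Omega> T"
  shows "norm y \<le> T * norm (heat \<kappa> \<Omega> T y)"
proof -
  obtain w g where 1: "heat_triple \<Omega> T y w g"
    using assms Y_space_iff by metis
  have "norm y \<le> T * norm w"
    using 1 H1_time_bounds(1)[OF assms(1,3)] unfolding heat_triple_def by blast
  also have "\<dots> \<le> T * norm (w - \<kappa> *\<^sub>R g)"
    using maximal_regularity(1)[OF assms(1-4) 1] assms(3) by simp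
  finally show ?thesis unfolding heat_eq[OF assms(1) 1] .
qed

text \<open>The spatial conditions concern almost every slice, so convergence in norm is first
  turned into convergence of slices along a subsequence common to \<open>y\<close> and
  \<open>g\<close>. At each such time closedness of \<open>H^1_0\<close> under convergence of
  Laplacians applies.\<close>

lemma heat_triple_tendsto:
  assumes \<Omega>: "open \<Omega>" and T: "T > 0" and tr: "\<And>n. heat_triple \<Omega> T (y n) (w n) (g n)"
    and lim: "w \<longlonglongrightarrow> w'" "g \<longlonglongrightarrow> g'"
  obtains y' where "y \<longlonglongrightarrow> y'" "heat_triple \<Omega> T y' w' g'"
proof -
  obtain y' where y': "y \<longlonglongrightarrow> y'" "H1_time \<Omega> T y' w'"
    using H1_time_closed[OF \<Omega> T _ lim(1), of y] tr unfolding heat_triple_def by blast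
  have "closed (L2_on (cyl \<Omega> T))"
    by (rule closed_L2_on[OF sets_lebesgue_open[OF open_cyl[OF \<Omega>]]])
  then have g': "g' \<in> L2_on (cyl \<Omega> T)"
    using closed_sequentially[OF _ _ lim(2)] tr unfolding heat_triple_def by blast
  obtain r where r: "strict_mono r" "AE t in lebesgue. (\<lambda>n. slice (y (r n)) t) \<longlonglongrightarrow> slice y' t"
    using slice_subseq_convergent[OF y'(1)] by blast
  have "(\<lambda>n. g (r n)) \<longlonglongrightarrow> g'"
    using LIMSEQ_subseq_LIMSEQ[OF lim(2) r(1)] by (simp add: o_def)
  then obtain r' where r': "strict_mono r'" "AE t in lebesgue. (\<lambda>n. slice (g (r (r' n))) t) \<longlonglongrightarrow> slice g' t"
    using slice_subseq_convergent[of "\<lambda>n. g (r n)"] by blast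
  have "AE t in lebesgue. \<forall>n. t \<in> {0<..<T} \<longrightarrow> slice (y n) t \<in> H1_0 \<Omega> \<and> weak_laplacian \<Omega> (slice (y n) t) (slice (g n) t)"
    unfolding AE_all_countable using tr unfolding heat_triple_def by blast
  with r(2) r'(2)
  have "AE t in lebesgue. t \<in> {0<..<T} \<longrightarrow> slice y' t \<in> H1_0 \<Omega> \<and> weak_laplacian \<Omega> (slice y' t) (slice g' t)"
  proof eventually_elim
    case (elim t)
    have l: "(\<lambda>n. slice (y (r (r' n))) t) \<longlonglongrightarrow> slice y' t"
      using LIMSEQ_subseq_LIMSEQ[OF elim(1) r'(1)] by (simp add: o_def)
    show ?case
    proof
      assume "t \<in> {0<..<T}"
      then have h: "slice (y (r (r' n))) t \<in> H1_0 \<Omega>"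
        "weak_laplacian \<Omega> (slice (y (r (r' n))) t) (slice (g (r (r' n))) t)" for n
        using elim(3) by blast+
      show "slice y' t \<in> H1_0 \<Omega> \<and> weak_laplacian \<Omega> (slice y' t) (slice g' t)"
        using H1_0_closed[OF \<Omega> h l elim(2)] weak_laplacian_tendsto[OF h(2) l elim(2)] by blast
    qed
  qed
  then have "heat_triple \<Omega> T y' w' g'" using y'(2) g' unfolding heat_triple_def by blast
  with y'(1) show ?thesis by (rule that)
qed

text \<open>The a priori estimate for differences splits a Cauchy sequence of images into Cauchy
  sequences of time derivatives and of Laplacians, to whose limits the closedness of the graph
  applies.\<close>

lemma complete_heat_range:
  assumes "open \<Omega>" "bounded \<Omega>" "T > 0" "\<kappa> > 0"
  shows "complete (heat \<kappa> \<Omega> T ` Y_space \<Omega> T)"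
  unfolding complete_def
proof safe
  fix k :: "nat \<Rightarrow> (real \<times> 'a) l2"
  assume k: "\<forall>n. k n \<in> heat \<kappa> \<Omega> T ` Y_space \<Omega> T" "Cauchy k"
  have "\<exists>y w g. heat_triple \<Omega> T y w g \<and> k n = w - \<kappa> *\<^sub>R g" for n
  proof -
    obtain y where y: "y \<in> Y_space \<Omega> T" "k n = heat \<kappa> \<Omega> T y" using k(1) by blast
    then obtain w g where "heat_triple \<Omega> T y w g" using Y_space_iff by metis
    with y(2) show ?thesis using heat_eq[OF assms(1)] by metis
  qed
  then obtain y w g where ywg: "\<And>n. heat_triple \<Omega> T (y n) (w n) (g n)" "\<And>n. k n = w n - \<kappa> *\<^sub>R g n"
    by metis
  have tr: "heat_triple \<Omega> T (y n + (-1) *\<^sub>R y m) (w n + (-1) *\<^sub>R w m) (g n + (-1) *\<^sub>R g m)" for n m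
    by (intro heat_triple_add heat_triple_scaleR ywg)
  have kd: "(w n + (-1) *\<^sub>R w m) - \<kappa> *\<^sub>R (g n + (-1) *\<^sub>R g m) = k n - k m" for n m
    unfolding ywg(2) by (simp add: algebra_simps)
  have d: "norm (w n - w m) \<le> norm (k n - k m)" "\<kappa> * norm (g n - g m) \<le> norm (k n - k m)" for n m
    using maximal_regularity[OF assms tr[of n m]] unfolding kd by simp_all
  have "Cauchy w"
    using k(2) unfolding Cauchy_def dist_norm by (meson d(1) le_less_trans)
  moreover have "Cauchy g"
  proof (rule metric_CauchyI)
    fix e :: real assume "e > 0"
    then obtain N where N: "\<And>m n. m \<ge> N \<Longrightarrow> n \<ge> N \<Longrightarrow> norm (k m - k n) < \<kappa> * e"
      using k(2) assms(4) unfolding Cauchy_def dist_norm by (metis mult_pos_pos)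
    have "norm (g m - g n) < e" if "m \<ge> N" "n \<ge> N" for m n
    proof -
      have "\<kappa> * norm (g m - g n) < \<kappa> * e"
        using d(2)[of m n] N[OF that] by linarith
      then show ?thesis using assms(4) by simp
    qed
    then show "\<exists>N. \<forall>m\<ge>N. \<forall>n\<ge>N. dist (g m) (g n) < e" unfolding dist_norm by blast
  qed
  ultimately obtain w' g' where lim: "w \<longlonglongrightarrow> w'" "g \<longlonglongrightarrow> g'"
    using complete_l2 unfolding complete_def by blast
  obtain y' where y': "heat_triple \<Omega> T y' w' g'"
    using heat_triple_tendsto[OF assms(1,3) ywg(1) lim] by blast
  have "k \<longlonglongrightarrow> w' - \<kappa> *\<^sub>R g'"
    unfolding ywg(2) by (intro tendsto_intros lim)
  then show "\<exists>l\<in>heat \<kappa> \<Omega> T ` Y_space \<Omega> T. k \<longlonglongrightarrow> l"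
    using heat_eq[OF assms(1) y'] y' Y_space_iff by (metis image_eqI)
qed

subsection \<open>The abstract optimality system\<close>

text \<open>At \<open>x = pi / 7\<close> the values \<open>cos (4 x)\<close> and
  \<open>- cos (3 x)\<close> agree. Expanded in \<open>cos x\<close> this is a quartic with root -1,
  and the remaining factor is the cubic. The sine equals \<open>cos (3 x)\<close>, again a
  polynomial in \<open>p\<close> that the cubic reduces to degree two.\<close>

lemma cos_pi_7_cubic:
  defines "p \<equiv> 2 * cos (pi / 7)"
  shows "p ^ 3 - p ^ 2 - 2 * p + 1 = 0" "2 * sin (pi / 14) = p ^ 2 - p - 1"
    "1.8019 < p" "p < 1.8020"
proof -
  define c where "c = cos (pi / 7)"
  have p: "p = 2 * c" unfolding p_def c_def ..
  have c3: "cos (3 * (pi / 7)) = 4 * c ^ 3 - 3 * c"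
    unfolding c_def by (rule cos_treble_cos)
  have c0: "c > 0" unfolding c_def by (rule cos_gt_zero) (use pi_gt_zero in auto)
  have "cos (4 * (pi / 7)) = 2 * (cos (2 * (pi / 7)))\<^sup>2 - 1"
    using cos_double_cos[of "2 * (pi / 7)"] by simp
  also have "cos (2 * (pi / 7)) = 2 * c\<^sup>2 - 1"
    unfolding c_def by (rule cos_double_cos)
  finally have "cos (4 * (pi / 7)) = 2 * (2 * c\<^sup>2 - 1)\<^sup>2 - 1" .
  moreover have "cos (4 * (pi / 7)) = - cos (3 * (pi / 7))"
  proof -
    have "4 * (pi / 7) = pi - 3 * (pi / 7)" by (simp add: field_simps)
    then show ?thesis by (simp only: cos_pi_minus)
  qed
  ultimately have "(c + 1) * (8 * c ^ 3 - 4 * c\<^sup>2 - 4 * c + 1) = 0"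
    using c3 by (simp add: algebra_simps power2_eq_square power3_eq_cube)
  then have "8 * c ^ 3 - 4 * c\<^sup>2 - 4 * c + 1 = 0" using c0 by simp
  then show cubic: "p ^ 3 - p ^ 2 - 2 * p + 1 = 0"
    unfolding p by (simp add: power_mult_distrib)
  have "sin (pi / 14) = cos (3 * (pi / 7))"
  proof -
    have "3 * (pi / 7) = pi / 2 - pi / 14" by (simp add: field_simps)
    then show ?thesis using sin_cos_eq[of "pi / 14"] by simp
  qed
  then have "2 * sin (pi / 14) = p ^ 3 - 3 * p"
    unfolding c3 p by (simp add: power_mult_distrib)
  then show "2 * sin (pi / 14) = p ^ 2 - p - 1" using cubic by simp
  \<comment> \<open>This crude bound, \<open>p > sqrt 3 > 1.7\<close>, separates \<open>p\<close>
    from the other two roots of the cubic.\<close>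
  have "cos (pi / 6) < c"
    unfolding c_def by (rule cos_monotone_0_pi) (use pi_gt_zero in auto)
  then have "sqrt 3 < p" unfolding p cos_30 by simp
  moreover have "1.7 < sqrt 3" by (rule real_less_rsqrt) (simp add: power2_eq_square)
  ultimately have p17: "1.7 < p" by simp
  \<comment> \<open>As \<open>p\<close> is a root, the cubic at \<open>a\<close> has
    \<open>a - p\<close> as a factor, with a quadratic cofactor that is positive for
    \<open>a > 1.7\<close>. The sign of the cubic at \<open>a\<close> thus tells on which side of
    \<open>p\<close> the number \<open>a\<close> lies.\<close>
  have factor: "(p - a) * (p\<^sup>2 + p * a + a\<^sup>2 - p - a - 2) = - (a ^ 3 - a\<^sup>2 - 2 * a + 1)" for a
    using cubic by (simp add: algebra_simps power2_eq_square power3_eq_cube)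
  have pos: "p\<^sup>2 + p * a + a\<^sup>2 - p - a - 2 > 0" if "a > 1.7" for a
  proof -
    have "p\<^sup>2 > 1.7 * p" "p * a > 1.7 * a" "a\<^sup>2 > 1.7 * a"
      using p17 that by (simp_all add: power2_eq_square)
    then show ?thesis using p17 that by linarith
  qed
  have "(p - 1.8019) * (p\<^sup>2 + p * 1.8019 + 1.8019\<^sup>2 - p - 1.8019 - 2) > 0"
    unfolding factor by (simp add: power2_eq_square power3_eq_cube)
  then show "1.8019 < p" using pos[of "1.8019"] by (simp add: zero_less_mult_iff)
  have "(p - 1.8020) * (p\<^sup>2 + p * 1.8020 + 1.8020\<^sup>2 - p - 1.8020 - 2) < 0"
    unfolding factor by (simp add: power2_eq_square power3_eq_cube)
  then show "p < 1.8020" using pos[of "1.8020"] by (simp add: mult_less_0_iff)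
qed

lemma cos_sin_ratio:
  "\<bar>cos (pi / 7) / sin (pi / 14) - 4.05\<bar> < 0.005"
proof -
  define p where "p = 2 * cos (pi / 7)"
  define s where "s = 2 * sin (pi / 14)"
  note c = cos_pi_7_cubic[folded p_def s_def]
  have "1.8019 * 1.8019 \<le> p * p" by (rule mult_mono) (use c(3) in auto)
  moreover have "p * p \<le> 1.8020 * 1.8020" by (rule mult_mono) (use c(3,4) in auto)
  ultimately have s: "0.4448 < s" "s < 0.44531"
    using c(2,3,4) by (simp_all add: power2_eq_square)
  have "cos (pi / 7) / sin (pi / 14) = p / s" unfolding p_def s_def by simp
  moreover have "4.045 < p / s" using s c(3) by (simp add: field_simps)
  moreover have "p / s < 4.055" using s c(4) by (simp add: field_simps)
  moreover have "\<bar>r - 4.05\<bar> < 0.005" if "4.045 < r" "r < 4.055" for r :: real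
    unfolding abs_less_iff using that by simp
  ultimately show ?thesis by simp
qed

section \<open>Completing squares for the two matrices\<close>

lemma weighted_square: "k > 0 \<Longrightarrow> k * (a - b / k)\<^sup>2 = k * a\<^sup>2 - 2 * a * b + b\<^sup>2 / (k :: real)"
  by (simp add: power2_diff power_divide right_diff_distrib distrib_left) (simp add: power2_eq_square)

text \<open>Positive semidefiniteness of \<open>p - J\<close>: completing squares with the pivots
  \<open>p - 1\<close> at \<open>a\<close> and \<open>p\<close> at \<open>g\<close> leaves
  \<open>p - 1 / (p - 1) - 1 / p\<close> as the coefficient of the square of \<open>b\<close>, and
  this is 0 by the cubic. The variable \<open>h\<close> belongs to the identity block.\<close>

lemma path_form_bound:
  fixes a b g h p :: real
  assumes p: "p ^ 3 - p ^ 2 - 2 * p + 1 = 0" "p > 1"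
  shows "a\<^sup>2 + 2 * a * b + 2 * b * g + h\<^sup>2 \<le> p * (a\<^sup>2 + b\<^sup>2 + g\<^sup>2 + h\<^sup>2)"
proof -
  have p0: "p - 1 > 0" "p > 0" using p(2) by auto
  have "1 / (p - 1) + 1 / p = p"
  proof -
    have "p + (p - 1) = p * (p * (p - 1))"
      using p(1) by (simp add: algebra_simps power2_eq_square power3_eq_cube)
    then show ?thesis using p0 by (simp add: field_simps)
  qed
  then have "p * b\<^sup>2 = b\<^sup>2 / (p - 1) + b\<^sup>2 / p"
    by (metis distrib_right mult.left_neutral times_divide_eq_left)
  moreover have "0 \<le> (p - 1) * (a - b / (p - 1))\<^sup>2 + p * (g - b / p)\<^sup>2" using p0 by simp
  moreover have "(p - 1) * (a - b / (p - 1))\<^sup>2 = (p - 1) * a\<^sup>2 - 2 * a * b + b\<^sup>2 / (p - 1)"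
    by (rule weighted_square[OF p0(1)])
  moreover have "p * (g - b / p)\<^sup>2 = p * g\<^sup>2 - 2 * g * b + b\<^sup>2 / p"
    by (rule weighted_square[OF p0(2)])
  moreover have "h\<^sup>2 \<le> p * h\<^sup>2" using p(2) by (simp add: mult_le_cancel_right1)
  ultimately show ?thesis by (simp add: algebra_simps)
qed

text \<open>The same elimination for the second matrix: the pivots \<open>m - 1\<close> and
  \<open>m\<close> leave \<open>m - 1 - 1 / (m - 1) - 1 / m\<close>, again 0 by the cubic.\<close>

lemma inverse_form_bound:
  fixes a b c m :: real
  assumes m: "m ^ 3 - 2 * m ^ 2 - m + 1 = 0" "m > 1"
  shows "a\<^sup>2 + 2 * c * (a + b) + c\<^sup>2 \<le> m * (a\<^sup>2 + b\<^sup>2 + c\<^sup>2)"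
proof -
  have m0: "m - 1 > 0" "m > 0" using m(2) by auto
  have "1 / (m - 1) + 1 / m = m - 1"
  proof -
    have "m + (m - 1) = (m - 1) * (m * (m - 1))"
      using m(1) by (simp add: algebra_simps power2_eq_square power3_eq_cube)
    then show ?thesis using m0 by (simp add: field_simps)
  qed
  then have "(m - 1) * c\<^sup>2 = c\<^sup>2 / (m - 1) + c\<^sup>2 / m"
    by (metis distrib_right mult.left_neutral times_divide_eq_left)
  moreover have "0 \<le> (m - 1) * (a - c / (m - 1))\<^sup>2 + m * (b - c / m)\<^sup>2" using m0 by simp
  moreover have "(m - 1) * (a - c / (m - 1))\<^sup>2 = (m - 1) * a\<^sup>2 - 2 * a * c + c\<^sup>2 / (m - 1)"
    by (rule weighted_square[OF m0(1)])
  moreover have "m * (b - c / m)\<^sup>2 = m * b\<^sup>2 - 2 * b * c + c\<^sup>2 / m"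
    by (rule weighted_square[OF m0(2)])
  ultimately show ?thesis by (simp add: algebra_simps)
qed

lemma inverse_form_lower_bound:
  fixes a b m :: real
  assumes "m \<ge> 2"
  shows "2 * a * b + b\<^sup>2 \<le> m * (a\<^sup>2 + b\<^sup>2)"
proof -
  have "2 * a * b \<le> a\<^sup>2 + b\<^sup>2" by (rule sum_squares_bound)
  then have "2 * a * b + b\<^sup>2 \<le> 2 * (a\<^sup>2 + b\<^sup>2)" using zero_le_power2[of a]
    unfolding distrib_left by linarith
  also have "\<dots> \<le> m * (a\<^sup>2 + b\<^sup>2)" using assms by (intro mult_right_mono) auto
  finally show ?thesis .
qed

section \<open>The optimality system in a Hilbert space and its solvability\<close>

text \<open>\<open>H\<close> stands for the heat operator and \<open>Q\<close> for the restriction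
  to the observation set. \<open>Y\<close> carries no topology of its own: its norm is the norm of
  \<open>H y\<close>, so that its completeness is expressed by \<open>H_inj\<close> and
  \<open>complete_H\<close>.\<close>

locale optimality_system =
  fixes Y :: "'v::real_vector set" and U :: "'u::real_inner set"
    and H :: "'v \<Rightarrow> 'u" and Q :: "'v \<Rightarrow> 'w::real_inner" and \<alpha> c :: real
  assumes Y: "subspace Y" and U: "subspace U" and complete_U: "complete U"
    and H_add: "\<And>x y. x \<in> Y \<Longrightarrow> y \<in> Y \<Longrightarrow> H (x + y) = H x + H y"
    and H_scale: "\<And>r x. x \<in> Y \<Longrightarrow> H (r *\<^sub>R x) = r *\<^sub>R H x"
    and H_mem: "\<And>x. x \<in> Y \<Longrightarrow> H x \<in> U"
    and Q_add: "\<And>x y. x \<in> Y \<Longrightarrow> y \<in> Y \<Longrightarrow> Q (x + y) = Q x + Q y"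
    and Q_scale: "\<And>r x. x \<in> Y \<Longrightarrow> Q (r *\<^sub>R x) = r *\<^sub>R Q x"
    and Q_bound: "\<And>x. x \<in> Y \<Longrightarrow> norm (Q x) \<le> c * norm (H x)"
    and H_inj: "\<And>x. x \<in> Y \<Longrightarrow> H x = 0 \<Longrightarrow> x = 0"
    and complete_H: "complete (H ` Y)"
    and \<alpha>: "\<alpha> > 0"
begin

text \<open>Embeds \<open>Y\<close> isometrically, for the inner product of the first block of
  \<open>B_0\<close>, into a product of inner product spaces. The Riesz theorem for complete
  subspaces then applies to the image.\<close>

definition E :: "'v \<Rightarrow> 'u \<times> 'w" where "E y = (sqrt \<alpha> *\<^sub>R H y, Q y)"

definition X :: "('v \<times> 'u \<times> 'u) set" where "X = Y \<times> U \<times> U"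

definition a_form :: "'v \<times> 'u \<times> 'u \<Rightarrow> 'v \<times> 'u \<times> 'u \<Rightarrow> real" where
  "a_form = (\<lambda>(y, u, l) (y', u', l'). inner (Q y) (Q y') + inner l (H y') + \<alpha> * inner u u' + inner l u'
     + inner (H y) l' + inner u l')"

definition b_form :: "'v \<times> 'u \<times> 'u \<Rightarrow> 'v \<times> 'u \<times> 'u \<Rightarrow> real" where
  "b_form = (\<lambda>(y, u, l) (y', u', l'). inner (E y) (E y') + \<alpha> * inner u u' + inner l l' / \<alpha>)"

lemma inner_E: "inner (E y) (E z) = inner (Q y) (Q z) + \<alpha> * inner (H y) (H z)"
  using \<alpha> by (simp add: E_def inner_prod_def mult.assoc[symmetric])

lemma norm_E: "(norm (E y))\<^sup>2 = (norm (Q y))\<^sup>2 + \<alpha> * (norm (H y))\<^sup>2"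
  unfolding power2_norm_eq_inner by (rule inner_E)

lemma E_add: "x \<in> Y \<Longrightarrow> y \<in> Y \<Longrightarrow> E (x + y) = E x + E y"
  by (simp add: E_def H_add Q_add scaleR_add_right)

lemma E_scale: "x \<in> Y \<Longrightarrow> E (r *\<^sub>R x) = r *\<^sub>R E x"
  by (simp add: E_def H_scale Q_scale)

lemma H_diff: "x \<in> Y \<Longrightarrow> y \<in> Y \<Longrightarrow> H (x - y) = H x - H y"
  using H_add[of x "(-1) *\<^sub>R y"] H_scale[of y "-1"] subspace_scale[OF Y, of y "-1"] by simp

lemma Q_diff: "x \<in> Y \<Longrightarrow> y \<in> Y \<Longrightarrow> Q (x - y) = Q x - Q y"
  using Q_add[of x "(-1) *\<^sub>R y"] Q_scale[of y "-1"] subspace_scale[OF Y, of y "-1"] by simp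

lemma E_diff: "x \<in> Y \<Longrightarrow> y \<in> Y \<Longrightarrow> E (x - y) = E x - E y"
  by (simp add: E_def H_diff Q_diff scaleR_diff_right)

lemma norm_H_le_E: "sqrt \<alpha> * norm (H y) \<le> norm (E y)"
proof -
  have "(sqrt \<alpha> * norm (H y))\<^sup>2 \<le> (norm (E y))\<^sup>2"
    using \<alpha> by (simp add: norm_E power_mult_distrib)
  then show ?thesis by (rule power2_le_imp_le) simp
qed

lemma E_inj: "x \<in> Y \<Longrightarrow> y \<in> Y \<Longrightarrow> E x = E y \<Longrightarrow> x = y"
  using H_inj[of "x - y"] subspace_diff[OF Y, of x y] \<alpha> by (simp add: E_def H_diff)

lemma subspace_E: "subspace (E ` Y)"
proof (rule subspaceI)
  show "0 \<in> E ` Y"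
    using E_scale[of 0 0] subspace_0[OF Y] by (metis imageI scaleR_zero_left)
next
  fix x y assume "x \<in> E ` Y" "y \<in> E ` Y"
  then show "x + y \<in> E ` Y"
    by (auto simp: subspace_add[OF Y] simp flip: E_add)
next
  fix r x assume "x \<in> E ` Y"
  then show "r *\<^sub>R x \<in> E ` Y"
    by (auto simp: subspace_scale[OF Y] simp flip: E_scale)
qed

text \<open>The first component controls the second: it converges within the range of
  \<open>H\<close> by \<open>complete_H\<close>, and \<open>Q_bound\<close> transfers the
  convergence to \<open>Q\<close>.\<close>

lemma complete_E: "complete (E ` Y)"
  unfolding complete_def
proof safe
  fix s assume s: "\<forall>n. s n \<in> E ` Y" "Cauchy s"
  then have "\<exists>y\<in>Y. s n = E y" for n by blast
  then obtain y where y: "\<And>n. y n \<in> Y" "\<And>n. s n = E (y n)" by metis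
  have "Cauchy (\<lambda>n. H (y n))"
  proof (rule metric_CauchyI)
    fix e :: real assume "e > 0"
    then have "sqrt \<alpha> * e > 0" using \<alpha> by simp
    then obtain N where N: "\<And>m n. m \<ge> N \<Longrightarrow> n \<ge> N \<Longrightarrow> dist (s m) (s n) < sqrt \<alpha> * e"
      using s(2) unfolding Cauchy_def by metis
    have "norm (H (y m) - H (y n)) < e" if "m \<ge> N" "n \<ge> N" for m n
    proof -
      have "sqrt \<alpha> * norm (H (y m) - H (y n)) \<le> norm (s m - s n)"
        using norm_H_le_E[of "y m - y n"] by (simp add: y H_diff E_diff)
      then have "sqrt \<alpha> * norm (H (y m) - H (y n)) < sqrt \<alpha> * e"
        using N[OF that] by (simp add: dist_norm)
      then show ?thesis using \<alpha> by simp
    qed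
    then show "\<exists>N. \<forall>m\<ge>N. \<forall>n\<ge>N. dist (H (y m)) (H (y n)) < e" unfolding dist_norm by blast
  qed
  then obtain z where z: "z \<in> Y" "(\<lambda>n. H (y n)) \<longlonglongrightarrow> H z"
  proof -
    have "\<forall>n. H (y n) \<in> H ` Y" using y(1) by blast
    with \<open>Cauchy (\<lambda>n. H (y n))\<close> have "\<exists>w\<in>H ` Y. (\<lambda>n. H (y n)) \<longlonglongrightarrow> w"
      using complete_H[unfolded complete_def, rule_format, of "\<lambda>n. H (y n)"] by simp
    then show ?thesis using that by blast
  qed
  have "(\<lambda>n. Q (y n)) \<longlonglongrightarrow> Q z"
  proof -
    have "norm (Q (y n) - Q z) \<le> c * norm (H (y n) - H z)" for n
      using Q_bound[of "y n - z"] z(1) y(1) by (simp add: Q_diff H_diff subspace_diff[OF Y])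
    moreover have "(\<lambda>n. c * norm (H (y n) - H z)) \<longlonglongrightarrow> 0"
      using tendsto_mult[OF tendsto_const[of c] tendsto_norm_zero[OF LIM_zero[OF z(2)]]] by simp
    ultimately have "(\<lambda>n. Q (y n) - Q z) \<longlonglongrightarrow> 0"
      by (intro Lim_null_comparison[of "\<lambda>n. Q (y n) - Q z" "\<lambda>n. c * norm (H (y n) - H z)"]) auto
    then show ?thesis by (rule LIM_zero_cancel)
  qed
  then have "s \<longlonglongrightarrow> E z"
    unfolding y(2) E_def by (intro tendsto_Pair tendsto_scaleR tendsto_const z(2))
  then show "\<exists>l\<in>E ` Y. s \<longlonglongrightarrow> l" using z(1) by blast
qed

lemma riesz_Y:
  assumes add: "\<And>x y. x \<in> Y \<Longrightarrow> y \<in> Y \<Longrightarrow> f (x + y) = f x + f y"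
    and scale: "\<And>r x. x \<in> Y \<Longrightarrow> f (r *\<^sub>R x) = r * f x"
    and bound: "\<And>x. x \<in> Y \<Longrightarrow> \<bar>f x\<bar> \<le> C * norm (H x)"
  obtains y where "y \<in> Y" "\<And>z. z \<in> Y \<Longrightarrow> inner (E y) (E z) = f z"
proof -
  define g where "g = (\<lambda>e. f (the_inv_into Y E e))"
  have inj: "inj_on E Y" by (rule inj_onI) (rule E_inj)
  have g: "g (E z) = f z" if "z \<in> Y" for z
    unfolding g_def by (simp add: the_inv_into_f_f[OF inj that])
  have bnd: "\<bar>f z\<bar> \<le> (\<bar>C\<bar> / sqrt \<alpha>) * norm (E z)" if "z \<in> Y" for z
  proof -
    have "\<bar>f z\<bar> \<le> \<bar>C\<bar> * norm (H z)"
      using bound[OF that] mult_right_mono[OF abs_ge_self norm_ge_zero, of C "H z"] by linarith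
    also have "\<dots> = (\<bar>C\<bar> / sqrt \<alpha>) * (sqrt \<alpha> * norm (H z))" using \<alpha> by simp
    also have "\<dots> \<le> (\<bar>C\<bar> / sqrt \<alpha>) * norm (E z)"
      using \<alpha> by (intro mult_left_mono norm_H_le_E) auto
    finally show ?thesis .
  qed
  obtain r where r: "r \<in> E ` Y" "\<And>e. e \<in> E ` Y \<Longrightarrow> g e = inner r e"
  proof (rule riesz_representation[OF subspace_E complete_E, of g "\<bar>C\<bar> / sqrt \<alpha>"])
    show "g (x + y) = g x + g y" if "x \<in> E ` Y" "y \<in> E ` Y" for x y
      using that by (auto simp: g add subspace_add[OF Y] simp flip: E_add)
    show "g (k *\<^sub>R x) = k * g x" if "x \<in> E ` Y" for k x
      using that by (auto simp: g scale subspace_scale[OF Y] simp flip: E_scale)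
    show "\<bar>g x\<bar> \<le> \<bar>C\<bar> / sqrt \<alpha> * norm x" if "x \<in> E ` Y" for x
      using that bnd by (auto simp: g)
  qed blast
  then obtain y where "y \<in> Y" "r = E y" by blast
  with r(2) g show ?thesis by (intro that[of y]) auto
qed

lemma E_eqI:
  assumes "x \<in> Y" "y \<in> Y" "\<And>z. z \<in> Y \<Longrightarrow> inner (E x) (E z) = inner (E y) (E z)"
  shows "x = y"
proof -
  have "inner (E x - E y) (E (x - y)) = 0"
    using assms(3)[of "x - y"] subspace_diff[OF Y assms(1,2)] by (simp add: inner_diff_left)
  then have "E x = E y" using assms by (simp add: E_diff)
  then show ?thesis using E_inj assms by blast
qed

lemma U_eqI:
  assumes "u \<in> U" "v \<in> U" "\<And>w. w \<in> U \<Longrightarrow> inner u w = inner v w"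
  shows "u = v"
  using assms(3)[of "u - v"] subspace_diff[OF U assms(1,2)]
  by (metis inner_diff_left inner_eq_zero_iff right_minus_eq)

text \<open>The right-hand sides are general because the lemma serves twice, for the optimality
  system itself and for the surjectivity of the preconditioned operator. The third row determines
  \<open>u\<close> and the second \<open>l\<close>; what remains of the first is a Riesz problem on
  \<open>Y\<close>.\<close>

lemma solve:
  assumes f: "\<And>x y. x \<in> Y \<Longrightarrow> y \<in> Y \<Longrightarrow> f (x + y) = f x + f y"
    "\<And>r x. x \<in> Y \<Longrightarrow> f (r *\<^sub>R x) = r * f x" "\<And>x. x \<in> Y \<Longrightarrow> \<bar>f x\<bar> \<le> C * norm (H x)"
    and d: "d \<in> U" "e \<in> U"
  shows "\<exists>!x. x \<in> X \<and> (\<forall>(y', u', l')\<in>X. a_form x (y', u', l') = f y' + inner d u' + inner e l')"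
proof -
  have iff: "(\<forall>(y', u', l')\<in>X. a_form (y, u, l) (y', u', l') = f y' + inner d u' + inner e l')
      \<longleftrightarrow> u = e - H y \<and> l = d - \<alpha> *\<^sub>R e + \<alpha> *\<^sub>R H y
        \<and> (\<forall>z\<in>Y. inner (E y) (E z) = f z - inner (d - \<alpha> *\<^sub>R e) (H z))"
    (is "?L \<longleftrightarrow> ?R") if x: "y \<in> Y" "u \<in> U" "l \<in> U" for y u l
  proof
    assume ?L
    then have L: "a_form (y, u, l) (y', u', l') = f y' + inner d u' + inner e l'"
      if "y' \<in> Y" "u' \<in> U" "l' \<in> U" for y' u' l'
      using that by (auto simp: X_def)
    have Y0: "0 \<in> Y" "H 0 = 0" "Q 0 = 0" "f 0 = 0" and U0: "0 \<in> U"
      using subspace_0[OF Y] subspace_0[OF U] H_scale[of 0 0] Q_scale[of 0 0] f(2)[of 0 0] by auto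
    have "H y + u = e"
    proof (rule U_eqI)
      show "H y + u \<in> U" using subspace_add[OF U] H_mem x by blast
      show "inner (H y + u) w = inner e w" if "w \<in> U" for w
        using L[OF Y0(1) U0 that] by (simp add: a_form_def Y0 inner_add_left)
    qed (rule d)
    moreover have "\<alpha> *\<^sub>R u + l = d"
    proof (rule U_eqI)
      show "\<alpha> *\<^sub>R u + l \<in> U" using subspace_add[OF U] subspace_scale[OF U] x by blast
      show "inner (\<alpha> *\<^sub>R u + l) w = inner d w" if "w \<in> U" for w
        using L[OF Y0(1) that U0] by (simp add: a_form_def Y0 inner_add_left)
    qed (rule d)
    ultimately have ul: "u = e - H y" "l = d - \<alpha> *\<^sub>R e + \<alpha> *\<^sub>R H y"
      by (auto simp: algebra_simps)
    moreover have "inner (E y) (E z) = f z - inner (d - \<alpha> *\<^sub>R e) (H z)" if "z \<in> Y" for z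
    proof -
      have "inner (Q y) (Q z) + inner l (H z) = f z"
        using L[OF that U0 U0] by (simp add: a_form_def)
      then show ?thesis unfolding inner_E ul by (simp add: inner_add_left inner_diff_left)
    qed
    ultimately show ?R by blast
  next
    assume R: ?R
    show ?L
      unfolding X_def
    proof (clarify)
      fix y' u' l' assume "y' \<in> Y" "u' \<in> U" "l' \<in> U"
      with R have "inner (E y) (E y') = f y' - inner (d - \<alpha> *\<^sub>R e) (H y')" by blast
      moreover have ul: "u = e - H y" "l = d - \<alpha> *\<^sub>R e + \<alpha> *\<^sub>R H y" using R by blast+
      ultimately show "a_form (y, u, l) (y', u', l') = f y' + inner d u' + inner e l'"
        unfolding inner_E a_form_def prod.case ul
        by (simp add: inner_add_left inner_diff_left right_diff_distrib)
    qed
  qed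
  obtain y where y: "y \<in> Y" "\<And>z. z \<in> Y \<Longrightarrow> inner (E y) (E z) = f z - inner (d - \<alpha> *\<^sub>R e) (H z)"
  proof (rule riesz_Y[of "\<lambda>z. f z - inner (d - \<alpha> *\<^sub>R e) (H z)" "C + norm (d - \<alpha> *\<^sub>R e)"])
    fix x assume "x \<in> Y"
    then have "\<bar>f x\<bar> \<le> C * norm (H x)" by (rule f)
    moreover have "\<bar>inner (d - \<alpha> *\<^sub>R e) (H x)\<bar> \<le> norm (d - \<alpha> *\<^sub>R e) * norm (H x)" by (rule Cauchy_Schwarz_ineq2)
    ultimately show "\<bar>f x - inner (d - \<alpha> *\<^sub>R e) (H x)\<bar> \<le> (C + norm (d - \<alpha> *\<^sub>R e)) * norm (H x)"
      by (simp add: distrib_right)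
  qed (auto simp: f H_add H_scale inner_add_right algebra_simps)
  show ?thesis
  proof (rule ex1I[of _ "(y, e - H y, d - \<alpha> *\<^sub>R e + \<alpha> *\<^sub>R H y)"])
    have "e - H y \<in> U" "d - \<alpha> *\<^sub>R e + \<alpha> *\<^sub>R H y \<in> U"
      using d y(1) H_mem by (auto intro!: subspace_diff[OF U] subspace_add[OF U] subspace_scale[OF U])
    then show "(y, e - H y, d - \<alpha> *\<^sub>R e + \<alpha> *\<^sub>R H y) \<in> X \<and>
        (\<forall>(y', u', l')\<in>X. a_form (y, e - H y, d - \<alpha> *\<^sub>R e + \<alpha> *\<^sub>R H y) (y', u', l') = f y' + inner d u' + inner e l')"
      using iff[of y "e - H y" "d - \<alpha> *\<^sub>R e + \<alpha> *\<^sub>R H y"] y by (simp add: X_def)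
  next
    fix x assume x: "x \<in> X \<and> (\<forall>(y', u', l')\<in>X. a_form x (y', u', l') = f y' + inner d u' + inner e l')"
    obtain y2 u2 l2 where xe: "x = (y2, u2, l2)" by (cases x)
    then have "y2 \<in> Y" "u2 \<in> U" "l2 \<in> U" using x by (auto simp: X_def)
    moreover from this have R: "u2 = e - H y2" "l2 = d - \<alpha> *\<^sub>R e + \<alpha> *\<^sub>R H y2"
      "\<forall>z\<in>Y. inner (E y2) (E z) = f z - inner (d - \<alpha> *\<^sub>R e) (H z)"
      using iff[of y2 u2 l2] x unfolding xe by blast+
    ultimately have "y2 = y" using y by (intro E_eqI) auto
    with R show "x = (y, e - H y, d - \<alpha> *\<^sub>R e + \<alpha> *\<^sub>R H y)" unfolding xe by simp
  qed
qed

section \<open>The bilinear forms on the product space\<close>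

lemma subspace_X: "subspace X"
  unfolding X_def by (intro subspace_Times Y U)

lemma b_form_nonneg: "b_form x x \<ge> 0"
  using \<alpha> by (cases x) (auto simp: b_form_def)

lemma a_form_sym: "a_form x x' = a_form x' x"
  by (cases x; cases x') (simp add: a_form_def inner_commute)

lemma b_form_sym: "b_form x x' = b_form x' x"
  by (cases x; cases x') (simp add: b_form_def inner_commute)

lemma a_form_add: "x \<in> X \<Longrightarrow> x' \<in> X \<Longrightarrow> a_form (x + x') z = a_form x z + a_form x' z"
  by (cases x; cases x'; cases z) (simp add: a_form_def X_def H_add Q_add inner_add_left algebra_simps)

lemma b_form_add: "x \<in> X \<Longrightarrow> x' \<in> X \<Longrightarrow> b_form (x + x') z = b_form x z + b_form x' z"
  by (cases x; cases x'; cases z) (simp add: b_form_def X_def E_add inner_add_left algebra_simps add_divide_distrib)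

lemma a_form_scale: "x \<in> X \<Longrightarrow> a_form (r *\<^sub>R x) z = r * a_form x z"
  by (cases x; cases z) (simp add: a_form_def X_def H_scale Q_scale algebra_simps)

lemma b_form_scale: "x \<in> X \<Longrightarrow> b_form (r *\<^sub>R x) z = r * b_form x z"
  by (cases x; cases z) (simp add: b_form_def X_def E_scale algebra_simps)

lemma a_form_diff: "x \<in> X \<Longrightarrow> x' \<in> X \<Longrightarrow> a_form (x - x') z = a_form x z - a_form x' z"
  using a_form_add[of x "(-1) *\<^sub>R x'" z] a_form_scale[of x' "-1" z] subspace_scale[OF subspace_X, of x' "-1"] by simp

lemma b_form_diff: "x \<in> X \<Longrightarrow> x' \<in> X \<Longrightarrow> b_form (x - x') z = b_form x z - b_form x' z"
  using b_form_add[of x "(-1) *\<^sub>R x'" z] b_form_scale[of x' "-1" z] subspace_scale[OF subspace_X, of x' "-1"] by simp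

lemma b_form_eq_0: "x \<in> X \<Longrightarrow> b_form x x = 0 \<Longrightarrow> x = 0"
proof -
  assume x: "x \<in> X" "b_form x x = 0"
  obtain y u l where yul: "x = (y, u, l)" by (cases x)
  then have "y \<in> Y" using x by (simp add: X_def)
  have "(norm (E y))\<^sup>2 + \<alpha> * (norm u)\<^sup>2 + (norm l)\<^sup>2 / \<alpha> = 0"
    using x(2) by (simp add: yul b_form_def power2_norm_eq_inner)
  moreover have "0 \<le> (norm (E y))\<^sup>2" "0 \<le> \<alpha> * (norm u)\<^sup>2" "0 \<le> (norm l)\<^sup>2 / \<alpha>" using \<alpha> by auto
  ultimately have "(norm (E y))\<^sup>2 = 0" "\<alpha> * (norm u)\<^sup>2 = 0" "(norm l)\<^sup>2 / \<alpha> = 0" by linarith+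
  then have "E y = 0" "u = 0" "l = 0" using \<alpha> by auto
  then have "y = 0" using H_inj[OF \<open>y \<in> Y\<close>] \<alpha> by (simp add: E_def zero_prod_def)
  with \<open>u = 0\<close> \<open>l = 0\<close> show "x = 0" by (simp add: yul zero_prod_def)
qed

lemma b_form_eqI:
  assumes "x \<in> X" "x' \<in> X" "\<And>z. z \<in> X \<Longrightarrow> b_form x z = b_form x' z"
  shows "x = x'"
proof -
  have "x - x' \<in> X" using assms subspace_diff[OF subspace_X] by blast
  then have "x - x' = 0"
    using assms(3)[of "x - x'"] assms(1,2) by (intro b_form_eq_0) (simp_all add: b_form_diff)
  then show ?thesis by simp
qed

text \<open>The form is block diagonal, so one Riesz representative per component suffices; the
  factors \<open>1 / \<alpha>\<close> and \<open>\<alpha>\<close> undo the weights of the last two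
  blocks.\<close>

lemma riesz_X:
  assumes add: "\<And>x y. x \<in> X \<Longrightarrow> y \<in> X \<Longrightarrow> f (x + y) = f x + f y"
    and scale: "\<And>r x. x \<in> X \<Longrightarrow> f (r *\<^sub>R x) = r * f x"
    and bound: "\<And>y u l. (y, u, l) \<in> X \<Longrightarrow> \<bar>f (y, u, l)\<bar> \<le> C * sqrt ((norm (H y))\<^sup>2 + (norm u)\<^sup>2 + (norm l)\<^sup>2)"
  obtains x where "x \<in> X" "\<And>z. z \<in> X \<Longrightarrow> b_form x z = f z"
proof -
  have 0: "0 \<in> Y" "0 \<in> U" "H 0 = 0"
    using subspace_0[OF Y] subspace_0[OF U] H_scale[of 0 0] by auto
  obtain y where y: "y \<in> Y" "\<And>z. z \<in> Y \<Longrightarrow> inner (E y) (E z) = f (z, 0, 0)"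
  proof (rule riesz_Y[of "\<lambda>z. f (z, 0, 0)" C])
    show "f (z + w, 0, 0) = f (z, 0, 0) + f (w, 0, 0)" if "z \<in> Y" "w \<in> Y" for z w
      using add[of "(z, 0, 0)" "(w, 0, 0)"] that 0 by (simp add: X_def)
    show "f (r *\<^sub>R z, 0, 0) = r * f (z, 0, 0)" if "z \<in> Y" for r z
      using scale[of "(z, 0, 0)" r] that 0 by (simp add: X_def)
    show "\<bar>f (z, 0, 0)\<bar> \<le> C * norm (H z)" if "z \<in> Y" for z
      using bound[of z 0 0] that 0 by (simp add: X_def)
  qed blast
  obtain u where u: "u \<in> U" "\<And>v. v \<in> U \<Longrightarrow> f (0, v, 0) = inner u v"
  proof (rule riesz_representation[OF U complete_U, of "\<lambda>v. f (0, v, 0)" C])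
    show "f (0, z + w, 0) = f (0, z, 0) + f (0, w, 0)" if "z \<in> U" "w \<in> U" for z w
      using add[of "(0, z, 0)" "(0, w, 0)"] that 0 by (simp add: X_def)
    show "f (0, r *\<^sub>R z, 0) = r * f (0, z, 0)" if "z \<in> U" for r z
      using scale[of "(0, z, 0)" r] that 0 by (simp add: X_def)
    show "\<bar>f (0, z, 0)\<bar> \<le> C * norm z" if "z \<in> U" for z
      using bound[of 0 z 0] that 0 by (simp add: X_def)
  qed blast
  obtain l where l: "l \<in> U" "\<And>v. v \<in> U \<Longrightarrow> f (0, 0, v) = inner l v"
  proof (rule riesz_representation[OF U complete_U, of "\<lambda>v. f (0, 0, v)" C])
    show "f (0, 0, z + w) = f (0, 0, z) + f (0, 0, w)" if "z \<in> U" "w \<in> U" for z w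
      using add[of "(0, 0, z)" "(0, 0, w)"] that 0 by (simp add: X_def)
    show "f (0, 0, r *\<^sub>R z) = r * f (0, 0, z)" if "z \<in> U" for r z
      using scale[of "(0, 0, z)" r] that 0 by (simp add: X_def)
    show "\<bar>f (0, 0, z)\<bar> \<le> C * norm z" if "z \<in> U" for z
      using bound[of 0 0 z] that 0 by (simp add: X_def)
  qed blast
  show ?thesis
  proof (rule that[of "(y, (1 / \<alpha>) *\<^sub>R u, \<alpha> *\<^sub>R l)"])
    show "(y, (1 / \<alpha>) *\<^sub>R u, \<alpha> *\<^sub>R l) \<in> X"
      using y(1) u(1) l(1) subspace_scale[OF U] by (simp add: X_def)
    fix z assume "z \<in> X"
    then obtain y' u' l' where z: "z = (y', u', l')" "y' \<in> Y" "u' \<in> U" "l' \<in> U" by (auto simp: X_def)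
    have "f z = f (y', 0, 0) + f (0, u', 0) + f (0, 0, l')"
      using add[of "(y', 0, 0)" "(0, u', 0)"] add[of "(y', u', 0)" "(0, 0, l')"] z 0 by (simp add: X_def)
    then show "b_form (y, (1 / \<alpha>) *\<^sub>R u, \<alpha> *\<^sub>R l) z = f z"
      using \<alpha> y(2)[OF z(2)] u(2)[OF z(3)] l(2)[OF z(4)] by (simp add: z(1) b_form_def)
  qed
qed

section \<open>Bounds on quadratic forms\<close>

text \<open>The weights on the four norms are chosen so that \<open>b_form x x\<close> is the sum of
  their squares while the products \<open>a * b\<close> and \<open>b * g\<close> are free of
  \<open>\<alpha>\<close>. Cauchy-Schwarz then reduces the claim to the scalar inequality for
  \<open>J\<close>.\<close>

lemma a_form_bound:
  fixes p :: real
  assumes p: "p ^ 3 - p ^ 2 - 2 * p + 1 = 0" "p > 1"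
  shows "\<bar>a_form x x\<bar> \<le> p * b_form x x"
proof -
  obtain y u l where x: "x = (y, u, l)" by (cases x)
  define a where "a = sqrt \<alpha> * norm u"
  define b where "b = norm l / sqrt \<alpha>"
  define g where "g = sqrt \<alpha> * norm (H y)"
  define h where "h = norm (Q y)"
  have sq: "a\<^sup>2 = \<alpha> * (norm u)\<^sup>2" "b\<^sup>2 = (norm l)\<^sup>2 / \<alpha>" "g\<^sup>2 = \<alpha> * (norm (H y))\<^sup>2"
    using \<alpha> by (simp_all add: a_def b_def g_def power_mult_distrib power_divide)
  have ab: "a * b = norm u * norm l" "b * g = norm l * norm (H y)"
    using \<alpha> by (simp_all add: a_def b_def g_def)
  have "\<bar>a_form x x\<bar> = \<bar>(norm (Q y))\<^sup>2 + 2 * inner l (H y) + \<alpha> * (norm u)\<^sup>2 + 2 * inner u l\<bar>"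
    unfolding x a_form_def power2_norm_eq_inner by (simp add: inner_commute[of l u] inner_commute[of "H y" l])
  also have "\<dots> \<le> (norm (Q y))\<^sup>2 + 2 * (norm l * norm (H y)) + \<alpha> * (norm u)\<^sup>2 + 2 * (norm u * norm l)"
  proof -
    have "0 \<le> (norm (Q y))\<^sup>2" "0 \<le> \<alpha> * (norm u)\<^sup>2" using \<alpha> by auto
    then show ?thesis
      using Cauchy_Schwarz_ineq2[of l "H y"] Cauchy_Schwarz_ineq2[of u l] by linarith
  qed
  also have "\<dots> = a\<^sup>2 + 2 * a * b + 2 * b * g + h\<^sup>2"
    using ab sq by (simp add: h_def mult.assoc)
  also have "\<dots> \<le> p * (a\<^sup>2 + b\<^sup>2 + g\<^sup>2 + h\<^sup>2)"
    by (rule path_form_bound[OF p])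
  also have "a\<^sup>2 + b\<^sup>2 + g\<^sup>2 + h\<^sup>2 = b_form x x"
    unfolding x b_form_def prod.case sq h_def inner_E power2_norm_eq_inner by simp
  finally show ?thesis .
qed

text \<open>Block elimination: with \<open>(z, v, m) = F x\<close>, \<open>d = Hy - l/\<alpha> = m/\<alpha> - v\<close> and \<open>y - z\<close> the
  representative of \<open>\<alpha> (d, H \<cdot>)\<close> in \<open>Y\<close>, the form \<open>a x x\<close> equals
  \<open>\<alpha> \<parallel>v\<parallel>^2 - \<alpha> \<parallel>d\<parallel>^2 + \<parallel>E y\<parallel>^2\<close>.\<close>

lemma a_form_inverse_bound:
  fixes r :: real
  assumes r: "r ^ 3 - 2 * r ^ 2 - r + 1 = 0" "r \<ge> 2"
    and x: "x \<in> X" and k: "k \<in> X" "\<And>z. z \<in> X \<Longrightarrow> b_form k z = a_form x z"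
  shows "\<bar>a_form x x\<bar> \<le> r * b_form k k"
proof -
  obtain y u l where xe: "x = (y, u, l)" by (cases x)
  obtain z v m where ke: "k = (z, v, m)" by (cases k)
  have xX: "y \<in> Y" "u \<in> U" "l \<in> U" using x by (auto simp: xe X_def)
  have kX: "z \<in> Y" "v \<in> U" "m \<in> U" using k(1) by (auto simp: ke X_def)
  have 0: "0 \<in> Y" "0 \<in> U" "H 0 = 0" "Q 0 = 0" "E 0 = 0"
    using subspace_0[OF Y] subspace_0[OF U] H_scale[of 0 0] Q_scale[of 0 0] E_scale[of 0 0] by auto
  have "\<alpha> *\<^sub>R v = \<alpha> *\<^sub>R u + l"
  proof (rule U_eqI)
    show "inner (\<alpha> *\<^sub>R v) w = inner (\<alpha> *\<^sub>R u + l) w" if "w \<in> U" for w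
      using k(2)[of "(0, w, 0)"] that 0 by (simp add: xe ke X_def a_form_def b_form_def inner_add_left)
  qed (use xX kX subspace_scale[OF U] subspace_add[OF U] in auto)
  then have v: "v = u + (1 / \<alpha>) *\<^sub>R l"
    using \<alpha> by (metis (no_types, lifting) scaleR_add_right scaleR_scaleR scaleR_one less_irrefl nonzero_eq_divide_eq)
  have m: "(1 / \<alpha>) *\<^sub>R m = H y + u"
  proof (rule U_eqI)
    show "inner ((1 / \<alpha>) *\<^sub>R m) w = inner (H y + u) w" if "w \<in> U" for w
      using k(2)[of "(0, 0, w)"] that 0 by (simp add: xe ke X_def a_form_def b_form_def inner_add_left)
  qed (use xX kX subspace_scale[OF U] subspace_add[OF U] H_mem in auto)
  define d where "d = H y - (1 / \<alpha>) *\<^sub>R l"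
  have d: "d = (1 / \<alpha>) *\<^sub>R m - v" unfolding d_def m v by simp
  have rep: "inner (E (y - z)) (E e) = \<alpha> * inner d (H e)" if "e \<in> Y" for e
  proof -
    have "inner (E z) (E e) = inner (Q y) (Q e) + inner l (H e)"
      using k(2)[of "(e, 0, 0)"] that 0 by (simp add: xe ke X_def a_form_def b_form_def)
    then show ?thesis
      unfolding E_diff[OF xX(1) kX(1)] inner_diff_left d_def using \<alpha> by (simp add: inner_E right_diff_distrib)
  qed
  define A where "A = sqrt \<alpha> * norm v"
  define B where "B = norm m / sqrt \<alpha>"
  define D where "D = sqrt \<alpha> * norm d"
  define C where "C = norm (E z)"
  have sq: "A\<^sup>2 = \<alpha> * (norm v)\<^sup>2" "B\<^sup>2 = (norm m)\<^sup>2 / \<alpha>" "D\<^sup>2 = \<alpha> * (norm d)\<^sup>2"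
    using \<alpha> by (simp_all add: A_def B_def D_def power_mult_distrib power_divide)
  have nn: "0 \<le> A" "0 \<le> B" "0 \<le> C" "0 \<le> D" using \<alpha> by (auto simp: A_def B_def C_def D_def)
  have bk: "b_form k k = A\<^sup>2 + B\<^sup>2 + C\<^sup>2"
    unfolding ke b_form_def prod.case sq C_def power2_norm_eq_inner by simp
  have ax: "a_form x x = A\<^sup>2 - D\<^sup>2 + (norm (E y))\<^sup>2"
    unfolding sq norm_E power2_norm_eq_inner v d_def xe a_form_def prod.case using \<alpha>
    by (simp add: inner_add_left inner_add_right inner_diff_left inner_diff_right inner_commute[of l u]
        inner_commute[of "H y" l] inner_E algebra_simps)
  have DAB: "D \<le> A + B"
  proof -
    have "norm d \<le> norm m / \<alpha> + norm v"
      unfolding d using norm_triangle_ineq4[of "(1 / \<alpha>) *\<^sub>R m" v] \<alpha> by simp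
    then have "D \<le> sqrt \<alpha> * (norm m / \<alpha> + norm v)"
      unfolding D_def using \<alpha> by (intro mult_left_mono) auto
    also have "sqrt \<alpha> * (norm m / \<alpha>) = B"
      unfolding B_def using \<alpha> by (simp add: real_div_sqrt field_simps)
    then have "sqrt \<alpha> * (norm m / \<alpha> + norm v) = A + B"
      unfolding A_def by (simp add: distrib_left)
    finally show ?thesis .
  qed
  have yz: "y - z \<in> Y" using subspace_diff[OF Y xX(1) kX(1)] .
  have "norm (E (y - z)) \<le> D"
  proof -
    have "(norm (E (y - z)))\<^sup>2 = \<alpha> * inner d (H (y - z))"
      using rep[OF yz] by (simp add: power2_norm_eq_inner)
    also have "\<dots> \<le> \<alpha> * (norm d * norm (H (y - z)))"
      using \<alpha> norm_cauchy_schwarz[of d "H (y - z)"] by simp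
    also have "\<dots> = D * (sqrt \<alpha> * norm (H (y - z)))" using \<alpha> by (simp add: D_def)
    also have "\<dots> \<le> D * norm (E (y - z))" by (rule mult_left_mono[OF norm_H_le_E nn(4)])
    finally show ?thesis
      by (cases "norm (E (y - z)) = 0") (auto simp: power2_eq_square nn)
  qed
  then have "norm (E y) \<le> C + D"
    using norm_triangle_ineq[of "E z" "E (y - z)"] unfolding C_def E_diff[OF xX(1) kX(1)] by simp
  then have "(norm (E y))\<^sup>2 \<le> (C + D)\<^sup>2" by (intro power_mono) auto
  \<comment> \<open>The square of \<open>D\<close> cancels, so \<open>D\<close> enters only linearly
    and may be replaced by its bound \<open>A + B\<close>.\<close>
  then have "a_form x x \<le> A\<^sup>2 + 2 * C * D + C\<^sup>2"
    unfolding ax by (simp add: power2_sum)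
  also have "\<dots> \<le> A\<^sup>2 + 2 * C * (A + B) + C\<^sup>2"
    using DAB nn(3) by (simp add: mult_left_mono)
  also have "\<dots> \<le> r * (A\<^sup>2 + B\<^sup>2 + C\<^sup>2)"
    by (rule inverse_form_bound) (use r in auto)
  finally have up: "a_form x x \<le> r * b_form k k" unfolding bk .
  have "- a_form x x \<le> D\<^sup>2 - A\<^sup>2" unfolding ax by simp
  also have "\<dots> \<le> (A + B)\<^sup>2 - A\<^sup>2" using DAB nn by (simp add: power_mono)
  also have "\<dots> = 2 * A * B + B\<^sup>2" by (simp add: power2_sum)
  also have "\<dots> \<le> r * (A\<^sup>2 + B\<^sup>2)" by (rule inverse_form_lower_bound[OF r(2)])
  also have "\<dots> \<le> r * (A\<^sup>2 + B\<^sup>2 + C\<^sup>2)" using r(2) by (intro mult_left_mono) auto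
  finally have "- a_form x x \<le> r * b_form k k" unfolding bk .
  with up show ?thesis by (simp add: abs_le_iff)
qed

section \<open>Norms of the preconditioned operator and of its inverse\<close>

context
  fixes F
  assumes F: "\<And>x. x \<in> X \<Longrightarrow> F x \<in> X" "\<And>x z. x \<in> X \<Longrightarrow> z \<in> X \<Longrightarrow> b_form (F x) z = a_form x z"
begin

lemma F_add: "x \<in> X \<Longrightarrow> y \<in> X \<Longrightarrow> F (x + y) = F x + F y"
  using subspace_add[OF subspace_X] by (intro b_form_eqI) (auto simp: F b_form_add a_form_add)

lemma F_diff: "x \<in> X \<Longrightarrow> y \<in> X \<Longrightarrow> F (x - y) = F x - F y"
  using subspace_diff[OF subspace_X] by (intro b_form_eqI) (auto simp: F b_form_diff a_form_diff)

text \<open>\<open>F x = k\<close> says that \<open>a_form x\<close> and \<open>b_form k\<close>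
  agree as functionals, which is an instance of the solved system with right-hand side read off from
  \<open>k\<close>.\<close>

lemma bij_F: "bij_betw F X X"
proof -
  have ex: "\<exists>!x. x \<in> X \<and> F x = k" if k: "k \<in> X" for k
  proof -
    obtain z v m where ke: "k = (z, v, m)" "z \<in> Y" "v \<in> U" "m \<in> U" using k by (auto simp: X_def)
    have "\<exists>!x. x \<in> X \<and> (\<forall>(y', u', l')\<in>X. a_form x (y', u', l')
        = inner (E z) (E y') + inner (\<alpha> *\<^sub>R v) u' + inner ((1 / \<alpha>) *\<^sub>R m) l')"
    proof (rule solve)
      fix e assume "e \<in> Y"
      have "norm (E e) \<le> norm (sqrt \<alpha> *\<^sub>R H e) + norm (Q e)"
        unfolding E_def by (rule norm_Pair_le)
      also have "\<dots> \<le> (sqrt \<alpha> + c) * norm (H e)"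
        using Q_bound[OF \<open>e \<in> Y\<close>] \<alpha> by (simp add: distrib_right)
      finally have "norm (E z) * norm (E e) \<le> norm (E z) * ((sqrt \<alpha> + c) * norm (H e))"
        by (rule mult_left_mono) simp
      then show "\<bar>inner (E z) (E e)\<bar> \<le> (norm (E z) * (sqrt \<alpha> + c)) * norm (H e)"
        using Cauchy_Schwarz_ineq2[of "E z" "E e"] by (simp add: mult.assoc)
    qed (use ke subspace_scale[OF U] in \<open>auto simp: E_add E_scale inner_add_right\<close>)
    moreover have "F x = k \<longleftrightarrow> (\<forall>(y', u', l')\<in>X. a_form x (y', u', l')
        = inner (E z) (E y') + inner (\<alpha> *\<^sub>R v) u' + inner ((1 / \<alpha>) *\<^sub>R m) l')" (is "_ \<longleftrightarrow> ?R") if "x \<in> X" for x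
    proof -
      have "?R \<longleftrightarrow> (\<forall>z\<in>X. b_form (F x) z = b_form k z)"
        using F(2)[OF that] by (auto simp: ke b_form_def)
      also have "\<dots> \<longleftrightarrow> F x = k" using b_form_eqI[OF F(1)[OF that] k] by auto
      finally show ?thesis by simp
    qed
    ultimately show ?thesis by (metis (no_types, lifting))
  qed
  show ?thesis
  proof (rule bij_betwI')
    show "(F x = F y) = (x = y)" if "x \<in> X" "y \<in> X" for x y using ex[OF F(1)[OF that(1)]] that by metis
    show "\<exists>x\<in>X. k = F x" if "k \<in> X" for k using ex[OF that] by metis
  qed (rule F(1))
qed

text \<open>Applied with \<open>G\<close> the identity for the norm of \<open>F\<close>, and with
  \<open>G = F\<close> for the norm of its inverse.\<close>

lemma parallelogram_form:
  assumes "\<And>x y. x \<in> X \<Longrightarrow> y \<in> X \<Longrightarrow> G (x + y) = G x + G y" "\<And>x y. x \<in> X \<Longrightarrow> y \<in> X \<Longrightarrow> G (x - y) = G x - G y"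
    and "\<And>x. x \<in> X \<Longrightarrow> G x \<in> X" "x \<in> X" "y \<in> X"
  shows "b_form (G (x + y)) (G (x + y)) + b_form (G (x - y)) (G (x - y)) = 2 * b_form (G x) (G x) + 2 * b_form (G y) (G y)"
  using assms subspace_add[OF subspace_X] subspace_diff[OF subspace_X]
    b_form_sym[of "G x" "G x + G y"] b_form_sym[of "G y" "G x + G y"] b_form_sym[of "G x" "G x - G y"] b_form_sym[of "G y" "G x - G y"]
  by (simp add: b_form_add b_form_diff)

lemma polarisation_form:
  assumes "x \<in> X" "y \<in> X"
  shows "a_form (x + y) (x + y) - a_form (x - y) (x - y) = 4 * a_form x y"
  using assms subspace_add[OF subspace_X] subspace_diff[OF subspace_X]
    a_form_sym[of x "x + y"] a_form_sym[of y "x + y"] a_form_sym[of x "x - y"] a_form_sym[of y "x - y"] a_form_sym[of y x]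
  by (simp add: a_form_add a_form_diff)

text \<open>Symmetry of \<open>a_form\<close> makes \<open>F\<close> self-adjoint for
  \<open>b_form\<close>, so the bound on the quadratic form is a bound on the operator.\<close>

lemma norm_F:
  fixes p :: real
  assumes p: "p ^ 3 - p ^ 2 - 2 * p + 1 = 0" "p > 1" and x: "x \<in> X"
  shows "b_form (F x) (F x) \<le> p\<^sup>2 * b_form x x"
proof -
  \<comment> \<open>With this scaling \<open>a_form x k\<close> and \<open>p * b_form k k\<close>
    are both the square norm of \<open>F x\<close> divided by \<open>p\<close>, so the latter is
    absorbed into the left-hand side.\<close>
  define k where "k = (1 / p) *\<^sub>R F x"
  have k: "k \<in> X" unfolding k_def by (rule subspace_scale[OF subspace_X F(1)[OF x]])
  have kk: "b_form k w = b_form (F x) w / p" for w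
    unfolding k_def by (simp add: b_form_scale F(1)[OF x])
  have "2 * a_form x k \<le> p * (b_form x x + b_form k k)"
  proof (rule polarised_bound[OF subspace_X polarisation_form _ _ x k])
    show "b_form (x + y) (x + y) + b_form (x - y) (x - y) = 2 * b_form x x + 2 * b_form y y"
      if "x \<in> X" "y \<in> X" for x y
      using parallelogram_form[of "\<lambda>x. x"] that by simp
  qed (auto intro: a_form_bound[OF p])
  also have "a_form x k = b_form (F x) (F x) / p"
    using F(2)[OF x k] kk[of "F x"] b_form_sym[of "F x" k] by simp
  also have "b_form k k = b_form (F x) (F x) / p\<^sup>2"
    using kk[of k] kk[of "F x"] b_form_sym[of "F x" k] by (simp add: power2_eq_square)
  finally have "2 * (b_form (F x) (F x) / p) \<le> p * b_form x x + b_form (F x) (F x) / p"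
    using p(2) by (simp add: distrib_left power2_eq_square)
  then have "b_form (F x) (F x) / p \<le> p * b_form x x" by simp
  then show ?thesis using p(2) by (simp add: divide_le_eq power2_eq_square mult_ac)
qed

text \<open>Viewed as a function of \<open>F x\<close>, the form \<open>a_form x x\<close> belongs
  to the inverse operator. The polarised bound is therefore used with the square norm of
  \<open>F x\<close>, and the second argument is the preimage of \<open>x / r\<close>.\<close>

lemma norm_F_inverse:
  fixes r :: real
  assumes r: "r ^ 3 - 2 * r ^ 2 - r + 1 = 0" "r \<ge> 2" and x: "x \<in> X"
  shows "b_form x x \<le> r\<^sup>2 * b_form (F x) (F x)"
proof -
  have "(1 / r) *\<^sub>R x \<in> X" by (rule subspace_scale[OF subspace_X x])
  then obtain k where k: "k \<in> X" "F k = (1 / r) *\<^sub>R x"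
    using bij_F unfolding bij_betw_def by (metis (no_types, lifting) imageE)
  have kk: "b_form (F k) w = b_form x w / r" for w
    unfolding k(2) by (simp add: b_form_scale x)
  have "2 * a_form x k \<le> r * (b_form (F x) (F x) + b_form (F k) (F k))"
  proof (rule polarised_bound[OF subspace_X polarisation_form _ _ x k(1)])
    show "b_form (F (x + y)) (F (x + y)) + b_form (F (x - y)) (F (x - y)) = 2 * b_form (F x) (F x) + 2 * b_form (F y) (F y)"
      if "x \<in> X" "y \<in> X" for x y
      using parallelogram_form[of F] F_add F_diff F(1) that by simp
    show "\<bar>a_form x x\<bar> \<le> r * b_form (F x) (F x)" if "x \<in> X" for x
      using a_form_inverse_bound[OF r that F(1)[OF that] F(2)[OF that]] .
  qed
  also have "a_form x k = b_form x x / r"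
    using F(2)[OF k(1) x] kk[of x] a_form_sym[of x k] by simp
  also have "b_form (F k) (F k) = b_form x x / r\<^sup>2"
    using kk[of "F k"] kk[of x] b_form_sym[of x "F k"] by (simp add: power2_eq_square)
  finally have "2 * (b_form x x / r) \<le> r * b_form (F x) (F x) + b_form x x / r"
    using r(2) by (simp add: distrib_left power2_eq_square)
  then have "b_form x x / r \<le> r * b_form (F x) (F x)" by simp
  then show ?thesis using r(2) by (simp add: divide_le_eq power2_eq_square mult_ac)
qed

end

end

subsection \<open>The parabolic optimality system\<close>

lemma cut_U_space:
  assumes "open \<Omega>" "u \<in> U_space \<Omega> T"
  shows "inner_on (cyl \<Omega> T) u v = inner u v" "inner_on (cyl \<Omega> T) v u = inner v u"
proof -
  have Q: "cyl \<Omega> T \<in> sets lebesgue"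
    by (rule sets_lebesgue_open[OF open_cyl[OF assms(1)]])
  have cu: "cut (cyl \<Omega> T) u = u" using assms(2) cut_eq_iff[OF Q] by blast
  show "inner_on (cyl \<Omega> T) u v = inner u v" "inner_on (cyl \<Omega> T) v u = inner v u"
    unfolding inner_on_eq_cut[OF Q] cu
    using inner_cut[OF Q, of u v] inner_cut[OF Q, of v u] cu by simp_all
qed

text \<open>\<open>M\<close> is the Riesz map of \<open>U\<close>, so the block
  \<open>L' M^-1 L\<close> of the preconditioner is the form \<open>inner (H y) (H z)\<close> of the
  heat operator.\<close>

lemma op_Minv_op_L:
  assumes "open \<Omega>" "y \<in> Y_space \<Omega> T"
  shows "op_Minv \<Omega> T (op_L \<kappa> \<Omega> T y) = heat \<kappa> \<Omega> T y"
proof -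
  let ?U = "U_space \<Omega> T"
  note hU = heat_in_U_space[OF assms, of \<kappa>]
  have "inj_on (op_M \<Omega> T) ?U"
  proof (rule inj_onI)
    fix u v assume uv: "u \<in> ?U" "v \<in> ?U" "op_M \<Omega> T u = op_M \<Omega> T v"
    have d: "u - v \<in> ?U" using uv subspace_diff[OF subspace_L2_on] by blast
    have "op_M \<Omega> T u (u - v) = op_M \<Omega> T v (u - v)" using uv(3) by simp
    then have "inner (u - v) (u - v) = 0"
      using d cut_U_space(1)[OF assms(1) uv(1)] cut_U_space(1)[OF assms(1) uv(2)]
      by (simp add: op_M_def restr_def inner_diff_left)
    then show "u = v" by simp
  qed
  moreover have "op_L \<kappa> \<Omega> T y = op_M \<Omega> T (heat \<kappa> \<Omega> T y)"
    by (simp add: op_L_def op_M_def)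
  ultimately show ?thesis unfolding op_Minv_def using hU by (simp add: the_inv_into_f_f)
qed

lemma op_norm_le:
  assumes "C \<ge> 0" "\<And>x. N x \<ge> 0" "\<And>x. x \<in> S \<Longrightarrow> N (F x) \<le> C * N x"
  shows "op_norm S N F \<le> ennreal C"
  unfolding op_norm_def
proof (rule SUP_least)
  fix x assume "x \<in> S - {0}"
  then have "N (F x) \<le> C * N x" using assms(3) by blast
  \<comment> \<open>Where \<open>N x\<close> vanishes, the quotient is 0 by convention.\<close>
  then have "N (F x) / N x \<le> C"
    using assms(1) assms(2)[of x] by (cases "N x = 0") (auto simp: divide_le_eq less_le)
  then show "ennreal (N (F x) / N x) \<le> ennreal C" by (rule ennreal_leI)
qed

theorem lemma1:
  fixes \<Omega> :: "(real ^ 'd) set" and T \<alpha> \<kappa> :: real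
    and q :: "(real \<times> (real ^ 'd)) set"
    and y\<^sub>d f :: "(real \<times> (real ^ 'd)) l2"
  assumes "CARD('d) \<in> {2, 3}"
    and "open \<Omega>" and "connected \<Omega>" and "\<Omega> \<noteq> {}" and "bounded \<Omega>" and "lipschitz_boundary \<Omega>"
    and "T > 0"
    and "q \<in> sets lebesgue" and "q \<subseteq> cyl \<Omega> T"
    and "\<alpha> > 0" and "\<kappa> > 0"
    and "y\<^sub>d \<in> L2_on q" and "f \<in> L2_on (cyl \<Omega> T)"
  shows "(\<exists>!(y, u, l).
            y \<in> Y_space \<Omega> T \<and> u \<in> U_space \<Omega> T \<and> l \<in> U_space \<Omega> T \<and>
            (\<forall>y'\<in>Y_space \<Omega> T. inner_on q y y' + inner_on (cyl \<Omega> T) l (heat \<kappa> \<Omega> T y')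
                = inner_on q y\<^sub>d y') \<and>
            (\<forall>u'\<in>U_space \<Omega> T. \<alpha> * inner_on (cyl \<Omega> T) u u' + inner_on (cyl \<Omega> T) l u' = 0) \<and>
            (\<forall>l'\<in>U_space \<Omega> T. inner_on (cyl \<Omega> T) (heat \<kappa> \<Omega> T y) l' + inner_on (cyl \<Omega> T) u l'
                = inner_on (cyl \<Omega> T) f l'))
       \<and> op_A \<alpha> \<kappa> \<Omega> T q \<in> X_space \<Omega> T \<rightarrow> X_dual \<kappa> \<Omega> T
       \<and> bij_betw (op_B0 \<alpha> \<kappa> \<Omega> T q) (X_space \<Omega> T) (X_dual \<kappa> \<Omega> T)
       \<and> cond_number (X_space \<Omega> T) (norm_B0 \<alpha> \<kappa> \<Omega> T q) (B0inv_A \<alpha> \<kappa> \<Omega> T q)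
           \<le> ennreal (cos (pi / 7) / sin (pi / 14))
       \<and> \<bar>cos (pi / 7) / sin (pi / 14) - 4.05\<bar> < 0.005"
proof -
  note \<Omega> = \<open>open \<Omega>\<close> and bnd = \<open>bounded \<Omega>\<close> and T = \<open>T > 0\<close> and q = \<open>q \<in> sets lebesgue\<close>
    and \<alpha> = \<open>\<alpha> > 0\<close> and \<kappa> = \<open>\<kappa> > 0\<close>
  let ?Y = "Y_space \<Omega> T" and ?U = "U_space \<Omega> T" and ?X = "X_space \<Omega> T" and ?H = "heat \<kappa> \<Omega> T"
  have Qs: "cyl \<Omega> T \<in> sets lebesgue"
    by (rule sets_lebesgue_open[OF open_cyl[OF \<Omega>]])
  have bound: "norm y \<le> T * norm (?H y)" if "y \<in> ?Y" for y
    by (rule norm_le_heat[OF \<Omega> bnd T \<kappa> that])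
  have Qbound: "norm (cut q y) \<le> T * norm (?H y)" if "y \<in> ?Y" for y
    using norm_cut_le[OF q, of y] bound[OF that] by simp
  \<comment> \<open>The last parameter is the observation constant: restriction to \<open>q\<close>
    does not increase the norm, and the norm of \<open>y\<close> is at most \<open>T\<close> times
    that of its heat image.\<close>
  interpret S: optimality_system ?Y ?U ?H "cut q" \<alpha> T
  proof
    show "subspace ?Y" by (rule subspace_Y_space[OF \<Omega> T])
    show "complete (?H ` ?Y)" by (rule complete_heat_range[OF \<Omega> bnd T \<kappa>])
    show "x = 0" if "x \<in> ?Y" "?H x = 0" for x using bound[OF that(1)] that(2) by simp
  qed (auto simp: subspace_L2_on complete_L2_on[OF Qs] heat_add[OF \<Omega>] heat_scaleR[OF \<Omega>] heat_in_U_space[OF \<Omega>]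
      linear_add[OF linear_cut[OF q]] linear_scale[OF linear_cut[OF q]] Qbound \<alpha>)
  have X: "S.X = ?X" unfolding S.X_def X_space_def ..
  have A: "op_A \<alpha> \<kappa> \<Omega> T q x x' = S.a_form x x'" if "x \<in> ?X" "x' \<in> ?X" for x x'
  proof -
    obtain y u l y' u' l' where x: "x = (y, u, l)" "x' = (y', u', l')" by (cases x, cases x')
    have m: "y \<in> ?Y" "u \<in> ?U" "l \<in> ?U" "y' \<in> ?Y" "u' \<in> ?U" "l' \<in> ?U" using that by (auto simp: x X_space_def)
    show ?thesis
      using that m heat_in_U_space[OF \<Omega> m(1), of \<kappa>] heat_in_U_space[OF \<Omega> m(4), of \<kappa>]
      unfolding x op_A_def S.a_form_def
      by (simp add: restr_def op_Mq_def op_L'_def op_L_def op_M_def inner_on_eq_cut[OF q]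
          cut_U_space[OF \<Omega>] inner_commute)
  qed
  have B: "op_B0 \<alpha> \<kappa> \<Omega> T q x x' = S.b_form x x'" if "x \<in> ?X" "x' \<in> ?X" for x x'
  proof -
    obtain y u l y' u' l' where x: "x = (y, u, l)" "x' = (y', u', l')" by (cases x, cases x')
    have m: "y \<in> ?Y" "u \<in> ?U" "l \<in> ?U" "y' \<in> ?Y" "u' \<in> ?U" "l' \<in> ?U" using that by (auto simp: x X_space_def)
    show ?thesis
      using that m heat_in_U_space[OF \<Omega> m(1), of \<kappa>] heat_in_U_space[OF \<Omega> m(4), of \<kappa>]
      unfolding x op_B0_def S.b_form_def
      by (simp add: restr_def op_Mq_def op_L'_def op_L_def[of _ _ _ y'] op_M_def inner_on_eq_cut[OF q]
          cut_U_space[OF \<Omega>] op_Minv_op_L[OF \<Omega>] S.inner_E inner_commute)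
  qed
  \<comment> \<open>Functionals are compared as functions on the whole type, so their value 0 off
    the product space is part of every equality below.\<close>
  have outside: "op_A \<alpha> \<kappa> \<Omega> T q x x' = 0" "op_B0 \<alpha> \<kappa> \<Omega> T q x x' = 0" if "x' \<notin> ?X" for x x'
    using that by (cases x; simp add: op_A_def op_B0_def restr_def)+
  have norm_X: "norm_X \<kappa> \<Omega> T (y, u, l) = sqrt ((norm (?H y))\<^sup>2 + (norm u)\<^sup>2 + (norm l)\<^sup>2)" for y u l
    by (simp add: norm_X_def norm_Y_def)
  have nX: "norm (?H y) \<le> norm_X \<kappa> \<Omega> T (y, u, l)" "norm u \<le> norm_X \<kappa> \<Omega> T (y, u, l)"
    "norm l \<le> norm_X \<kappa> \<Omega> T (y, u, l)" for y u l
    unfolding norm_X by (auto intro!: real_le_rsqrt)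
  have dualI: "g \<in> X_dual \<kappa> \<Omega> T"
    if g: "\<And>x x'. x \<in> ?X \<Longrightarrow> x' \<in> ?X \<Longrightarrow> g (x + x') = g x + g x'" "\<And>r x. x \<in> ?X \<Longrightarrow> g (r *\<^sub>R x) = r * g x"
      "\<And>x. x \<notin> ?X \<Longrightarrow> g x = 0"
      "\<And>y u l. (y, u, l) \<in> ?X \<Longrightarrow> \<bar>g (y, u, l)\<bar> \<le> a * norm (?H y) + b * norm u + c * norm l"
      and abc: "a \<ge> 0" "b \<ge> 0" "c \<ge> 0" for g a b c
  proof -
    have "\<bar>g x\<bar> \<le> (a + b + c) * norm_X \<kappa> \<Omega> T x" if "x \<in> ?X" for x
    proof -
      obtain y u l where x: "x = (y, u, l)" by (cases x)
      have "\<bar>g x\<bar> \<le> a * norm (?H y) + b * norm u + c * norm l" using g(4) that x by blast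
      also have "\<dots> \<le> a * norm_X \<kappa> \<Omega> T x + b * norm_X \<kappa> \<Omega> T x + c * norm_X \<kappa> \<Omega> T x"
        unfolding x using abc by (intro add_mono mult_left_mono nX)
      finally show ?thesis by (simp add: distrib_right)
    qed
    then show ?thesis using g unfolding X_dual_def dual_def by blast
  qed
  have A_dual: "op_A \<alpha> \<kappa> \<Omega> T q x \<in> X_dual \<kappa> \<Omega> T" if x: "x \<in> ?X" for x
  proof -
    obtain y u l where xe: "x = (y, u, l)" by (cases x)
    show ?thesis
    proof (rule dualI[of _ "norm (cut q y) * T + norm l" "\<alpha> * norm u + norm l" "norm (?H y) + norm u"])
      fix y' u' l' assume x': "(y', u', l') \<in> ?X"
      then have "y' \<in> ?Y" by (simp add: X_space_def)
      have "norm (cut q y) * norm (cut q y') \<le> norm (cut q y) * (T * norm (?H y'))"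
        by (rule mult_left_mono[OF Qbound[OF \<open>y' \<in> ?Y\<close>]]) simp
      moreover have "\<bar>\<alpha> * inner u u'\<bar> \<le> \<alpha> * (norm u * norm u')"
        using \<alpha> Cauchy_Schwarz_ineq2[of u u'] by (simp add: abs_mult)
      moreover note Cauchy_Schwarz_ineq2[of "cut q y" "cut q y'"] Cauchy_Schwarz_ineq2[of l "?H y'"]
        Cauchy_Schwarz_ineq2[of l u'] Cauchy_Schwarz_ineq2[of "?H y" l'] Cauchy_Schwarz_ineq2[of u l']
      ultimately have "\<bar>S.a_form x (y', u', l')\<bar> \<le> norm (cut q y) * (T * norm (?H y')) + norm l * norm (?H y')
          + \<alpha> * (norm u * norm u') + norm l * norm u' + norm (?H y) * norm l' + norm u * norm l'"
        unfolding xe S.a_form_def prod.case by linarith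
      then show "\<bar>op_A \<alpha> \<kappa> \<Omega> T q x (y', u', l')\<bar> \<le> (norm (cut q y) * T + norm l) * norm (?H y')
          + (\<alpha> * norm u + norm l) * norm u' + (norm (?H y) + norm u) * norm l'"
        unfolding A[OF x x'] by (simp add: algebra_simps)
    qed (use x T \<alpha> in \<open>simp_all add: A outside S.a_form_sym[of x] S.a_form_add S.a_form_scale X
        subspace_add[OF S.subspace_X, unfolded X] subspace_scale[OF S.subspace_X, unfolded X]\<close>)
  qed
  have B_dual: "op_B0 \<alpha> \<kappa> \<Omega> T q x \<in> X_dual \<kappa> \<Omega> T" if x: "x \<in> ?X" for x
  proof -
    obtain y u l where xe: "x = (y, u, l)" by (cases x)
    show ?thesis
    proof (rule dualI[of _ "norm (cut q y) * T + \<alpha> * norm (?H y)" "\<alpha> * norm u" "norm l / \<alpha>"])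
      fix y' u' l' assume x': "(y', u', l') \<in> ?X"
      then have "y' \<in> ?Y" by (simp add: X_space_def)
      have "norm (cut q y) * norm (cut q y') \<le> norm (cut q y) * (T * norm (?H y'))"
        by (rule mult_left_mono[OF Qbound[OF \<open>y' \<in> ?Y\<close>]]) simp
      moreover have "\<bar>\<alpha> * inner u u'\<bar> \<le> \<alpha> * (norm u * norm u')"
        "\<bar>\<alpha> * inner (?H y) (?H y')\<bar> \<le> \<alpha> * (norm (?H y) * norm (?H y'))"
        "\<bar>inner l l' / \<alpha>\<bar> \<le> norm l * norm l' / \<alpha>"
        using \<alpha> Cauchy_Schwarz_ineq2[of u u'] Cauchy_Schwarz_ineq2[of "?H y" "?H y'"] Cauchy_Schwarz_ineq2[of l l']
        by (simp_all add: abs_mult divide_right_mono)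
      moreover note Cauchy_Schwarz_ineq2[of "cut q y" "cut q y'"]
      ultimately have "\<bar>S.b_form x (y', u', l')\<bar> \<le> norm (cut q y) * (T * norm (?H y')) + \<alpha> * (norm (?H y) * norm (?H y'))
          + \<alpha> * (norm u * norm u') + norm l * norm l' / \<alpha>"
        unfolding xe S.b_form_def prod.case S.inner_E by linarith
      then show "\<bar>op_B0 \<alpha> \<kappa> \<Omega> T q x (y', u', l')\<bar> \<le> (norm (cut q y) * T + \<alpha> * norm (?H y)) * norm (?H y')
          + \<alpha> * norm u * norm u' + norm l / \<alpha> * norm l'"
        unfolding B[OF x x'] by (simp add: algebra_simps)
    qed (use x T \<alpha> in \<open>simp_all add: B outside S.b_form_sym[of x] S.b_form_add S.b_form_scale X
        subspace_add[OF S.subspace_X, unfolded X] subspace_scale[OF S.subspace_X, unfolded X]\<close>)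
  qed
  have B_bij: "bij_betw (op_B0 \<alpha> \<kappa> \<Omega> T q) ?X (X_dual \<kappa> \<Omega> T)"
  proof (rule bij_betwI')
    fix x x' assume x: "x \<in> ?X" "x' \<in> ?X"
    show "(op_B0 \<alpha> \<kappa> \<Omega> T q x = op_B0 \<alpha> \<kappa> \<Omega> T q x') = (x = x')"
    proof
      assume eq: "op_B0 \<alpha> \<kappa> \<Omega> T q x = op_B0 \<alpha> \<kappa> \<Omega> T q x'"
      show "x = x'"
        by (rule S.b_form_eqI; unfold X) (use x B eq in metis)+
    qed simp
  next
    fix g assume g: "g \<in> X_dual \<kappa> \<Omega> T"
    then obtain C where C: "\<And>x. x \<in> ?X \<Longrightarrow> \<bar>g x\<bar> \<le> C * norm_X \<kappa> \<Omega> T x"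
      unfolding X_dual_def dual_def by blast
    obtain x where x: "x \<in> ?X" "\<And>z. z \<in> ?X \<Longrightarrow> S.b_form x z = g z"
    proof (rule S.riesz_X[unfolded X, of g C])
      show "\<bar>g (y, u, l)\<bar> \<le> C * sqrt ((norm (?H y))\<^sup>2 + (norm u)\<^sup>2 + (norm l)\<^sup>2)" if "(y, u, l) \<in> ?X" for y u l
        using C[OF that] unfolding norm_X .
    qed (use g in \<open>auto simp: X_dual_def dual_def\<close>)
    have "g = op_B0 \<alpha> \<kappa> \<Omega> T q x"
    proof
      fix z
      have "g z = 0" if "z \<notin> ?X" using g that unfolding X_dual_def dual_def by blast
      then show "g z = op_B0 \<alpha> \<kappa> \<Omega> T q x z"
        using x(2)[of z] B[OF x(1), of z] outside(2)[of z x] by (cases "z \<in> ?X") simp_all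
    qed
    with x(1) show "\<exists>x\<in>?X. g = op_B0 \<alpha> \<kappa> \<Omega> T q x" by blast
  qed (rule B_dual)
  define F where "F = B0inv_A \<alpha> \<kappa> \<Omega> T q"
  have F: "F x \<in> ?X" "op_B0 \<alpha> \<kappa> \<Omega> T q (F x) = op_A \<alpha> \<kappa> \<Omega> T q x" if "x \<in> ?X" for x
  proof -
    have inj: "inj_on (op_B0 \<alpha> \<kappa> \<Omega> T q) ?X" and img: "op_A \<alpha> \<kappa> \<Omega> T q x \<in> op_B0 \<alpha> \<kappa> \<Omega> T q ` ?X"
      using B_bij A_dual[OF that] unfolding bij_betw_def by auto
    show "F x \<in> ?X" unfolding F_def B0inv_A_def by (rule the_inv_into_into[OF inj img order_refl])
    show "op_B0 \<alpha> \<kappa> \<Omega> T q (F x) = op_A \<alpha> \<kappa> \<Omega> T q x"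
      unfolding F_def B0inv_A_def by (rule f_the_inv_into_f[OF inj img])
  qed
  have Fb: "S.b_form (F x) z = S.a_form x z" if "x \<in> ?X" "z \<in> ?X" for x z
    using F[OF that(1)] A[OF that] B[OF F(1)[OF that(1)] that(2)] by simp
  note FX = F(1)[folded X] Fb[folded X]
  have bij: "bij_betw F ?X ?X" using S.bij_F[of F, OF FX] unfolding X .
  define p where "p = 2 * cos (pi / 7)"
  define s where "s = 2 * sin (pi / 14)"
  note c = cos_pi_7_cubic[folded p_def s_def]
  have s2: "s\<^sup>2 = 2 - p"
  proof -
    \<comment> \<open>This is the half-angle identity, here found by polynomial division of
      \<open>(p^2 - p - 1)^2\<close> by the cubic: the quotient is \<open>p - 1\<close> and the
      remainder \<open>2 - p\<close>.\<close>
    have "s\<^sup>2 = (p ^ 3 - p ^ 2 - 2 * p + 1) * (p - 1) + 2 - p"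
      unfolding c(2) by (simp add: algebra_simps power2_eq_square power3_eq_cube)
    then show ?thesis using c(1) by simp
  qed
  have s_pos: "s > 0" unfolding s_def by (simp add: sin_gt_zero pi_gt_zero)
  have s_half: "s \<le> 1 / 2"
  proof -
    have "s\<^sup>2 \<le> (1 / 2)\<^sup>2" unfolding s2 using c(3) by (simp add: power2_eq_square)
    then show ?thesis by (rule power2_le_imp_le) simp
  qed
  define r where "r = 1 / s"
  have r2: "r \<ge> 2" unfolding r_def using s_pos s_half by (simp add: field_simps)
  \<comment> \<open>\<open>s\<close> is another root of the cubic of \<open>p\<close>. Its
    reciprocal \<open>r\<close> is then a root of the polynomial with reversed coefficients, which
    is the one required for the inverse.\<close>
  have s3: "s ^ 3 - s\<^sup>2 - 2 * s + 1 = 0"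
  proof -
    have "s ^ 3 - s\<^sup>2 - 2 * s + 1 = (2 - p) * s - (2 - p) - 2 * s + 1"
      by (simp add: power3_eq_cube s2[symmetric] power2_eq_square)
    also have "\<dots> = - (p ^ 3 - p ^ 2 - 2 * p + 1)"
      unfolding c(2) by (simp add: algebra_simps power2_eq_square power3_eq_cube)
    finally show ?thesis using c(1) by simp
  qed
  have r3: "r ^ 3 - 2 * r ^ 2 - r + 1 = 0"
  proof -
    have "s ^ 3 * (r ^ 3 - 2 * r ^ 2 - r + 1) = s ^ 3 - s\<^sup>2 - 2 * s + 1"
      unfolding r_def using s_pos by (simp add: algebra_simps power2_eq_square power3_eq_cube)
    then show ?thesis using s3 s_pos by simp
  qed
  have nB: "norm_B0 \<alpha> \<kappa> \<Omega> T q x = sqrt (S.b_form x x)" if "x \<in> ?X" for x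
    unfolding norm_B0_def using B[OF that that] by simp
  have nB0: "norm_B0 \<alpha> \<kappa> \<Omega> T q x \<ge> 0" for x
    using S.b_form_nonneg B outside(2)[of x x] unfolding norm_B0_def by (cases "x \<in> ?X") auto
  have "op_norm ?X (norm_B0 \<alpha> \<kappa> \<Omega> T q) F \<le> ennreal p"
  proof (rule op_norm_le[OF _ nB0])
    fix x assume x: "x \<in> ?X"
    have "S.b_form (F x) (F x) \<le> p\<^sup>2 * S.b_form x x"
      by (rule S.norm_F[of F, OF FX c(1)]) (use c(3) x X in auto)
    then have "sqrt (S.b_form (F x) (F x)) \<le> sqrt (p\<^sup>2 * S.b_form x x)" by simp
    then show "norm_B0 \<alpha> \<kappa> \<Omega> T q (F x) \<le> p * norm_B0 \<alpha> \<kappa> \<Omega> T q x"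
      using c(3) by (simp add: nB[OF x] nB[OF F(1)[OF x]] real_sqrt_mult)
  qed (use c(3) in simp)
  moreover have "op_norm ?X (norm_B0 \<alpha> \<kappa> \<Omega> T q) (the_inv_into ?X F) \<le> ennreal r"
  proof (rule op_norm_le[OF _ nB0])
    fix k assume "k \<in> ?X"
    then obtain x where x: "x \<in> ?X" "k = F x" using bij unfolding bij_betw_def by blast
    then have inv: "the_inv_into ?X F k = x" using bij by (simp add: the_inv_into_f_f bij_betw_def)
    have "S.b_form x x \<le> r\<^sup>2 * S.b_form (F x) (F x)"
      by (rule S.norm_F_inverse[of F, OF FX r3 r2]) (use x X in auto)
    then have "sqrt (S.b_form x x) \<le> sqrt (r\<^sup>2 * S.b_form (F x) (F x))" by simp
    then show "norm_B0 \<alpha> \<kappa> \<Omega> T q (the_inv_into ?X F k) \<le> r * norm_B0 \<alpha> \<kappa> \<Omega> T q k"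
      unfolding inv unfolding x(2) using r2 by (simp add: nB[OF x(1)] nB[OF F(1)[OF x(1)]] real_sqrt_mult)
  qed (use r2 in simp)
  ultimately have "cond_number ?X (norm_B0 \<alpha> \<kappa> \<Omega> T q) F \<le> ennreal p * ennreal r"
    unfolding cond_number_def using bij by (simp add: mult_mono)
  also have "\<dots> = ennreal (p * r)" using c(3) r2 by (simp add: ennreal_mult)
  also have "p * r = cos (pi / 7) / sin (pi / 14)" by (simp add: p_def r_def s_def)
  finally have cond: "cond_number ?X (norm_B0 \<alpha> \<kappa> \<Omega> T q) (B0inv_A \<alpha> \<kappa> \<Omega> T q)
      \<le> ennreal (cos (pi / 7) / sin (pi / 14))"
    unfolding F_def .
  have fU: "f \<in> ?U" by fact
  have ex: "\<exists>!x. x \<in> ?X \<and> (\<forall>(y', u', l')\<in>?X. S.a_form x (y', u', l')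
      = inner (cut q y\<^sub>d) (cut q y') + inner 0 u' + inner f l')"
  proof (rule S.solve[unfolded X])
    show "\<bar>inner (cut q y\<^sub>d) (cut q y')\<bar> \<le> (norm (cut q y\<^sub>d) * T) * norm (?H y')" if "y' \<in> ?Y" for y'
      using Cauchy_Schwarz_ineq2[of "cut q y\<^sub>d" "cut q y'"] mult_left_mono[OF Qbound[OF that] norm_ge_zero[of "cut q y\<^sub>d"]]
      by (simp add: mult.assoc)
  qed (auto simp: linear_add[OF linear_cut[OF q]] linear_scale[OF linear_cut[OF q]] inner_add_right fU
      subspace_0[OF subspace_L2_on])
  have iff: "(case x of (y, u, l) \<Rightarrow> y \<in> ?Y \<and> u \<in> ?U \<and> l \<in> ?U \<and>
      (\<forall>y'\<in>?Y. inner_on q y y' + inner_on (cyl \<Omega> T) l (?H y') = inner_on q y\<^sub>d y') \<and>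
      (\<forall>u'\<in>?U. \<alpha> * inner_on (cyl \<Omega> T) u u' + inner_on (cyl \<Omega> T) l u' = 0) \<and>
      (\<forall>l'\<in>?U. inner_on (cyl \<Omega> T) (?H y) l' + inner_on (cyl \<Omega> T) u l' = inner_on (cyl \<Omega> T) f l'))
    \<longleftrightarrow> x \<in> ?X \<and> (\<forall>(y', u', l')\<in>?X. S.a_form x (y', u', l')
      = inner (cut q y\<^sub>d) (cut q y') + inner 0 u' + inner f l')" for x
  proof -
    obtain y u l where x: "x = (y, u, l)" by (cases x)
    have 0: "0 \<in> ?Y" "0 \<in> ?U" "?H 0 = 0" "cut q 0 = 0"
      using subspace_0[OF S.Y] subspace_0[OF S.U] S.H_scale[of 0 0] S.Q_scale[of 0 0] by auto
    show ?thesis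
    proof (cases "y \<in> ?Y \<and> u \<in> ?U \<and> l \<in> ?U")
      case True
      note m = True heat_in_U_space[OF \<Omega>, of y T \<kappa>]
      have "(\<forall>(y', u', l')\<in>?X. S.a_form x (y', u', l') = inner (cut q y\<^sub>d) (cut q y') + inner 0 u' + inner f l')
        \<longleftrightarrow> (\<forall>y'\<in>?Y. inner (cut q y) (cut q y') + inner l (?H y') = inner (cut q y\<^sub>d) (cut q y')) \<and>
          (\<forall>u'\<in>?U. \<alpha> * inner u u' + inner l u' = 0) \<and>
          (\<forall>l'\<in>?U. inner (?H y) l' + inner u l' = inner f l')" (is "?L \<longleftrightarrow> ?R")
      proof
        assume L: ?L
        then have L: "S.a_form x (y', u', l') = inner (cut q y\<^sub>d) (cut q y') + inner 0 u' + inner f l'"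
          if "y' \<in> ?Y" "u' \<in> ?U" "l' \<in> ?U" for y' u' l'
          using that by (auto simp: X_space_def)
        \<comment> \<open>Testing with one nonzero component at a time separates the single equation
          into its three rows.\<close>
        show ?R
          using L[OF _ 0(2) 0(2)] L[OF 0(1) _ 0(2)] L[OF 0(1) 0(2)]
          by (auto simp: x S.a_form_def 0)
      next
        assume ?R
        then show ?L by (auto simp: x S.a_form_def X_space_def)
      qed
      then show ?thesis
        using m by (auto simp: x X_space_def inner_on_eq_cut[OF q] cut_U_space[OF \<Omega>] fU)
    next
      case False
      then show ?thesis by (auto simp: x X_space_def)
    qed
  qed
  show ?thesis
    unfolding iff using ex A_dual B_bij cond cos_sin_ratio by blast
qed

end
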